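(* Let $n$ be a positive integer, $\mathbf{g}=(g_0,\dots,g_{n-1})$ with $g_k\in H(\mathbb{D})$ for $0\leq k\leq n-1$, and $0<q<p<\infty$. The following are equivalent: (a) $I_{\mathbf{g}}^{(n)}:A^p\to A^q$ is bounded; (b) $I_{\mathbf{g}}^{(n)}:A^p\to A^q$ is compact; (c) for each $0\leq k\leq n-1$, $\int_{\mathbb{D}}\big|g_k(z)(1-|z|^2)^{n-k}\big|^{\frac{pq}{p-q}}\,dA(z)<\infty$.
   Context: $\mathbb{D}$ is the open unit disc, $H(\mathbb{D})$ the analytic functions on $\mathbb{D}$, $dA=\frac{dx\,dy}{\pi}$, and $A^p=\{f\in H(\mathbb{D}):\int_{\mathbb{D}}|f|^p\,dA<\infty\}$ is the Bergman space. $I$ is the integration operator $(If)(z)=\int_0^zf(w)\,dw$ and $I^n$ its $n$-th iterate; $I_{\mathbf{g}}^{(n)}f=I^n\big(fg_0+f'g_1+\cdots+f^{(n-1)}g_{n-1}\big)$. *)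

theory Defs
  imports "HOL-Complex_Analysis.Complex_Analysis"
begin

text \<open>Functions on the unit disc are represented as total functions complex \<Rightarrow> complex;
only their values on the open unit disc (ball 0 1) matter.\<close>

definition unit_disc :: "complex set" where
  "unit_disc = ball 0 1"

definition disc_int :: "(complex \<Rightarrow> real) \<Rightarrow> ennreal" where
  "disc_int u = (\<integral>\<^sup>+ z \<in> unit_disc. ennreal (u z) \<partial>lborel) / ennreal pi"

definition Bergman :: "real \<Rightarrow> (complex \<Rightarrow> complex) set" where
  "Bergman p = {f. f holomorphic_on unit_disc \<and> disc_int (\<lambda>z. cmod (f z) powr p) < \<infinity>}"

definition Bergman_norm :: "real \<Rightarrow> (complex \<Rightarrow> complex) \<Rightarrow> real" where
  "Bergman_norm p f = (enn2real (disc_int (\<lambda>z. cmod (f z) powr p))) powr (1 / p)"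

definition Iop :: "(complex \<Rightarrow> complex) \<Rightarrow> complex \<Rightarrow> complex" where
  "Iop f = (\<lambda>z. contour_integral (linepath 0 z) f)"

definition Ig :: "nat \<Rightarrow> (nat \<Rightarrow> complex \<Rightarrow> complex) \<Rightarrow> (complex \<Rightarrow> complex) \<Rightarrow> complex \<Rightarrow> complex" where
  "Ig n g f = (Iop ^^ n) (\<lambda>z. \<Sum>k<n. (deriv ^^ k) f z * g k z)"

definition bounded_op :: "real \<Rightarrow> real \<Rightarrow> ((complex \<Rightarrow> complex) \<Rightarrow> complex \<Rightarrow> complex) \<Rightarrow> bool" where
  "bounded_op p q T \<longleftrightarrow> (\<forall>f \<in> Bergman p. T f \<in> Bergman q) \<and>
     (\<exists>C. \<forall>f \<in> Bergman p. Bergman_norm q (T f) \<le> C * Bergman_norm p f)"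

definition compact_op :: "real \<Rightarrow> real \<Rightarrow> ((complex \<Rightarrow> complex) \<Rightarrow> complex \<Rightarrow> complex) \<Rightarrow> bool" where
  "compact_op p q T \<longleftrightarrow> (\<forall>f \<in> Bergman p. T f \<in> Bergman q) \<and>
     (\<forall>F :: nat \<Rightarrow> complex \<Rightarrow> complex. (\<forall>j. F j \<in> Bergman p) \<longrightarrow>
        (\<exists>M. \<forall>j. Bergman_norm p (F j) \<le> M) \<longrightarrow>
        (\<exists>r h. strict_mono r \<and> h \<in> Bergman q \<and>
           (\<lambda>j. Bergman_norm q (\<lambda>z. T (F (r j)) z - h z)) \<longlonglongrightarrow> 0))"

end

theory Submission
  imports Defs
begin

text \<open>The integral operator is inverted by \<open>n\<close> derivatives, so everything rests on two estimates. A
  Littlewood--Paley inequality bounds the norm of \<open>Iop F\<close> by the norm of \<open>F\<close> with weight \<open>1 - |z|\<close>, and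
  Cauchy's estimate, averaged over hyperbolic discs, gives the reverse bound for derivatives. Integrability
  of the coefficients then yields compactness by Young's inequality, normal families and dominated
  convergence. Conversely, boundedness is tested on sums \<open>\<Sum>a\<in>J. \<plusminus> l a * kern M p a\<close> over separated
  sets \<open>J\<close>. Averaging over the signs isolates one summand near each \<open>a\<close>, the coefficients \<open>g k\<close> are
  separated by using \<open>n\<close> consecutive exponents \<open>M\<close>, and the choice of \<open>l\<close> by
  duality turns the local integrals into the integrability condition with exponent \<open>p q / (p - q)\<close>.\<close>

section \<open>Local bounds for powers of holomorphic functions\<close>

text \<open>Both \<open>p\<close> and \<open>q\<close> may lie below 1. Then the Bergman norms are
  only quasi-norms, integral means along radii obey no Minkowski or Hardy inequality, and the spaces
  have no useful dual. Hence the Littlewood--Paley bound is obtained from a recurrence between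
  annuli, in which the number of dilated copies beats the constant of the quasi-triangle inequality,
  and duality is used for finite sequences only. The exponent p q / (p - q) appears because p / q
  and p / (p - q) are conjugate: Young's inequality pairs the q-th power of a derivative with that
  of a coefficient, and the finite sequences in l^(p/q) are tested against l^(p/(p-q)). In Young's
  inequality the p-th power may carry an arbitrarily small factor, while the rest has an integrable
  majorant independent of the argument; this gives compactness and not merely boundedness. Near
  \<open>a\<close> the k-th derivative of a kernel has the size of the kernel times
  \<open>bd a\<close> to the power -k, so all \<open>g k\<close> enter a test at the same scale, and
  no single exponent \<open>M\<close> can isolate one of them.\<close>

abbreviation bd :: "complex \<Rightarrow> real" where
  "bd z \<equiv> 1 - cmod z"

abbreviation dint :: "(complex \<Rightarrow> real) \<Rightarrow> ennreal" where
  "dint u \<equiv> (\<integral>\<^sup>+z\<in>unit_disc. ennreal (u z) \<partial>lborel)"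

lemma unit_disc_iff [simp]: "z \<in> unit_disc \<longleftrightarrow> cmod z < 1"
  by (simp add: unit_disc_def)

lemma open_unit_disc [simp, intro]: "open unit_disc"
  by (simp add: unit_disc_def)

lemma borel_unit_disc [measurable, simp]: "unit_disc \<in> sets borel"
  by (simp add: unit_disc_def)

lemma emeasure_complex_ball:
  "r \<ge> 0 \<Longrightarrow> emeasure lborel (ball (a::complex) r) = ennreal (pi * r\<^sup>2)"
  by (simp add: emeasure_ball unit_ball_vol_2)

lemma measurable_ennreal_indicator_continuous:
  fixes u :: "complex \<Rightarrow> real"
  assumes "continuous_on A u" "A \<in> sets borel"
  shows "(\<lambda>z. ennreal (u z) * indicator A z) \<in> borel_measurable borel"
proof -
  have "(\<lambda>z. ennreal (indicator A z *\<^sub>R u z)) \<in> borel_measurable borel"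
    using borel_measurable_continuous_on_indicator[OF assms(2,1)] by measurable
  also have "(\<lambda>z. ennreal (indicator A z *\<^sub>R u z)) = (\<lambda>z. ennreal (u z) * indicator A z)"
    by (auto simp: indicator_def)
  finally show ?thesis .
qed

lemma measurable_holomorphic_powr:
  assumes "f holomorphic_on unit_disc" "p > 0"
  shows "(\<lambda>z. ennreal (cmod (f z) powr p) * indicator unit_disc z) \<in> borel_measurable borel"
  using assms
  by (intro measurable_ennreal_indicator_continuous continuous_on_powr' continuous_intros
        holomorphic_on_imp_continuous_on) auto

text \<open>Weights occur with exponents of either sign, so comparability of the bases is
  transferred with a loss that depends on |g| only.\<close>

lemma powr_comparable:
  fixes x y A g :: real
  assumes "x > 0" "y > 0" "A \<ge> 1" "x \<le> A * y" "y \<le> A * x"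
  shows "x powr g \<le> A powr \<bar>g\<bar> * y powr g"
proof (cases "g \<ge> 0")
  case True
  have "x powr g \<le> (A * y) powr g" using assms True by (intro powr_mono2) auto
  then show ?thesis using True assms by (simp add: powr_mult)
next
  case False
  have "x powr g \<le> (y / A) powr g"
    using assms False by (intro powr_mono2') (auto simp: field_simps)
  also have "\<dots> = A powr (-g) * y powr g"
    using assms by (simp add: powr_divide powr_minus field_simps)
  finally show ?thesis using False by simp
qed

text \<open>Stands in for the triangle inequality: replacing both summands by the larger one works
  for exponents below 1 as well as above.\<close>

lemma power_add_le_powr:
  fixes x y q :: real
  assumes "x \<ge> 0" "y \<ge> 0" "q > 0"
  shows "(x + y) powr q \<le> 2 powr q * (x powr q + y powr q)"
proof -
  have "(x + y) powr q \<le> (2 * max x y) powr q"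
    using assms by (intro powr_mono2) auto
  also have "\<dots> = 2 powr q * max x y powr q" using assms by (simp add: powr_mult)
  also have "max x y powr q \<le> x powr q + y powr q" by (auto simp: max_def)
  finally show ?thesis by simp
qed

lemma powr_sum_le:
  fixes f :: "'a \<Rightarrow> real" and q :: real
  assumes "finite A" "q > 0" "\<And>i. i \<in> A \<Longrightarrow> f i \<ge> 0"
  shows "(\<Sum>i\<in>A. f i) powr q \<le> real (card A) powr q * (\<Sum>i\<in>A. f i powr q)"
proof (cases "A = {}")
  case False
  define m where "m = Max (f ` A)"
  have m: "\<And>i. i \<in> A \<Longrightarrow> f i \<le> m" using assms(1) by (simp add: m_def)
  have "m \<in> f ` A" unfolding m_def using assms(1) False by (intro Max_in) auto
  then obtain i where i: "i \<in> A" "m = f i" by auto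
  have "(\<Sum>i\<in>A. f i) \<le> real (card A) * m" using sum_bounded_above[of A f m] m by auto
  then have "(\<Sum>i\<in>A. f i) powr q \<le> (real (card A) * m) powr q"
    using assms by (intro powr_mono2 sum_nonneg) auto
  also have "\<dots> = real (card A) powr q * f i powr q" using assms i by (simp add: powr_mult)
  also have "f i powr q \<le> (\<Sum>i\<in>A. f i powr q)"
    using assms i by (intro member_le_sum) auto
  finally show ?thesis by (simp add: mult_left_mono)
qed simp

text \<open>Maximising \<open>|f z| (r - |z - a|) powr (2 / p)\<close> yields a ball on which Cauchy's estimate keeps
  \<open>f\<close> within half of its centre value; this needs no subharmonicity and covers \<open>p < 1\<close>.\<close>

lemma holomorphic_powr_local_bound:
  assumes "p > 0"
  shows "\<exists>C>0. \<forall>f (a::complex) r. r > 0 \<longrightarrow> f holomorphic_on ball a r \<longrightarrow>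
           ennreal (cmod (f a) powr p * r\<^sup>2)
             \<le> ennreal C * (\<integral>\<^sup>+z\<in>ball a r. ennreal (cmod (f z) powr p) \<partial>lborel)"
proof -
  define K :: real where "K = 2 powr (2 / p)"
  have K: "K \<ge> 1" using assms by (simp add: K_def ge_one_powr_ge_zero)
  define C where "C = 4 * 2 powr p * 64 * K\<^sup>2 / pi"
  have C: "C > 0" using K by (simp add: C_def)
  have "ennreal (cmod (f a) powr p * r\<^sup>2)
             \<le> ennreal C * (\<integral>\<^sup>+z\<in>ball a r. ennreal (cmod (f z) powr p) \<partial>lborel)"
    if r: "r > 0" and hol: "f holomorphic_on ball a r" for f and a :: complex and r
  proof -
    \<comment> \<open>Half the radius makes the closed disc a compact subset of the domain, so the
      maximum of \<open>ph\<close> is attained.\<close>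
    define s where "s = r / 2"
    have s: "s > 0" "cball a s \<subseteq> ball a r" using r by (auto simp: s_def)
    define ph where "ph = (\<lambda>z. cmod (f z) * (s - cmod (z - a)) powr (2 / p))"
    have contf: "continuous_on (cball a s) f"
      using hol s holomorphic_on_imp_continuous_on continuous_on_subset by blast
    have "continuous_on (cball a s) ph"
      unfolding ph_def using assms
      by (intro continuous_intros contf continuous_on_powr')
         (auto simp: dist_norm norm_minus_commute)
    then obtain z0 where z0: "z0 \<in> cball a s" and max: "\<And>z. z \<in> cball a s \<Longrightarrow> ph z \<le> ph z0"
      using continuous_attains_sup[of "cball a s" ph] s by auto
    have max_a: "cmod (f a) * s powr (2 / p) \<le> ph z0"
      using max[of a] s by (simp add: ph_def)
    define t where "t = s - cmod (z0 - a)"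
    have t0: "t \<ge> 0" using z0 by (simp add: t_def dist_norm norm_minus_commute)
    show ?thesis
    proof (cases "ph z0 = 0")
      case True
      have "cmod (f a) * s powr (2 / p) = 0"
        using max_a True s by (intro antisym) auto
      then have "f a = 0" using s by simp
      then show ?thesis using assms by simp
    next
      case False
      then have t: "t > 0"
        using t0 by (auto simp: ph_def t_def)
      \<comment> \<open>Within \<open>t / 2\<close> of the maximiser the base of the weight is still
        at least \<open>t / 2\<close>, so maximality loses only \<open>K\<close>, which is 2 to the
        power 2 / p.\<close>
      have near: "w \<in> cball a s" "cmod (f w) \<le> K * cmod (f z0)" if "cmod (w - z0) \<le> t / 2" for w
      proof -
        have "cmod (w - a) \<le> cmod (w - z0) + cmod (z0 - a)"
          using norm_triangle_ineq[of "w - z0" "z0 - a"] by simp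
        then have half: "t / 2 \<le> s - cmod (w - a)" using that by (simp add: t_def)
        then show w: "w \<in> cball a s" using t by (auto simp: dist_norm norm_minus_commute)
        have "cmod (f w) * (t / 2) powr (2 / p) \<le> ph w"
          unfolding ph_def using half t assms by (intro mult_left_mono powr_mono2) auto
        also have "\<dots> \<le> cmod (f z0) * t powr (2 / p)" using max[OF w] by (simp add: ph_def t_def)
        also have "\<dots> = cmod (f z0) * K * (t / 2) powr (2 / p)"
          unfolding K_def using t by (simp add: powr_divide)
        finally show "cmod (f w) \<le> K * cmod (f z0)" using t by (simp add: mult_ac)
      qed
      have hol': "f holomorphic_on cball a s" using hol s holomorphic_on_subset by blast
      have sub: "ball z0 (t/2) \<subseteq> ball a r"
      proof
        fix x assume "x \<in> ball z0 (t/2)"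
        then have "cmod (x - z0) \<le> t / 2" by (simp add: dist_norm norm_minus_commute)
        then show "x \<in> ball a r" using near(1) s by blast
      qed
      have deriv_bd: "cmod (deriv f w) \<le> 4 * K * cmod (f z0) / t" if "cmod (w - z0) < t / 4" for w
      proof -
        have in1: "cmod (x - z0) \<le> t / 2" if "cmod (w - x) \<le> t / 4" for x
        proof -
          have "cmod (x - z0) \<le> cmod (w - x) + cmod (w - z0)"
            by (metis norm_minus_commute norm_triangle_sub diff_add_cancel add.commute
                  dist_norm dist_triangle3)
          then show ?thesis using that \<open>cmod (w - z0) < t / 4\<close> by simp
        qed
        have "cball w (t/4) \<subseteq> cball a s" using near(1) in1 by (auto simp: dist_norm)
        then have "norm ((deriv ^^ 1) f w) \<le> fact 1 * (K * cmod (f z0)) / (t / 4) ^ 1"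
          using t hol' contf in1 near(2)
          by (intro Cauchy_inequality)
             (auto intro: holomorphic_on_subset continuous_on_subset simp: subset_iff)
        then show ?thesis using t by (simp add: field_simps)
      qed
      \<comment> \<open>The derivative bound \<open>4 * K * cmod (f z0) / t\<close> times this
        radius is exactly \<open>cmod (f z0) / 2\<close>.\<close>
      define e where "e = t / (8 * K)"
      have e: "e > 0" "e \<le> t / 8" using t K by (auto simp: e_def field_simps)
      have lower: "cmod (f z0) / 2 \<le> cmod (f w)" if w: "w \<in> ball z0 e" for w
      proof -
        have "cmod (f w - f z0) \<le> (4 * K * cmod (f z0) / t) * cmod (w - z0)"
        proof (rule field_differentiable_bound[of "ball z0 (t/4)" f "deriv f"])
          show "(f has_field_derivative deriv f x) (at x within ball z0 (t/4))"
            if "x \<in> ball z0 (t/4)" for x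
          proof -
            have "t / 4 \<le> t / 2" using t by simp
            then have "x \<in> ball a r" using that sub subset_ball by blast
            then show ?thesis
              using hol holomorphic_derivI[of f "ball a r" x] by (simp add: has_field_derivative_at_within)
          qed
        qed (use deriv_bd e w t in \<open>auto simp: dist_norm norm_minus_commute\<close>)
        also have "\<dots> \<le> (4 * K * cmod (f z0) / t) * e"
          using w t K by (intro mult_left_mono) (auto simp: dist_norm norm_minus_commute)
        also have "\<dots> = cmod (f z0) / 2" using t K by (simp add: e_def field_simps)
        finally have "cmod (f w - f z0) \<le> cmod (f z0) / 2" .
        then show ?thesis using norm_triangle_ineq2[of "f z0" "f w"] by (simp add: norm_minus_commute)
      qed
      have be: "ball z0 e \<subseteq> ball a r" using subset_trans[OF subset_ball[of e "t/2" z0] sub] e t by linarith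
      have "ennreal ((cmod (f z0) / 2) powr p) * emeasure lborel (ball z0 e)
            = (\<integral>\<^sup>+z. ennreal ((cmod (f z0) / 2) powr p) * indicator (ball z0 e) z \<partial>lborel)"
        by (subst nn_integral_cmult_indicator) auto
      also have "\<dots> \<le> (\<integral>\<^sup>+z\<in>ball a r. ennreal (cmod (f z) powr p) \<partial>lborel)"
        using lower be assms
        by (intro nn_integral_mono) (auto split: split_indicator intro!: ennreal_leI powr_mono2)
      finally have int: "ennreal ((cmod (f z0) / 2) powr p * (pi * e\<^sup>2))
            \<le> (\<integral>\<^sup>+z\<in>ball a r. ennreal (cmod (f z) powr p) \<partial>lborel)"
        using e by (simp add: emeasure_complex_ball ennreal_mult)
      \<comment> \<open>This identity dictates the exponent 2 / p of the weight: its p-th power is a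
        squared radius, that is, an area.\<close>
      have sp: "(x powr (2 / p)) powr p = x\<^sup>2" if "x > 0" for x :: real
        using that assms by (simp add: powr_powr)
      have "(cmod (f a) * s powr (2 / p)) powr p \<le> (cmod (f z0) * t powr (2 / p)) powr p"
        using max_a assms s by (intro powr_mono2) (auto simp: ph_def t_def)
      then have "cmod (f a) powr p * s\<^sup>2 \<le> cmod (f z0) powr p * t\<^sup>2"
        using s t by (simp add: powr_mult sp)
      then have "cmod (f a) powr p * r\<^sup>2 \<le> 4 * (cmod (f z0) powr p * t\<^sup>2)"
        by (simp add: s_def power2_eq_square)
      also have "\<dots> = C * ((cmod (f z0) / 2) powr p * (pi * e\<^sup>2))"
        using K by (simp add: C_def e_def powr_divide power_divide power_mult_distrib)
      finally have "ennreal (cmod (f a) powr p * r\<^sup>2)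
          \<le> ennreal C * ennreal ((cmod (f z0) / 2) powr p * (pi * e\<^sup>2))"
        using C by (subst ennreal_mult[symmetric]) (auto intro!: ennreal_leI)
      also have "\<dots> \<le> ennreal C * (\<integral>\<^sup>+z\<in>ball a r. ennreal (cmod (f z) powr p) \<partial>lborel)"
        by (intro mult_left_mono int) auto
      finally show ?thesis .
    qed
  qed
  then show ?thesis using C by blast
qed

text \<open>The preceding bound, applied on balls of radius \<open>r / 2\<close> about the points of
  the half ball, yields a supremum bound \<open>B\<close> there; Cauchy's inequality on the half
  ball then pays \<open>r ^ k\<close> for \<open>k\<close> derivatives.\<close>

lemma holomorphic_deriv_powr_local_bound:
  assumes "p > 0"
  shows "\<exists>C>0. \<forall>f (a::complex) r. r > 0 \<longrightarrow> f holomorphic_on ball a r \<longrightarrow>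
           ennreal ((cmod ((deriv ^^ k) f a) * r ^ k) powr p * r\<^sup>2)
             \<le> ennreal C * (\<integral>\<^sup>+z\<in>ball a r. ennreal (cmod (f z) powr p) \<partial>lborel)"
proof -
  obtain C where C: "C > 0" and bound: "\<And>f (a::complex) r. r > 0 \<Longrightarrow> f holomorphic_on ball a r \<Longrightarrow>
           ennreal (cmod (f a) powr p * r\<^sup>2)
             \<le> ennreal C * (\<integral>\<^sup>+z\<in>ball a r. ennreal (cmod (f z) powr p) \<partial>lborel)"
    using holomorphic_powr_local_bound[OF assms] by blast
  define C' where "C' = (fact k * 2 ^ k) powr p * 4 * C"
  have C': "C' > 0" using C by (simp add: C'_def)
  have "ennreal ((cmod ((deriv ^^ k) f a) * r ^ k) powr p * r\<^sup>2)
             \<le> ennreal C' * (\<integral>\<^sup>+z\<in>ball a r. ennreal (cmod (f z) powr p) \<partial>lborel)"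
    if r: "r > 0" and hol: "f holomorphic_on ball a r" for f and a :: complex and r
  proof -
    define I where "I = (\<integral>\<^sup>+z\<in>ball a r. ennreal (cmod (f z) powr p) \<partial>lborel)"
    show ?thesis
    proof (cases "I = \<infinity>")
      case True
      then show ?thesis using C' by (simp add: I_def ennreal_mult_top)
    next
      case False
      define i where "i = enn2real I"
      have Ii: "I = ennreal i" "i \<ge> 0" using False by (auto simp: i_def top.not_eq_extremum)
      define B where "B = (4 * C * i / r\<^sup>2) powr (1 / p)"
      have Bp: "B powr p = 4 * C * i / r\<^sup>2"
        using assms Ii C by (simp add: B_def powr_powr)
      have fB: "cmod (f w) \<le> B" if w: "cmod (w - a) \<le> r / 2" for w
      proof -
        have sub: "ball w (r/2) \<subseteq> ball a r"
        proof
          fix x assume "x \<in> ball w (r/2)"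
          then have "dist w x < r / 2" by simp
          moreover have "dist a w \<le> r / 2" using w by (simp add: dist_norm norm_minus_commute)
          ultimately show "x \<in> ball a r" using dist_triangle[of a x w] by simp
        qed
        have "ennreal (cmod (f w) powr p * (r/2)\<^sup>2)
              \<le> ennreal C * (\<integral>\<^sup>+z\<in>ball w (r/2). ennreal (cmod (f z) powr p) \<partial>lborel)"
          using r hol sub by (intro bound) (auto intro: holomorphic_on_subset)
        also have "\<dots> \<le> ennreal C * I"
          unfolding I_def using sub
          by (intro mult_left_mono nn_integral_mono) (auto split: split_indicator)
        also have "\<dots> = ennreal (C * i)" using Ii C by (simp add: ennreal_mult)
        finally have "cmod (f w) powr p * (r/2)\<^sup>2 \<le> C * i"
          using Ii C by (subst (asm) ennreal_le_iff) auto
        then have "cmod (f w) powr p \<le> B powr p"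
          unfolding Bp using r by (simp add: field_simps power2_eq_square)
        then show ?thesis
          using assms powr_less_mono2[of p B "cmod (f w)"] by (force simp: B_def)
      qed
      have "cmod ((deriv ^^ k) f a) \<le> fact k * B / (r/2) ^ k"
      proof (rule Cauchy_inequality)
        show "f holomorphic_on ball a (r/2)" using hol r by (auto intro: holomorphic_on_subset)
        have "cball a (r/2) \<subseteq> ball a r" using r by auto
        then show "continuous_on (cball a (r/2)) f"
          using hol holomorphic_on_imp_continuous_on continuous_on_subset by blast
      qed (use r fB in \<open>auto simp: norm_minus_commute\<close>)
      then have "cmod ((deriv ^^ k) f a) * r ^ k \<le> (fact k * 2 ^ k) * B"
        using r by (simp add: field_simps)
      then have "(cmod ((deriv ^^ k) f a) * r ^ k) powr p \<le> ((fact k * 2 ^ k) * B) powr p"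
        using assms r by (intro powr_mono2) auto
      also have "\<dots> = (fact k * 2 ^ k) powr p * (4 * C * i / r\<^sup>2)"
        using Bp by (simp add: powr_mult B_def)
      finally have "(cmod ((deriv ^^ k) f a) * r ^ k) powr p * r\<^sup>2 \<le> C' * i"
        using r by (simp add: C'_def field_simps)
      then show ?thesis
        using Ii C' by (simp add: I_def ennreal_mult[symmetric] ennreal_leI)
    qed
  qed
  then show ?thesis using C' by blast
qed

section \<open>Averages over hyperbolic neighbourhoods\<close>

text \<open>A hyperbolic neighbourhood in Euclidean terms. For \<open>A\<close> \<ge> 1 the distance
  condition alone admits points arbitrarily close to the circle; the last condition keeps
  \<open>bd w\<close> above a multiple of \<open>bd z\<close>.\<close>

definition near :: "real \<Rightarrow> complex \<Rightarrow> complex set" where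
  "near A z = {w. cmod w < 1 \<and> cmod (w - z) \<le> A * bd z \<and> bd z \<le> A * bd w}"

lemma near_subset_disc: "near A z \<subseteq> unit_disc"
  by (auto simp: near_def)

lemma borel_near [measurable, simp]: "near A z \<in> sets borel"
  unfolding near_def by measurable

lemma measurable_indicator_near:
  "(\<lambda>(z, w). indicator unit_disc z * indicator (near A z) w :: ennreal)
     \<in> borel_measurable (borel \<Otimes>\<^sub>M borel)"
proof -
  let ?S = "{x \<in> space (borel \<Otimes>\<^sub>M borel). cmod (fst x) < 1 \<and> cmod (snd x) < 1 \<and>
      cmod (snd x - fst x) \<le> A * bd (fst x) \<and> bd (fst x) \<le> A * bd (snd x)}"
  have "?S \<in> sets (borel \<Otimes>\<^sub>M borel)" by measurable
  then have "(indicator ?S :: _ \<Rightarrow> ennreal) \<in> borel_measurable (borel \<Otimes>\<^sub>M borel)"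
    by (rule borel_measurable_indicator)
  also have "(indicator ?S :: _ \<Rightarrow> ennreal)
      = (\<lambda>(z, w). indicator unit_disc z * indicator (near A z) w)"
    by (auto simp: fun_eq_iff near_def space_pair_measure split: split_indicator)
  finally show ?thesis .
qed

lemma measurable_nn_integral_near:
  assumes [measurable]: "\<phi> \<in> borel_measurable borel"
  shows "(\<lambda>z. (\<integral>\<^sup>+w\<in>near A z. \<phi> w \<partial>lborel) * indicator unit_disc z) \<in> borel_measurable borel"
proof -
  have [measurable]: "(\<lambda>(z, w). indicator unit_disc z * indicator (near A z) w :: ennreal)
     \<in> borel_measurable (borel \<Otimes>\<^sub>M lborel)"
    using measurable_indicator_near[of A] by simp
  have "(\<lambda>z. \<integral>\<^sup>+w. \<phi> w * (case (z, w) of (z, w) \<Rightarrow> indicator unit_disc z * indicator (near A z) w) \<partial>lborel)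
      \<in> borel_measurable borel"
    by measurable
  also have "(\<lambda>z. \<integral>\<^sup>+w. \<phi> w * (case (z, w) of (z, w) \<Rightarrow> indicator unit_disc z * indicator (near A z) w) \<partial>lborel)
    = (\<lambda>z. (\<integral>\<^sup>+w\<in>near A z. \<phi> w \<partial>lborel) * indicator unit_disc z)"
    by (auto simp: fun_eq_iff split: split_indicator)
  finally show ?thesis .
qed

text \<open>Tonelli's theorem. For fixed \<open>w\<close> the admissible \<open>z\<close> lie in a
  ball of radius comparable to \<open>bd w\<close>, and there \<open>bd z\<close> is comparable to
  \<open>bd w\<close>; the area of that ball supplies the two powers between \<open>b - 2\<close>
  and \<open>b\<close>.\<close>

lemma nn_integral_near_le:
  assumes A: "A \<ge> 1"
  shows "\<exists>K>0. \<forall>\<phi>\<in>borel_measurable borel.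
    (\<integral>\<^sup>+z\<in>unit_disc. ennreal (bd z powr (b - 2)) * (\<integral>\<^sup>+w\<in>near A z. \<phi> w \<partial>lborel) \<partial>lborel)
      \<le> ennreal K * (\<integral>\<^sup>+w\<in>unit_disc. \<phi> w * ennreal (bd w powr b) \<partial>lborel)"
proof -
  define L where "L = (1 + A\<^sup>2) powr \<bar>b - 2\<bar>"
  define K where "K = L * (4 * pi * A ^ 4)"
  have L: "L > 0" using A add_pos_nonneg[of 1 "A\<^sup>2"] by (simp add: L_def)
  have K: "K > 0" using A L by (simp add: K_def)
  have "(\<integral>\<^sup>+z\<in>unit_disc. ennreal (bd z powr (b - 2)) * (\<integral>\<^sup>+w\<in>near A z. \<phi> w \<partial>lborel) \<partial>lborel)
      \<le> ennreal K * (\<integral>\<^sup>+w\<in>unit_disc. \<phi> w * ennreal (bd w powr b) \<partial>lborel)"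
    if [measurable]: "\<phi> \<in> borel_measurable borel" for \<phi>
  proof -
    define G where "G = (\<lambda>z w. ennreal (bd z powr (b - 2)) * \<phi> w
        * (case (z, w) of (z, w) \<Rightarrow> indicator unit_disc z * indicator (near A z) w))"
    have [measurable]: "(\<lambda>(z, w). indicator unit_disc z * indicator (near A z) w :: ennreal)
       \<in> borel_measurable (lborel \<Otimes>\<^sub>M lborel)"
      using measurable_indicator_near[of A] by simp
    have G: "case_prod G \<in> borel_measurable (lborel \<Otimes>\<^sub>M lborel)"
      unfolding G_def by measurable
    have inner: "(\<integral>\<^sup>+z. G z w \<partial>lborel)
        \<le> ennreal K * (\<phi> w * ennreal (bd w powr b) * indicator unit_disc w)" for w
    proof (cases "w \<in> unit_disc")
      case False
      then have "G z w = 0" for z by (auto simp: G_def near_def)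
      then show ?thesis by simp
    next
      case True
      have bw: "bd w > 0" using True by simp
      have pt: "G z w \<le> ennreal (L * bd w powr (b - 2)) * \<phi> w * indicator (ball w (2 * A\<^sup>2 * bd w)) z" for z
      proof (cases "z \<in> unit_disc \<and> w \<in> near A z")
        case False
        then have "G z w = 0" by (auto simp: G_def)
        then show ?thesis by simp
      next
        case True
        then have z: "bd z > 0" "cmod (w - z) \<le> A * bd z" "bd z \<le> A * bd w"
          by (auto simp: near_def)
        have "cmod (w - z) \<le> A * (A * bd w)" using z A by (meson mult_left_mono order.trans zero_le_one)
        \<comment> \<open>The factor 2 makes the inequality strict, as membership in the open ball
          requires.\<close>
        also have "\<dots> < 2 * A\<^sup>2 * bd w" using A bw by (simp add: power2_eq_square)
        finally have zb: "z \<in> ball w (2 * A\<^sup>2 * bd w)" by (simp add: dist_norm)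
        have "bd w \<le> bd z + cmod (w - z)" using norm_triangle_ineq3[of z w] by (simp add: norm_minus_commute)
        then have "bd w \<le> (1 + A) * bd z" using z by (simp add: algebra_simps)
        also have "\<dots> \<le> (1 + A\<^sup>2) * bd z"
          using z(1) A by (intro mult_right_mono) (auto simp: power2_eq_square)
        finally have 1: "bd w \<le> (1 + A\<^sup>2) * bd z" .
        have "bd z \<le> A * bd w" by fact
        also have "\<dots> \<le> (1 + A\<^sup>2) * bd w"
        proof (intro mult_right_mono)
          show "A \<le> 1 + A\<^sup>2" using A mult_left_mono[of 1 A A] unfolding power2_eq_square by linarith
        qed (use bw in simp)
        finally have 2: "bd z \<le> (1 + A\<^sup>2) * bd w" .
        have "bd z powr (b - 2) \<le> L * bd w powr (b - 2)"
          unfolding L_def using 1 2 z bw A by (intro powr_comparable) auto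
        then have "ennreal (bd z powr (b - 2)) * \<phi> w \<le> ennreal (L * bd w powr (b - 2)) * \<phi> w"
          by (intro mult_right_mono ennreal_leI) auto
        then show ?thesis using True zb by (simp add: G_def)
      qed
      have "(\<integral>\<^sup>+z. G z w \<partial>lborel)
         \<le> (\<integral>\<^sup>+z. ennreal (L * bd w powr (b - 2)) * \<phi> w * indicator (ball w (2 * A\<^sup>2 * bd w)) z \<partial>lborel)"
        by (intro nn_integral_mono pt)
      also have "\<dots> = ennreal (L * bd w powr (b - 2)) * \<phi> w * emeasure lborel (ball w (2 * A\<^sup>2 * bd w))"
        by (subst nn_integral_cmult_indicator) auto
      also have "\<dots> = \<phi> w * (ennreal (L * bd w powr (b - 2)) * ennreal (pi * (2 * A\<^sup>2 * bd w)\<^sup>2))"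
        using bw A by (subst emeasure_complex_ball) (auto simp: mult_ac)
      also have "ennreal (L * bd w powr (b - 2)) * ennreal (pi * (2 * A\<^sup>2 * bd w)\<^sup>2)
          = ennreal (L * bd w powr (b - 2) * (pi * (2 * A\<^sup>2 * bd w)\<^sup>2))"
        using L by (subst ennreal_mult) auto
      also have "L * bd w powr (b - 2) * (pi * (2 * A\<^sup>2 * bd w)\<^sup>2)
          = K * (bd w powr (b - 2) * bd w powr 2)"
        using bw by (simp add: K_def power2_eq_square power4_eq_xxxx)
      also have "bd w powr (b - 2) * bd w powr 2 = bd w powr b"
        by (simp add: powr_add[symmetric])
      finally have "(\<integral>\<^sup>+z. G z w \<partial>lborel) \<le> \<phi> w * ennreal (K * bd w powr b)" .
      then show ?thesis using True K by (simp add: ennreal_mult mult_ac)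
    qed
    have "(\<integral>\<^sup>+z\<in>unit_disc. ennreal (bd z powr (b - 2)) * (\<integral>\<^sup>+w\<in>near A z. \<phi> w \<partial>lborel) \<partial>lborel)
        = (\<integral>\<^sup>+z. (\<integral>\<^sup>+w. G z w \<partial>lborel) \<partial>lborel)"
    proof (intro nn_integral_cong)
      fix z
      have "(\<integral>\<^sup>+w. G z w \<partial>lborel)
          = (\<integral>\<^sup>+w. (ennreal (bd z powr (b - 2)) * indicator unit_disc z) * (\<phi> w * indicator (near A z) w) \<partial>lborel)"
        by (simp add: G_def mult_ac)
      also have "\<dots> = (ennreal (bd z powr (b - 2)) * indicator unit_disc z)
          * (\<integral>\<^sup>+w. \<phi> w * indicator (near A z) w \<partial>lborel)"
        by (intro nn_integral_cmult) simp
      finally show "ennreal (bd z powr (b - 2)) * (\<integral>\<^sup>+w\<in>near A z. \<phi> w \<partial>lborel) * indicator unit_disc z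
          = (\<integral>\<^sup>+w. G z w \<partial>lborel)"
        by (simp add: mult_ac)
    qed
    also have "\<dots> = (\<integral>\<^sup>+w. (\<integral>\<^sup>+z. G z w \<partial>lborel) \<partial>lborel)"
      using lborel_pair.Fubini'[OF G] by simp
    also have "\<dots> \<le> (\<integral>\<^sup>+w. ennreal K * (\<phi> w * ennreal (bd w powr b) * indicator unit_disc w) \<partial>lborel)"
      by (intro nn_integral_mono inner)
    also have "\<dots> = ennreal K * (\<integral>\<^sup>+w\<in>unit_disc. \<phi> w * ennreal (bd w powr b) \<partial>lborel)"
      by (intro nn_integral_cmult) auto
    finally show ?thesis .
  qed
  then show ?thesis using K by blast
qed

text \<open>The local bound on \<open>ball w (bd w / 2)\<close>, with this ball enlarged to a
  neighbourhood of \<open>z\<close> that does not depend on \<open>w\<close>. The factor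
  \<open>bd z powr (- 2)\<close> normalises by area, so the right-hand side is an average to which
  \<open>nn_integral_near_le\<close> applies.\<close>

lemma deriv_powr_near_bound:
  assumes q: "q > 0" and A: "A \<ge> 1"
  shows "\<exists>C>0. \<forall>f z w. f holomorphic_on unit_disc \<longrightarrow> cmod z < 1 \<longrightarrow> w \<in> near A z \<longrightarrow>
    ennreal ((cmod ((deriv ^^ k) f w) * bd z ^ k) powr q)
      \<le> ennreal C * (ennreal (bd z powr (- 2))
           * (\<integral>\<^sup>+x\<in>near (2 * A + 1) z. ennreal (cmod (f x) powr q) \<partial>lborel))"
proof -
  obtain C where C: "C > 0" and bound: "\<And>f (a::complex) r. r > 0 \<Longrightarrow> f holomorphic_on ball a r \<Longrightarrow>
           ennreal ((cmod ((deriv ^^ k) f a) * r ^ k) powr q * r\<^sup>2)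
             \<le> ennreal C * (\<integral>\<^sup>+z\<in>ball a r. ennreal (cmod (f z) powr q) \<partial>lborel)"
    using holomorphic_deriv_powr_local_bound[OF q] by blast
  define L where "L = (((2 * A) ^ k) powr q * (2 * A)\<^sup>2)"
  have L: "L > 0" using A by (simp add: L_def)
  have "ennreal ((cmod ((deriv ^^ k) f w) * bd z ^ k) powr q)
      \<le> ennreal (L * C) * (ennreal (bd z powr (- 2))
           * (\<integral>\<^sup>+x\<in>near (2 * A + 1) z. ennreal (cmod (f x) powr q) \<partial>lborel))"
    if hol: "f holomorphic_on unit_disc" and z: "cmod z < 1" and w: "w \<in> near A z" for f z w
  proof -
    define r where "r = bd w / 2"
    have w': "cmod w < 1" "cmod (w - z) \<le> A * bd z" "bd z \<le> A * bd w"
      using w by (auto simp: near_def)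
    have r: "r > 0" "bd z \<le> 2 * A * r" using w' by (auto simp: r_def)
    have bwz: "bd w \<le> (1 + A) * bd z"
      using w' norm_triangle_ineq3[of z w] by (simp add: norm_minus_commute algebra_simps)
    have sub: "ball w r \<subseteq> near (2 * A + 1) z"
    proof
      fix x assume "x \<in> ball w r"
      then have xw: "cmod (x - w) < r" by (simp add: dist_norm norm_minus_commute)
      have bx: "bd x > r"
        using norm_triangle_ineq2[of x w] xw by (simp add: r_def)
      have "cmod (x - z) \<le> cmod (x - w) + cmod (w - z)"
        using norm_triangle_ineq[of "x - w" "w - z"] by simp
      also have "\<dots> \<le> (1 + A) * bd z / 2 + A * bd z" using xw w' bwz by (simp add: r_def)
      also have "\<dots> = ((1 + A) / 2 + A) * bd z" by (simp add: field_simps)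
      also have "\<dots> \<le> (2 * A + 1) * bd z" using z A by (intro mult_right_mono) auto
      finally have 1: "cmod (x - z) \<le> (2 * A + 1) * bd z" .
      have "bd z \<le> 2 * A * bd x" using r bx A by (smt (verit) mult_left_mono)
      also have "\<dots> \<le> (2 * A + 1) * bd x" using bx r by (intro mult_right_mono) auto
      finally show "x \<in> near (2 * A + 1) z" using 1 bx r by (simp add: near_def)
    qed
    have "(cmod ((deriv ^^ k) f w) * bd z ^ k) powr q * bd z ^ 2
        \<le> (cmod ((deriv ^^ k) f w) * (2 * A * r) ^ k) powr q * (2 * A * r) ^ 2"
      using z r q A by (intro mult_mono powr_mono2 power_mono mult_left_mono) auto
    also have "\<dots> = L * ((cmod ((deriv ^^ k) f w) * r ^ k) powr q * r\<^sup>2)"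
      using A r by (simp add: L_def power_mult_distrib powr_mult)
    finally have le: "(cmod ((deriv ^^ k) f w) * bd z ^ k) powr q
        \<le> bd z powr (-2) * (L * ((cmod ((deriv ^^ k) f w) * r ^ k) powr q * r\<^sup>2))"
      using z by (simp add: powr_minus field_simps)
    have "ennreal ((cmod ((deriv ^^ k) f w) * bd z ^ k) powr q)
      \<le> ennreal (bd z powr (-2)) * (ennreal L * ennreal ((cmod ((deriv ^^ k) f w) * r ^ k) powr q * r\<^sup>2))"
      using ennreal_leI[OF le] L by (simp add: ennreal_mult)
    also have "\<dots> \<le> ennreal (bd z powr (-2)) * (ennreal L * (ennreal C * (\<integral>\<^sup>+x\<in>near (2 * A + 1) z. ennreal (cmod (f x) powr q) \<partial>lborel)))"
    proof (intro mult_left_mono)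
      have "ennreal ((cmod ((deriv ^^ k) f w) * r ^ k) powr q * r\<^sup>2)
        \<le> ennreal C * (\<integral>\<^sup>+z\<in>ball w r. ennreal (cmod (f z) powr q) \<partial>lborel)"
        using subset_trans[OF sub near_subset_disc] r by (intro bound holomorphic_on_subset[OF hol]) auto
      also have "\<dots> \<le> ennreal C * (\<integral>\<^sup>+x\<in>near (2 * A + 1) z. ennreal (cmod (f x) powr q) \<partial>lborel)"
        using sub by (intro nn_integral_mono mult_left_mono) (auto split: split_indicator)
      finally show "ennreal ((cmod ((deriv ^^ k) f w) * r ^ k) powr q * r\<^sup>2)
        \<le> ennreal C * (\<integral>\<^sup>+x\<in>near (2 * A + 1) z. ennreal (cmod (f x) powr q) \<partial>lborel)" .
    qed auto
    finally show ?thesis using L C by (simp add: ennreal_mult mult_ac)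
  qed
  then show ?thesis using L C by (intro exI[of _ "L * C"]) auto
qed

lemma near_indicator_absorb:
  "(\<integral>\<^sup>+x\<in>near A z. \<phi> x * indicator unit_disc x \<partial>lborel) = (\<integral>\<^sup>+x\<in>near A z. \<phi> x \<partial>lborel)"
  using near_subset_disc[of A z] by (intro nn_integral_cong) (auto split: split_indicator)

text \<open>The local bound at \<open>w = z\<close> is integrated, and the averages disappear by
  \<open>nn_integral_near_le\<close> with \<open>b = 0\<close>. It serves twice: with
  \<open>q\<close> for the n-th derivative of \<open>Ig n g f\<close>, and with \<open>p\<close> for
  the derivatives of \<open>f\<close>.\<close>

lemma weighted_deriv_le:
  assumes q: "q > 0"
  shows "\<exists>C>0. \<forall>f. f holomorphic_on unit_disc \<longrightarrow>
    dint (\<lambda>z. (cmod ((deriv ^^ k) f z) * bd z ^ k) powr q)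
      \<le> ennreal C * dint (\<lambda>z. cmod (f z) powr q)"
proof -
  obtain C where C: "C > 0" and bound: "\<And>f z w. f holomorphic_on unit_disc \<Longrightarrow> cmod z < 1 \<Longrightarrow> w \<in> near 1 z \<Longrightarrow>
    ennreal ((cmod ((deriv ^^ k) f w) * bd z ^ k) powr q)
      \<le> ennreal C * (ennreal (bd z powr (- 2))
           * (\<integral>\<^sup>+x\<in>near 3 z. ennreal (cmod (f x) powr q) \<partial>lborel))"
    using deriv_powr_near_bound[OF q, of 1 k] by auto
  obtain K where K: "K > 0" and ton: "\<And>\<phi>. \<phi> \<in> borel_measurable borel \<Longrightarrow>
    (\<integral>\<^sup>+z\<in>unit_disc. ennreal (bd z powr (0 - 2)) * (\<integral>\<^sup>+w\<in>near 3 z. \<phi> w \<partial>lborel) \<partial>lborel)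
      \<le> ennreal K * (\<integral>\<^sup>+w\<in>unit_disc. \<phi> w * ennreal (bd w powr 0) \<partial>lborel)"
    using nn_integral_near_le[of 3 0] by auto
  have "dint (\<lambda>z. (cmod ((deriv ^^ k) f z) * bd z ^ k) powr q)
      \<le> ennreal (C * K) * dint (\<lambda>z. cmod (f z) powr q)"
    if hol: "f holomorphic_on unit_disc" for f
  proof -
    define \<phi> where "\<phi> = (\<lambda>x. ennreal (cmod (f x) powr q) * indicator unit_disc x)"
    have [measurable]: "\<phi> \<in> borel_measurable borel"
      unfolding \<phi>_def by (rule measurable_holomorphic_powr[OF hol q])
    have [measurable]: "(\<lambda>z. (\<integral>\<^sup>+w\<in>near 3 z. \<phi> w \<partial>lborel) * indicator unit_disc z) \<in> borel_measurable borel"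
      by (rule measurable_nn_integral_near) simp
    have "dint (\<lambda>z. (cmod ((deriv ^^ k) f z) * bd z ^ k) powr q)
      \<le> (\<integral>\<^sup>+z. ennreal C * (ennreal (bd z powr (0 - 2)) * ((\<integral>\<^sup>+w\<in>near 3 z. \<phi> w \<partial>lborel) * indicator unit_disc z)) \<partial>lborel)"
    proof (intro nn_integral_mono)
      fix z :: complex
      show "ennreal ((cmod ((deriv ^^ k) f z) * bd z ^ k) powr q) * indicator unit_disc z
        \<le> ennreal C * (ennreal (bd z powr (0 - 2)) * ((\<integral>\<^sup>+w\<in>near 3 z. \<phi> w \<partial>lborel) * indicator unit_disc z))"
      proof (cases "z \<in> unit_disc")
        case True
        then show ?thesis
          using bound[OF hol, of z z] unfolding \<phi>_def near_indicator_absorb by (simp add: near_def)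
      qed simp
    qed
    also have "\<dots> = ennreal C * (\<integral>\<^sup>+z. ennreal (bd z powr (0 - 2)) * ((\<integral>\<^sup>+w\<in>near 3 z. \<phi> w \<partial>lborel) * indicator unit_disc z) \<partial>lborel)"
      by (intro nn_integral_cmult) measurable
    also have "\<dots> \<le> ennreal C * (ennreal K * (\<integral>\<^sup>+w\<in>unit_disc. \<phi> w * ennreal (bd w powr 0) \<partial>lborel))"
      using ton[of \<phi>] by (intro mult_left_mono) (auto simp: mult.assoc)
    also have "(\<integral>\<^sup>+w\<in>unit_disc. \<phi> w * ennreal (bd w powr 0) \<partial>lborel)
        = dint (\<lambda>z. cmod (f z) powr q)"
      by (intro nn_integral_cong) (auto simp: \<phi>_def split: split_indicator)
    finally show ?thesis using C K by (simp add: ennreal_mult mult.assoc)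
  qed
  then show ?thesis using C K by (intro exI[of _ "C * K"]) auto
qed

text \<open>The condition on \<rho> places the whole segment from \<rho> z to \<open>z\<close> in
  \<open>near A z\<close>. There one number \<open>B\<close>, an average of the derivative, bounds
  \<open>deriv F\<close>, and the segment is no longer than \<open>A * bd z\<close>. The mean value
  inequality thus replaces integration along the radius, which would need \<open>q\<close> \<ge>
  1.\<close>

lemma radial_difference_bound:
  assumes q: "q > 0" and A: "A \<ge> 1"
  shows "\<exists>C>0. \<forall>F z \<rho>. F holomorphic_on unit_disc \<longrightarrow> cmod z < 1 \<longrightarrow> 0 \<le> \<rho> \<longrightarrow> \<rho> \<le> 1 \<longrightarrow>
    1 - \<rho> * cmod z \<le> A * bd z \<longrightarrow>
    ennreal (cmod (F z - F (of_real \<rho> * z)) powr q)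
      \<le> ennreal C * (ennreal (bd z powr (q - 2))
           * (\<integral>\<^sup>+x\<in>near (2 * A + 1) z. ennreal (cmod (deriv F x) powr q) \<partial>lborel))"
proof -
  obtain C where C: "C > 0" and bound: "\<And>f z w. f holomorphic_on unit_disc \<Longrightarrow> cmod z < 1 \<Longrightarrow> w \<in> near A z \<Longrightarrow>
    ennreal ((cmod ((deriv ^^ 0) f w) * bd z ^ 0) powr q)
      \<le> ennreal C * (ennreal (bd z powr (- 2))
           * (\<integral>\<^sup>+x\<in>near (2 * A + 1) z. ennreal (cmod (f x) powr q) \<partial>lborel))"
    using deriv_powr_near_bound[OF q A, of 0] by blast
  define C' where "C' = A powr q * C"
  have C': "C' > 0" using C A by (simp add: C'_def)
  have "ennreal (cmod (F z - F (of_real \<rho> * z)) powr q)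
      \<le> ennreal C' * (ennreal (bd z powr (q - 2))
           * (\<integral>\<^sup>+x\<in>near (2 * A + 1) z. ennreal (cmod (deriv F x) powr q) \<partial>lborel))"
    if hol: "F holomorphic_on unit_disc" and z: "cmod z < 1" and \<rho>: "0 \<le> \<rho>" "\<rho> \<le> 1"
      and le: "1 - \<rho> * cmod z \<le> A * bd z" for F z \<rho>
  proof -
    define I where "I = (\<integral>\<^sup>+x\<in>near (2 * A + 1) z. ennreal (cmod (deriv F x) powr q) \<partial>lborel)"
    show ?thesis
    proof (cases "I = \<infinity>")
      case True
      then show ?thesis using C' z by (simp add: I_def ennreal_mult_top)
    next
      case False
      define i where "i = enn2real I"
      have Ii: "I = ennreal i" "i \<ge> 0" using False by (auto simp: i_def top.not_eq_extremum)
      define B where "B = (C * (bd z powr (- 2) * i)) powr (1 / q)"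
      have Bq: "B powr q = C * (bd z powr (- 2) * i)"
        using q Ii C by (simp add: B_def powr_powr)
      have hold: "deriv F holomorphic_on unit_disc" using hol by (intro holomorphic_deriv) auto
      have dB: "cmod (deriv F w) \<le> B" if w: "w \<in> closed_segment (of_real \<rho> * z) z" for w
      proof -
        obtain u where u: "0 \<le> u" "u \<le> 1" "w = (1 - u) *\<^sub>R (of_real \<rho> * z) + u *\<^sub>R z"
          using w by (auto simp: in_segment)
        define t where "t = (1 - u) * \<rho> + u"
        have wt: "w = of_real t * z" using u by (simp add: t_def scaleR_conv_of_real algebra_simps)
        have "(1 - u) * \<rho> \<le> (1 - u) * 1" using u \<rho> by (intro mult_left_mono) auto
        then have t1: "t \<le> 1" by (simp add: t_def)
        have "u * \<rho> \<le> u" using u \<rho> mult_left_mono[of \<rho> 1 u] by simp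
        then have t2: "\<rho> \<le> t" by (simp add: t_def algebra_simps)
        have t3: "t * cmod z \<le> cmod z" using t1 mult_right_mono[of t 1 "cmod z"] by simp
        have t4: "\<rho> * cmod z \<le> t * cmod z" using t2 by (intro mult_right_mono) auto
        have nw: "cmod w = t * cmod z" using t2 \<rho> by (simp add: wt norm_mult)
        have "w - z = of_real (t - 1) * z" by (simp add: wt algebra_simps)
        then have "cmod (w - z) = (1 - t) * cmod z" using t1 by (simp add: norm_mult del: of_real_diff)
        then have 1: "cmod (w - z) \<le> A * bd z" using t4 le z by (simp add: algebra_simps)
        have "bd z \<le> bd w" using nw t3 by simp
        also have "\<dots> \<le> A * bd w" using A nw t3 z mult_right_mono[of 1 A "bd w"] by simp
        finally have "w \<in> near A z" using 1 nw t3 z by (simp add: near_def)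
        from bound[OF hold z this]
        have "ennreal (cmod (deriv F w) powr q) \<le> ennreal C * (ennreal (bd z powr (- 2)) * ennreal i)"
          using Ii by (simp add: I_def)
        also have "\<dots> = ennreal (B powr q)" using C Ii by (simp add: Bq ennreal_mult)
        finally have "cmod (deriv F w) powr q \<le> B powr q" by (simp add: ennreal_le_iff)
        then show ?thesis using q powr_less_mono2[of q B "cmod (deriv F w)"] by (force simp: B_def)
      qed
      have seg: "closed_segment (of_real \<rho> * z) z \<subseteq> unit_disc"
      proof (rule closed_segment_subset)
        show "convex unit_disc" by (simp add: unit_disc_def)
        show "of_real \<rho> * z \<in> unit_disc"
          using \<rho> z mult_right_mono[of \<rho> 1 "cmod z"] by (simp add: norm_mult)
      qed (use z in simp)
      have "cmod (F z - F (of_real \<rho> * z)) \<le> B * cmod (z - of_real \<rho> * z)"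
      proof (rule field_differentiable_bound[OF convex_closed_segment _ dB])
        show "(F has_field_derivative deriv F x) (at x within closed_segment (of_real \<rho> * z) z)"
          if "x \<in> closed_segment (of_real \<rho> * z) z" for x
          using hol seg that holomorphic_derivI[of F unit_disc x] by blast
      qed auto
      also have "z - of_real \<rho> * z = of_real (1 - \<rho>) * z" by (simp add: algebra_simps)
      also have "cmod \<dots> = (1 - \<rho>) * cmod z" using \<rho> by (simp add: norm_mult del: of_real_diff)
      also have "B * ((1 - \<rho>) * cmod z) \<le> B * (A * bd z)"
        using le z by (intro mult_left_mono) (auto simp: algebra_simps B_def)
      finally have "cmod (F z - F (of_real \<rho> * z)) powr q \<le> (B * (A * bd z)) powr q"
        using q by (intro powr_mono2) auto
      also have "\<dots> = C' * (bd z powr (- 2) * bd z powr q * i)"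
        using Bq A z by (simp add: powr_mult B_def C'_def)
      also have "bd z powr (- 2) * bd z powr q = bd z powr (q - 2)"
        by (simp add: powr_add[symmetric])
      finally have "cmod (F z - F (of_real \<rho> * z)) powr q \<le> C' * (bd z powr (q - 2) * i)" .
      from ennreal_leI[OF this] show ?thesis
        using Ii C' by (simp add: I_def ennreal_mult)
    qed
  qed
  then show ?thesis using C' by blast
qed

section \<open>Littlewood--Paley inequality\<close>

lemma nn_integral_dilation:
  fixes \<psi> :: "complex \<Rightarrow> ennreal"
  assumes [measurable]: "\<psi> \<in> borel_measurable borel" and "\<rho> > 0"
  shows "(\<integral>\<^sup>+z. \<psi> z \<partial>lborel) = ennreal (\<rho>\<^sup>2) * (\<integral>\<^sup>+z. \<psi> (of_real \<rho> * z) \<partial>lborel)"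
proof -
  have "(\<integral>\<^sup>+z. \<psi> z \<partial>lborel)
      = (\<integral>\<^sup>+z. \<psi> z \<partial>density (distr lborel borel (\<lambda>x. 0 + \<rho> *\<^sub>R x)) (\<lambda>_. \<bar>\<rho>\<bar> ^ DIM(complex)))"
    using lborel_affine[of \<rho> "0::complex"] assms(2) by simp
  also have "\<dots> = (\<integral>\<^sup>+z. ennreal (\<rho>\<^sup>2) * \<psi> (of_real \<rho> * z) \<partial>lborel)"
    by (simp add: nn_integral_density nn_integral_distr scaleR_conv_of_real)
  also have "\<dots> = ennreal (\<rho>\<^sup>2) * (\<integral>\<^sup>+z. \<psi> (of_real \<rho> * z) \<partial>lborel)"
    by (intro nn_integral_cmult) auto
  finally show ?thesis .
qed

section \<open>Annuli and averages over dilations\<close>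

definition annulus :: "real \<Rightarrow> real \<Rightarrow> complex set" where
  "annulus a b = {z. a \<le> cmod z \<and> cmod z < b}"

lemma borel_annulus [measurable, simp]: "annulus a b \<in> sets borel"
  unfolding annulus_def by measurable

lemma nn_integral_ring_split:
  assumes [measurable]: "\<psi> \<in> borel_measurable borel" and "a \<le> b" "b \<le> c"
  shows "(\<integral>\<^sup>+z\<in>annulus a c. \<psi> z \<partial>lborel) = (\<integral>\<^sup>+z\<in>annulus a b. \<psi> z \<partial>lborel) + (\<integral>\<^sup>+z\<in>annulus b c. \<psi> z \<partial>lborel)"
  using assms
  by (subst nn_integral_add[symmetric])
     (auto intro!: nn_integral_cong simp: annulus_def split: split_indicator)

lemma nn_integral_rings:
  fixes s :: "nat \<Rightarrow> real"
  assumes \<psi>: "\<psi> \<in> borel_measurable borel" and s: "\<And>i. s i \<le> s (Suc i)"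
  shows "(\<Sum>i<n. \<integral>\<^sup>+z\<in>annulus (s i) (s (Suc i)). \<psi> z \<partial>lborel) = (\<integral>\<^sup>+z\<in>annulus (s 0) (s n). \<psi> z \<partial>lborel)"
proof (induction n)
  case 0
  have "annulus (s 0) (s 0) = {}" by (auto simp: annulus_def)
  then show ?case by simp
next
  case (Suc n)
  have "s 0 \<le> s n" using s lift_Suc_mono_le[of s 0 n] by simp
  then show ?case using Suc nn_integral_ring_split[OF \<psi> _ s, of "s 0" n] by simp
qed

text \<open>The annuli \<open>r k \<le> |z| < r (k + 1)\<close> shrink by the factor \<open>m\<close>, so that \<open>m\<close> dilated copies of an annulus
  fit side by side into the preceding one. Averaging over these dilations gives the contraction.\<close>

context
  fixes m :: nat and r :: "nat \<Rightarrow> real"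
  assumes m: "m \<ge> 2" and r_def: "r = (\<lambda>k. 1 - 1 / real m ^ k)"
begin

lemma ring_bd: "z \<in> annulus (r k) (r (Suc k)) \<Longrightarrow> bd z \<le> 1 / real m ^ k \<and> 1 / real m ^ Suc k < bd z"
  by (auto simp: annulus_def r_def)

lemma radius_mono: "r k \<le> r (Suc k)"
  using m by (auto simp: r_def field_simps)

text \<open>Annulus \<open>k\<close> is cut into \<open>m\<close> rings of the width
  \<open>w\<close> of annulus \<open>k + 1\<close>; dilation by \<open>s i / r (Suc k)\<close> maps
  annulus \<open>k + 1\<close> into ring \<open>i\<close>. Adding the \<open>m\<close> hypotheses
  multiplies \<open>X\<close> by \<open>m\<close>, while the disjoint rings are together paid for
  once. For \<open>k\<close> \<ge> 1 all dilation factors are at least 1/2, so the Jacobian costs at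
  most 4.\<close>

lemma ring_dilation_le:
  assumes [measurable]: "\<psi> \<in> borel_measurable borel" and k: "k \<ge> 1" and c: "c \<ge> 0"
    and Y: "\<And>\<rho>. 0 < \<rho> \<Longrightarrow> \<rho> \<le> 1 \<Longrightarrow> r k \<le> \<rho> * r (Suc k) \<Longrightarrow>
      X \<le> ennreal c * (\<integral>\<^sup>+z\<in>annulus (r (Suc k)) (r (Suc (Suc k))). \<psi> (of_real \<rho> * z) \<partial>lborel) + Y"
  shows "of_nat m * X \<le> ennreal (4 * c) * (\<integral>\<^sup>+z\<in>annulus (r k) (r (Suc k)). \<psi> z \<partial>lborel) + of_nat m * Y"
proof -
  define w where "w = r (Suc (Suc k)) - r (Suc k)"
  define s where "s = (\<lambda>i. r k + real i * w)"
  have w: "w > 0" using m by (simp add: w_def r_def field_simps)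
  have sm: "s m = r (Suc k)" using m by (simp add: s_def w_def r_def field_simps)
  have rk: "r k \<ge> 1 / 2"
  proof -
    have "2 ^ 1 \<le> (2::real) ^ k" using k by (intro power_increasing) auto
    also have "\<dots> \<le> real m ^ k" using m by (intro power_mono) auto
    finally have "1 / real m ^ k \<le> 1 / 2" using m by (intro divide_left_mono) auto
    then show ?thesis by (simp add: r_def)
  qed
  have r1: "r (Suc k) < 1" using m by (simp add: r_def)
  have r2: "r k \<le> r (Suc k)" by (rule radius_mono)
  have step: "X \<le> ennreal (4 * c) * (\<integral>\<^sup>+z\<in>annulus (s i) (s (Suc i)). \<psi> z \<partial>lborel) + Y" if i: "i < m" for i
  proof -
    define \<rho> where "\<rho> = s i / r (Suc k)"
    have si: "s i \<ge> r k" using w by (simp add: s_def)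
    have "s i \<le> s m" using i w by (simp add: s_def)
    then have \<rho>: "0 < \<rho>" "\<rho> \<le> 1" "r k \<le> \<rho> * r (Suc k)"
      using si rk r2 sm by (auto simp: \<rho>_def)
    have \<rho>2: "1 / 2 \<le> \<rho>"
      using si rk r1 r2 by (simp add: \<rho>_def field_simps)
    have img: "of_real \<rho> * z \<in> annulus (s i) (s (Suc i))"
      if "z \<in> annulus (r (Suc k)) (r (Suc (Suc k)))" for z
    proof -
      have z: "r (Suc k) \<le> cmod z" "cmod z < r (Suc (Suc k))" using that by (auto simp: annulus_def)
      have 1: "s i = \<rho> * r (Suc k)" using rk r2 by (simp add: \<rho>_def)
      have "\<rho> * cmod z < \<rho> * r (Suc (Suc k))" using z \<rho> by simp
      also have "\<dots> = s i + \<rho> * w" using 1 by (simp add: w_def algebra_simps)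
      also have "\<dots> \<le> s (Suc i)" using \<rho> w by (simp add: s_def algebra_simps)
      finally show ?thesis using 1 z \<rho> by (simp add: annulus_def norm_mult)
    qed
    have "(\<integral>\<^sup>+z\<in>annulus (r (Suc k)) (r (Suc (Suc k))). \<psi> (of_real \<rho> * z) \<partial>lborel)
        \<le> (\<integral>\<^sup>+z. \<psi> (of_real \<rho> * z) * indicator (annulus (s i) (s (Suc i))) (of_real \<rho> * z) \<partial>lborel)"
      using img by (intro nn_integral_mono) (auto split: split_indicator)
    also have "\<dots> = ennreal (1 / \<rho>\<^sup>2) * (ennreal (\<rho>\<^sup>2) * \<dots>)"
      using \<rho> by (simp add: mult.assoc[symmetric] ennreal_mult[symmetric])
    also have "ennreal (\<rho>\<^sup>2) * (\<integral>\<^sup>+z. \<psi> (of_real \<rho> * z) * indicator (annulus (s i) (s (Suc i))) (of_real \<rho> * z) \<partial>lborel)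
        = (\<integral>\<^sup>+z\<in>annulus (s i) (s (Suc i)). \<psi> z \<partial>lborel)"
      using \<rho> by (intro nn_integral_dilation[symmetric]) auto
    also have "ennreal (1 / \<rho>\<^sup>2) * \<dots> \<le> ennreal 4 * \<dots>"
    proof (intro mult_right_mono ennreal_leI)
      have "(1 / 2)\<^sup>2 \<le> \<rho>\<^sup>2" using \<rho>2 by (intro power_mono) auto
      then show "1 / \<rho>\<^sup>2 \<le> 4" using \<rho> by (simp add: field_simps power2_eq_square)
    qed simp
    finally have le: "(\<integral>\<^sup>+z\<in>annulus (r (Suc k)) (r (Suc (Suc k))). \<psi> (of_real \<rho> * z) \<partial>lborel)
      \<le> ennreal 4 * (\<integral>\<^sup>+z\<in>annulus (s i) (s (Suc i)). \<psi> z \<partial>lborel)" .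
    have "X \<le> ennreal c * (\<integral>\<^sup>+z\<in>annulus (r (Suc k)) (r (Suc (Suc k))). \<psi> (of_real \<rho> * z) \<partial>lborel) + Y"
      by (rule Y) (use \<rho> in auto)
    also have "\<dots> \<le> ennreal c * (ennreal 4 * (\<integral>\<^sup>+z\<in>annulus (s i) (s (Suc i)). \<psi> z \<partial>lborel)) + Y"
      by (intro add_right_mono mult_left_mono le) auto
    also have "ennreal c * (ennreal 4 * (\<integral>\<^sup>+z\<in>annulus (s i) (s (Suc i)). \<psi> z \<partial>lborel))
        = ennreal (4 * c) * (\<integral>\<^sup>+z\<in>annulus (s i) (s (Suc i)). \<psi> z \<partial>lborel)"
      using c by (simp add: ennreal_mult mult_ac)
    finally show ?thesis .
  qed
  have "of_nat m * X = (\<Sum>i<m. X)" by simp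
  also have "\<dots> \<le> (\<Sum>i<m. ennreal (4 * c) * (\<integral>\<^sup>+z\<in>annulus (s i) (s (Suc i)). \<psi> z \<partial>lborel) + Y)"
    using step by (intro sum_mono) auto
  also have "\<dots> = ennreal (4 * c) * (\<Sum>i<m. \<integral>\<^sup>+z\<in>annulus (s i) (s (Suc i)). \<psi> z \<partial>lborel) + of_nat m * Y"
    by (simp add: sum.distrib sum_distrib_left)
  also have "(\<Sum>i<m. \<integral>\<^sup>+z\<in>annulus (s i) (s (Suc i)). \<psi> z \<partial>lborel) = (\<integral>\<^sup>+z\<in>annulus (s 0) (s m). \<psi> z \<partial>lborel)"
    using w by (intro nn_integral_rings) (auto simp: s_def)
  also have "annulus (s 0) (s m) = annulus (r k) (r (Suc k))" using sm by (simp add: s_def)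
  finally show ?thesis .
qed

lemma radius_0 [simp]: "r 0 = 0" by (simp add: r_def)

lemma nn_integral_disc_rings_le:
  assumes \<psi>: "\<psi> \<in> borel_measurable borel"
    and le: "\<And>N. (\<Sum>k<N. \<integral>\<^sup>+z\<in>annulus (r k) (r (Suc k)). \<psi> z \<partial>lborel) \<le> B"
  shows "(\<integral>\<^sup>+z\<in>unit_disc. \<psi> z \<partial>lborel) \<le> B"
proof -
  have [measurable]: "\<psi> \<in> borel_measurable borel" by fact
  define f where "f = (\<lambda>N z. \<psi> z * indicator (annulus 0 (r N)) z)"
  have "f N z \<le> f (Suc N) z" for N z
    using radius_mono[of N] by (auto simp: f_def annulus_def split: split_indicator)
  then have "incseq f" by (intro incseq_SucI le_funI)
  have SUP: "(SUP N. f N z) = \<psi> z * indicator unit_disc z" for z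
  proof (rule antisym)
    have "r N < 1" for N using m by (simp add: r_def)
    then have "f N z \<le> \<psi> z * indicator unit_disc z" for N
      using less_trans[of "cmod z" "r N" 1] by (auto simp: f_def annulus_def split: split_indicator)
    then show "(SUP N. f N z) \<le> \<psi> z * indicator unit_disc z"
      by (intro SUP_least)
    show "\<psi> z * indicator unit_disc z \<le> (SUP N. f N z)"
    proof (cases "cmod z < 1")
      case True
      have "\<exists>N. (1 / real m) ^ N < bd z"
        using True m by (intro real_arch_pow_inv) auto
      then obtain N where "(1 / real m) ^ N < bd z" by blast
      then have "f N z = \<psi> z" by (simp add: f_def annulus_def r_def power_divide)
      then show ?thesis using True by (intro SUP_upper2[of N]) auto
    qed simp
  qed
  have "(\<integral>\<^sup>+z\<in>unit_disc. \<psi> z \<partial>lborel) = (\<integral>\<^sup>+z. (SUP N. f N z) \<partial>lborel)"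
    by (simp add: SUP)
  also have "\<dots> = (SUP N. \<integral>\<^sup>+z. f N z \<partial>lborel)"
    by (rule nn_integral_monotone_convergence_SUP[OF \<open>incseq f\<close>]) (simp add: f_def)
  also have "\<dots> \<le> B"
    using le nn_integral_rings[where s=r, OF \<psi> radius_mono]
    by (intro SUP_least) (simp add: f_def)
  finally show ?thesis .
qed

end

text \<open>The summands may be infinite, so the sum cannot be absorbed into the left-hand side.
  Keeping an extra copy of the last \<open>x\<close> on the left lets the induction use the halving
  without any subtraction.\<close>

lemma sum_contraction_le:
  fixes x y :: "nat \<Rightarrow> ennreal"
  assumes "\<And>k. k \<ge> 1 \<Longrightarrow> 2 * x (Suc k) \<le> x k + y (Suc k)"
  shows "(\<Sum>k<N. x k) \<le> 2 * (x 0 + x 1) + (\<Sum>k<N. y k)"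
proof -
  have "(\<Sum>k\<le>Suc N. x k) + x (Suc N) \<le> 2 * (x 0 + x 1) + (\<Sum>k\<le>Suc N. y k)" for N
  proof (induction N)
    case 0
    have "x 0 + x 1 + x 1 \<le> 2 * (x 0 + x 1)"
      by (simp add: mult_2 add_ac add_increasing)
    then show ?case by (simp add: add_increasing2)
  next
    case (Suc N)
    have "(\<Sum>k\<le>Suc (Suc N). x k) + x (Suc (Suc N)) = (\<Sum>k\<le>Suc N. x k) + 2 * x (Suc (Suc N))"
      by (simp add: mult_2 add_ac)
    also have "\<dots> \<le> (\<Sum>k\<le>Suc N. x k) + (x (Suc N) + y (Suc (Suc N)))"
      using assms by (intro add_left_mono) auto
    also have "\<dots> \<le> 2 * (x 0 + x 1) + (\<Sum>k\<le>Suc N. y k) + y (Suc (Suc N))"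
      using add_right_mono[OF Suc] by (simp add: add_ac)
    finally show ?case by (simp add: add_ac)
  qed
  note * = this
  show ?thesis
  proof (cases "N \<ge> 2")
    case True
    then obtain M where M: "N = Suc (Suc M)" by (metis add_2_eq_Suc le_Suc_ex)
    have "(\<Sum>k<N. x k) \<le> (\<Sum>k\<le>Suc M. x k) + x (Suc M)"
      unfolding M lessThan_Suc_atMost by (simp add: add_increasing2)
    also note *[of M]
    finally show ?thesis unfolding M lessThan_Suc_atMost .
  next
    case False
    then consider "N = 0" | "N = 1" by linarith
    then show ?thesis
      by cases (auto simp: mult_2 add_ac intro: add_increasing2)
  qed
qed

theorem littlewood_paley_le:
  assumes q: "q > 0" and \<alpha>: "\<alpha> \<ge> - 1 / 4"
  shows "\<exists>C>0. \<forall>F. F holomorphic_on unit_disc \<longrightarrow>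
    dint (\<lambda>z. cmod (F z) powr q * bd z powr \<alpha>)
      \<le> ennreal C * (ennreal (cmod (F 0) powr q)
          + dint (\<lambda>z. cmod (deriv F z) powr q * bd z powr (\<alpha> + q)))"
proof -
  \<comment> \<open>This is \<open>8 * c\<close> \<le> \<open>m\<close> in disguise, as
    \<open>c\<close> is \<open>2 powr q\<close> times the square root of \<open>m\<close>: the 8 is
    the Jacobian factor 4 times the 2 wanted in the contraction.\<close>
  obtain m0 :: nat where m0: "(2 powr (q + 3))\<^sup>2 \<le> real m0" using real_arch_simple by blast
  define m where "m = max m0 2"
  have m: "m \<ge> 2" "(2 powr (q + 3))\<^sup>2 \<le> real m" using m0 by (auto simp: m_def)
  define r where "r = (\<lambda>k. 1 - 1 / real m ^ k)"
  note ring_bd = ring_bd[OF m(1) r_def]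
  \<comment> \<open>A point of annulus \<open>k + 1\<close> has \<open>bd\<close> above
    \<open>1 / real m ^ (k + 2)\<close>, and its dilates into annulus \<open>k\<close> have
    \<open>bd\<close> at most \<open>1 / real m ^ k\<close>. The quotient of these bounds is
    \<open>A\<close>.\<close>
  define A where "A = (real m)\<^sup>2"
  have A: "A \<ge> 1" using m by (simp add: A_def)
  define c where "c = 2 powr q * real m powr (1 / 2)"
  have "sqrt ((2 powr (q + 3))\<^sup>2) \<le> sqrt (real m)" using m(2) by (rule real_sqrt_le_mono)
  then have "2 powr (q + 3) \<le> real m powr (1 / 2)" by (simp add: powr_half_sqrt)
  then have "2 powr (q + 3) * real m powr (1 / 2) \<le> real m powr (1 / 2) * real m powr (1 / 2)"
    by (intro mult_right_mono) auto
  also have "\<dots> = real m" using m by (simp add: powr_add[symmetric])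
  finally have c: "8 * c \<le> real m" "c \<ge> 0" by (auto simp: c_def powr_add)
  obtain C where C: "C > 0" and rad: "\<And>F z \<rho>. F holomorphic_on unit_disc \<Longrightarrow> cmod z < 1 \<Longrightarrow> 0 \<le> \<rho> \<Longrightarrow> \<rho> \<le> 1 \<Longrightarrow>
    1 - \<rho> * cmod z \<le> A * bd z \<Longrightarrow>
    ennreal (cmod (F z - F (of_real \<rho> * z)) powr q)
      \<le> ennreal C * (ennreal (bd z powr (q - 2))
           * (\<integral>\<^sup>+x\<in>near (2 * A + 1) z. ennreal (cmod (deriv F x) powr q) \<partial>lborel))"
    using radial_difference_bound[OF q A] by blast
  obtain K where K: "K > 0" and ton: "\<And>\<phi>. \<phi> \<in> borel_measurable borel \<Longrightarrow>
    (\<integral>\<^sup>+z\<in>unit_disc. ennreal (bd z powr (\<alpha> + q - 2)) * (\<integral>\<^sup>+w\<in>near (2 * A + 1) z. \<phi> w \<partial>lborel) \<partial>lborel)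
      \<le> ennreal K * (\<integral>\<^sup>+w\<in>unit_disc. \<phi> w * ennreal (bd w powr (\<alpha> + q)) \<partial>lborel)"
    using nn_integral_near_le[of "2 * A + 1" "\<alpha> + q"] A by auto
  define D where "D = 2 powr q * C"
  define E where "E = 2 powr q * A powr \<bar>\<alpha>\<bar> * pi"
  have D: "D > 0" and E: "E > 0" using C A by (auto simp: D_def E_def)
  define C' where "C' = max (4 * E) (6 * D * K)"
  have C': "C' > 0" using D K E by (simp add: C'_def less_max_iff_disj)
  have "dint (\<lambda>z. cmod (F z) powr q * bd z powr \<alpha>)
      \<le> ennreal C' * (ennreal (cmod (F 0) powr q)
          + dint (\<lambda>z. cmod (deriv F z) powr q * bd z powr (\<alpha> + q)))"
    if hol: "F holomorphic_on unit_disc" for F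
  proof -
    define \<phi> where "\<phi> = (\<lambda>x. ennreal (cmod (deriv F x) powr q) * indicator unit_disc x)"
    have hold: "deriv F holomorphic_on unit_disc" using hol by (intro holomorphic_deriv) auto
    have [measurable]: "\<phi> \<in> borel_measurable borel"
      unfolding \<phi>_def by (rule measurable_holomorphic_powr[OF hold q])
    define N where "N = (\<lambda>z. (\<integral>\<^sup>+w\<in>near (2 * A + 1) z. \<phi> w \<partial>lborel) * indicator unit_disc z)"
    have [measurable]: "N \<in> borel_measurable borel"
      unfolding N_def by (rule measurable_nn_integral_near) simp
    define \<gamma> where "\<gamma> = (\<lambda>z. ennreal (bd z powr (\<alpha> + q - 2)) * N z)"
    have [measurable]: "\<gamma> \<in> borel_measurable borel" unfolding \<gamma>_def by measurable
    define \<psi> where "\<psi> = (\<lambda>z. ennreal (cmod (F z) powr q * bd z powr \<alpha>) * indicator unit_disc z)"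
    have [measurable]: "\<psi> \<in> borel_measurable borel"
      unfolding \<psi>_def using q hol
      by (intro measurable_ennreal_indicator_continuous continuous_intros continuous_on_powr'
            holomorphic_on_imp_continuous_on) auto
    have point: "\<psi> z \<le> ennreal (2 powr q * (bd z powr \<alpha> * cmod (F (of_real \<rho> * z)) powr q)) + ennreal D * \<gamma> z"
      if z: "cmod z < 1" and \<rho>: "0 \<le> \<rho>" "\<rho> \<le> 1" "1 - \<rho> * cmod z \<le> A * bd z" for z \<rho>
    proof -
      define u where "u = cmod (F (of_real \<rho> * z))"
      define v where "v = cmod (F z - F (of_real \<rho> * z))"
      have "cmod (F z) \<le> u + v"
        using norm_triangle_ineq[of "F (of_real \<rho> * z)" "F z - F (of_real \<rho> * z)"] by (simp add: u_def v_def)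
      then have "cmod (F z) powr q \<le> (u + v) powr q" using q by (intro powr_mono2) auto
      also have "\<dots> \<le> 2 powr q * (u powr q + v powr q)"
        using q by (intro power_add_le_powr) (auto simp: u_def v_def)
      finally have "cmod (F z) powr q * bd z powr \<alpha> \<le> 2 powr q * (u powr q + v powr q) * bd z powr \<alpha>"
        by (intro mult_right_mono) auto
      also have "\<dots> = 2 powr q * (bd z powr \<alpha> * u powr q) + 2 powr q * (bd z powr \<alpha> * v powr q)"
        by (simp add: algebra_simps)
      finally have "\<psi> z \<le> ennreal (2 powr q * (bd z powr \<alpha> * u powr q) + 2 powr q * (bd z powr \<alpha> * v powr q))"
        using z by (simp add: \<psi>_def ennreal_leI del: ennreal_plus)
      also have "\<dots> = ennreal (2 powr q * (bd z powr \<alpha> * u powr q))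
          + ennreal (2 powr q) * (ennreal (bd z powr \<alpha>) * ennreal (v powr q))"
        by (simp add: ennreal_plus[symmetric] ennreal_mult[symmetric] del: ennreal_plus)
      also have "ennreal (v powr q) \<le> ennreal C * (ennreal (bd z powr (q - 2))
           * (\<integral>\<^sup>+x\<in>near (2 * A + 1) z. ennreal (cmod (deriv F x) powr q) \<partial>lborel))"
        unfolding v_def by (rule rad[OF hol z \<rho>])
      also have "(\<integral>\<^sup>+x\<in>near (2 * A + 1) z. ennreal (cmod (deriv F x) powr q) \<partial>lborel) = N z"
        using z by (simp add: N_def \<phi>_def near_indicator_absorb)
      also have "ennreal (2 powr q) * (ennreal (bd z powr \<alpha>) * (ennreal C * (ennreal (bd z powr (q - 2)) * N z)))
          = ennreal D * (ennreal (bd z powr \<alpha> * bd z powr (q - 2)) * N z)"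
        using C by (simp add: D_def ennreal_mult mult_ac)
      also have "bd z powr \<alpha> * bd z powr (q - 2) = bd z powr (\<alpha> + q - 2)"
        by (simp add: powr_add[symmetric] algebra_simps)
      finally show ?thesis by (simp add: \<gamma>_def u_def add_left_mono mult_left_mono)
    qed
    define x where "x = (\<lambda>k. \<integral>\<^sup>+z\<in>annulus (r k) (r (Suc k)). \<psi> z \<partial>lborel)"
    define y where "y = (\<lambda>k. ennreal D * (\<integral>\<^sup>+z\<in>annulus (r k) (r (Suc k)). \<gamma> z \<partial>lborel))"
    have rle: "r k < 1" "r k \<ge> 0" for k using m by (auto simp: r_def)
    have contr: "2 * x (Suc k) \<le> x k + 2 * y (Suc k)" if k: "k \<ge> 1" for k
    proof -
      have "x (Suc k) \<le> ennreal c * (\<integral>\<^sup>+z\<in>annulus (r (Suc k)) (r (Suc (Suc k))). \<psi> (of_real \<rho> * z) \<partial>lborel) + y (Suc k)"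
        if \<rho>: "0 < \<rho>" "\<rho> \<le> 1" "r k \<le> \<rho> * r (Suc k)" for \<rho>
      proof -
        let ?R = "annulus (r (Suc k)) (r (Suc (Suc k)))"
        have pt: "\<psi> z \<le> ennreal c * \<psi> (of_real \<rho> * z) + ennreal D * \<gamma> z" if z: "z \<in> ?R" for z
        proof -
          have z1: "cmod z < 1" "r (Suc k) \<le> cmod z" using z rle[of "Suc (Suc k)"] by (auto simp: annulus_def)
          define b where "b = 1 - \<rho> * cmod z"
          have "\<rho> * r (Suc k) \<le> \<rho> * cmod z" using z1 \<rho> by (intro mult_left_mono) auto
          then have "b \<le> 1 - r k" using \<rho>(3) unfolding b_def by linarith
          also have "1 - r k = 1 / real m ^ k" by (simp add: r_def)
          also have "\<dots> = A * (1 / real m ^ Suc (Suc k))"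
            using m by (simp add: A_def power2_eq_square)
          also have "\<dots> \<le> A * bd z"
            using ring_bd[OF z] A by (intro mult_left_mono) auto
          finally have b: "b \<le> A * bd z" .
          have \<rho>z: "\<rho> * cmod z \<le> cmod z" using \<rho> mult_right_mono[of \<rho> 1 "cmod z"] by simp
          have b2: "bd z \<le> b" using \<rho>z by (simp add: b_def)
          \<comment> \<open>For negative \<alpha> the ratio \<open>A\<close> of the weights costs
            \<open>m\<close> to the power -2\<alpha>; the hypothesis that \<alpha> is at least -1/4
            keeps this below the square root of \<open>m\<close>.\<close>
          have "bd z powr \<alpha> \<le> real m powr (1 / 2) * b powr \<alpha>"
          proof (cases "\<alpha> \<ge> 0")
            case True
            have "1 * bd z powr \<alpha> \<le> real m powr (1 / 2) * b powr \<alpha>"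
              using True z1 b2 m by (intro mult_mono powr_mono2 ge_one_powr_ge_zero) auto
            then show ?thesis by simp
          next
            case False
            have "bd z powr \<alpha> \<le> (b / A) powr \<alpha>"
              using False b b2 z1 A by (intro powr_mono2') (auto simp: field_simps)
            also have "\<dots> = A powr (- \<alpha>) * b powr \<alpha>"
              using b2 z1 A by (simp add: powr_divide powr_minus field_simps)
            also have "A powr (- \<alpha>) = real m powr (- 2 * \<alpha>)"
              using m by (simp add: A_def powr_powr powr_numeral[symmetric] del: powr_numeral)
            also have "\<dots> * b powr \<alpha> \<le> real m powr (1 / 2) * b powr \<alpha>"
              using \<alpha> m by (intro mult_right_mono powr_mono) auto
            finally show ?thesis .
          qed
          then have "2 powr q * (bd z powr \<alpha> * cmod (F (of_real \<rho> * z)) powr q)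
             \<le> 2 powr q * ((real m powr (1 / 2) * b powr \<alpha>) * cmod (F (of_real \<rho> * z)) powr q)"
            by (intro mult_left_mono mult_right_mono) auto
          also have "\<dots> = c * (cmod (F (of_real \<rho> * z)) powr q * bd (of_real \<rho> * z) powr \<alpha>)"
            using \<rho> by (simp add: c_def b_def norm_mult)
          finally have "ennreal (2 powr q * (bd z powr \<alpha> * cmod (F (of_real \<rho> * z)) powr q))
             \<le> ennreal (c * (cmod (F (of_real \<rho> * z)) powr q * bd (of_real \<rho> * z) powr \<alpha>))"
            by (rule ennreal_leI)
          also have "\<dots> = ennreal c * \<psi> (of_real \<rho> * z)"
            using c \<rho> \<rho>z z1 by (simp add: \<psi>_def norm_mult ennreal_mult)
          finally have le: "ennreal (2 powr q * (bd z powr \<alpha> * cmod (F (of_real \<rho> * z)) powr q)) \<le> ennreal c * \<psi> (of_real \<rho> * z)" .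
          have "\<psi> z \<le> ennreal (2 powr q * (bd z powr \<alpha> * cmod (F (of_real \<rho> * z)) powr q)) + ennreal D * \<gamma> z"
            using z1 \<rho> b unfolding b_def by (intro point) auto
          also have "\<dots> \<le> ennreal c * \<psi> (of_real \<rho> * z) + ennreal D * \<gamma> z"
            by (intro add_right_mono le)
          finally show ?thesis .
        qed
        have "x (Suc k) \<le> (\<integral>\<^sup>+z. (ennreal c * (\<psi> (of_real \<rho> * z) * indicator ?R z) + ennreal D * (\<gamma> z * indicator ?R z)) \<partial>lborel)"
          unfolding x_def using pt by (intro nn_integral_mono) (auto split: split_indicator)
        also have "\<dots> = ennreal c * (\<integral>\<^sup>+z\<in>?R. \<psi> (of_real \<rho> * z) \<partial>lborel) + y (Suc k)"
          unfolding y_def by (simp add: nn_integral_add nn_integral_cmult)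
        finally show ?thesis .
      qed
      then have "of_nat m * x (Suc k) \<le> ennreal (4 * c) * (\<integral>\<^sup>+z\<in>annulus (r k) (r (Suc k)). \<psi> z \<partial>lborel) + of_nat m * y (Suc k)"
        by (intro ring_dilation_le[OF m(1) r_def _ k c(2)]) auto
      then have "of_nat m * x (Suc k) \<le> ennreal (4 * c) * x k + of_nat m * y (Suc k)"
        unfolding x_def .
      \<comment> \<open>Doubling produces \<open>8 * c\<close>, which is at most \<open>m\<close>;
        cancelling \<open>m\<close> leaves a recurrence of the form required by
        \<open>sum_contraction_le\<close>.\<close>
      from mult_left_mono[OF this, of 2]
      have "of_nat m * (2 * x (Suc k)) \<le> ennreal (8 * c) * x k + of_nat m * (2 * y (Suc k))"
        using c by (simp add: distrib_left mult.assoc[symmetric] ennreal_mult[symmetric] ennreal_numeral[symmetric]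
              del: ennreal_numeral) (simp add: mult_ac)
      also have "ennreal (8 * c) * x k \<le> of_nat m * x k"
        using c by (intro mult_right_mono) (auto simp: ennreal_of_nat_eq_real_of_nat intro: ennreal_leI)
      finally have "of_nat m * (2 * x (Suc k)) \<le> of_nat m * (x k + 2 * y (Suc k))"
        by (simp add: distrib_left add_right_mono)
      then show ?thesis
        using m by (simp add: ennreal_mult_le_mult_iff)
    qed
    define Y where "Y = ennreal D * (\<integral>\<^sup>+z\<in>unit_disc. \<gamma> z \<partial>lborel)"
    define f0 where "f0 = ennreal (cmod (F 0) powr q)"
    have ysum: "(\<Sum>k<N. y k) \<le> Y" for N
    proof -
      have "(\<Sum>k<N. y k) = ennreal D * (\<integral>\<^sup>+z\<in>annulus (r 0) (r N). \<gamma> z \<partial>lborel)"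
        unfolding y_def sum_distrib_left[symmetric]
        by (subst nn_integral_rings) (auto intro: radius_mono[OF m(1) r_def])
      also have "\<dots> \<le> Y"
        unfolding Y_def using rle[of N]
        by (intro mult_left_mono nn_integral_mono) (auto simp: annulus_def split: split_indicator)
      finally show ?thesis .
    qed
    \<comment> \<open>On the first two annuli \<open>bd z\<close> is at least \<open>1 / A\<close>,
      so \<rho> = 0 is admissible and the comparison is with \<open>F 0\<close>.\<close>
    have base: "x k \<le> ennreal E * f0 + y k" if k: "k \<le> 1" for k
    proof -
      let ?R = "annulus (r k) (r (Suc k))"
      have pt: "\<psi> z \<le> ennreal (2 powr q * A powr \<bar>\<alpha>\<bar>) * f0 + ennreal D * \<gamma> z" if z: "z \<in> ?R" for z
      proof -
        have z1: "cmod z < 1" using z rle[of "Suc k"] by (auto simp: annulus_def)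
        have "real m ^ Suc k \<le> real m ^ 2" using k m by (intro power_increasing) auto
        then have "1 / A \<le> 1 / real m ^ Suc k"
          using m unfolding A_def by (intro divide_left_mono) auto
        then have "1 / A \<le> bd z" using ring_bd[OF z] by simp
        then have Ab: "1 \<le> A * bd z" using A by (simp add: field_simps)
        have "bd z \<le> 1 * 1" by simp
        also have "\<dots> \<le> A * 1" using A by (intro mult_right_mono) auto
        finally have "bd z powr \<alpha> \<le> A powr \<bar>\<alpha>\<bar> * 1 powr \<alpha>"
          using A z1 Ab by (intro powr_comparable) auto
        then have "2 powr q * (bd z powr \<alpha> * cmod (F 0) powr q) \<le> 2 powr q * (A powr \<bar>\<alpha>\<bar> * cmod (F 0) powr q)"
          by (intro mult_left_mono mult_right_mono) auto
        then have "ennreal (2 powr q * (bd z powr \<alpha> * cmod (F 0) powr q)) \<le> ennreal (2 powr q * A powr \<bar>\<alpha>\<bar>) * f0"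
          by (simp add: f0_def ennreal_mult[symmetric] ennreal_leI mult_ac)
        then show ?thesis using point[OF z1, of 0] Ab by (simp add: order.trans[OF _ add_right_mono])
      qed
      have sub: "?R \<subseteq> ball 0 1" using rle[of "Suc k"] by (auto simp: annulus_def)
      have "x k \<le> (\<integral>\<^sup>+z. (ennreal (2 powr q * A powr \<bar>\<alpha>\<bar>) * f0 * indicator ?R z + ennreal D * (\<gamma> z * indicator ?R z)) \<partial>lborel)"
        unfolding x_def using pt by (intro nn_integral_mono) (auto split: split_indicator)
      also have "\<dots> = ennreal (2 powr q * A powr \<bar>\<alpha>\<bar>) * f0 * emeasure lborel ?R + y k"
        unfolding y_def by (simp add: nn_integral_add nn_integral_cmult nn_integral_cmult_indicator)
      also have "emeasure lborel ?R \<le> emeasure lborel (ball (0::complex) 1)"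
        using sub by (intro emeasure_mono) auto
      also have "emeasure lborel (ball (0::complex) 1) = ennreal pi"
        using emeasure_complex_ball[of 1 0] by simp
      also have "ennreal (2 powr q * A powr \<bar>\<alpha>\<bar>) * f0 * ennreal pi = ennreal E * f0"
        by (simp add: E_def ennreal_mult mult_ac)
      finally show ?thesis by (simp add: add_right_mono mult_left_mono)
    qed
    have y_le: "y k \<le> Y" for k
    proof -
      have "y k \<le> (\<Sum>i<Suc k. y i)" by simp
      then show ?thesis using ysum[of "Suc k"] by (rule order.trans)
    qed
    \<comment> \<open>The contraction counts \<open>x 0\<close> and \<open>x 1\<close> twice, each
      at most \<open>E * f0 + Y\<close>, and the doubled \<open>y k\<close> add another
      \<open>2 * Y\<close>.\<close>
    have xsum: "(\<Sum>k<N. x k) \<le> ennreal (4 * E) * f0 + 6 * Y" for N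
    proof -
      have "(\<Sum>k<N. x k) \<le> 2 * (x 0 + x 1) + (\<Sum>k<N. 2 * y k)"
        using contr by (rule sum_contraction_le)
      also have "\<dots> \<le> 2 * ((ennreal E * f0 + Y) + (ennreal E * f0 + Y)) + 2 * Y"
      proof (intro add_mono mult_left_mono)
        show "x 0 \<le> ennreal E * f0 + Y" "x 1 \<le> ennreal E * f0 + Y"
          using base[of 0] base[of 1] y_le by (auto intro: order.trans add_left_mono)
        show "(\<Sum>k<N. 2 * y k) \<le> 2 * Y"
          unfolding sum_distrib_left[symmetric] by (intro mult_left_mono ysum) auto
      qed auto
      also have "\<dots> = 4 * (ennreal E * f0) + 6 * Y"
      proof -
        have four: "(4::ennreal) = 2 + 2" and six: "(6::ennreal) = 2 + 2 + 2" by simp_all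
        show ?thesis by (simp only: four six distrib_left distrib_right add_ac)
      qed
      also have "4 * (ennreal E * f0) = ennreal (4 * E) * f0"
        using E by (simp add: ennreal_mult mult_ac)
      finally show ?thesis .
    qed
    have "(\<integral>\<^sup>+z\<in>unit_disc. \<psi> z \<partial>lborel) \<le> ennreal (4 * E) * f0 + 6 * Y"
      by (rule nn_integral_disc_rings_le[OF m(1) r_def]) (use xsum in \<open>auto simp: x_def\<close>)
    also have "Y \<le> ennreal D * (ennreal K * (\<integral>\<^sup>+w\<in>unit_disc. \<phi> w * ennreal (bd w powr (\<alpha> + q)) \<partial>lborel))"
    proof -
      have "(\<integral>\<^sup>+z\<in>unit_disc. \<gamma> z \<partial>lborel)
        = (\<integral>\<^sup>+z\<in>unit_disc. ennreal (bd z powr (\<alpha> + q - 2)) * (\<integral>\<^sup>+w\<in>near (2 * A + 1) z. \<phi> w \<partial>lborel) \<partial>lborel)"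
        by (intro nn_integral_cong) (auto simp: \<gamma>_def N_def split: split_indicator)
      then show ?thesis unfolding Y_def using ton[of \<phi>] by (intro mult_left_mono) auto
    qed
    also have "(\<integral>\<^sup>+w\<in>unit_disc. \<phi> w * ennreal (bd w powr (\<alpha> + q)) \<partial>lborel)
        = dint (\<lambda>z. cmod (deriv F z) powr q * bd z powr (\<alpha> + q))" (is "_ = ?J")
      by (intro nn_integral_cong) (auto simp: \<phi>_def ennreal_mult split: split_indicator)
    also have "6 * (ennreal D * (ennreal K * ?J)) = ennreal (6 * D * K) * ?J"
      using D K by (simp add: ennreal_mult mult_ac)
    also have "ennreal (4 * E) * f0 + ennreal (6 * D * K) * ?J \<le> ennreal C' * f0 + ennreal C' * ?J"
      by (intro add_mono mult_right_mono ennreal_leI) (auto simp: C'_def)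
    also have "\<dots> = ennreal C' * (f0 + ?J)" by (simp add: distrib_left)
    also have "(\<integral>\<^sup>+z\<in>unit_disc. \<psi> z \<partial>lborel)
        = dint (\<lambda>z. cmod (F z) powr q * bd z powr \<alpha>)"
      by (intro nn_integral_cong) (auto simp: \<psi>_def split: split_indicator)
    finally show ?thesis by (simp add: f0_def add_left_mono mult_left_mono)
  qed
  then show ?thesis using C' by blast
qed

section \<open>Forelli--Rudin estimates\<close>

lemma one_minus_cnj_ge:
  assumes "cmod a \<le> 1" "cmod z \<le> 1"
  shows "bd a \<le> cmod (1 - cnj a * z)" "bd z \<le> cmod (1 - cnj a * z)"
proof -
  have le: "1 - cmod a * cmod z \<le> cmod (1 - cnj a * z)"
    using norm_triangle_ineq2[of 1 "cnj a * z"] by (simp add: norm_mult)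
  show "bd a \<le> cmod (1 - cnj a * z)"
    using le mult_left_le[of "cmod z" "cmod a"] assms by simp
  show "bd z \<le> cmod (1 - cnj a * z)"
    using le mult_left_le[of "cmod a" "cmod z"] assms by (simp add: mult.commute)
qed

lemma one_minus_cnj_pos: "cmod a < 1 \<Longrightarrow> cmod z < 1 \<Longrightarrow> 0 < cmod (1 - cnj a * z)"
  using one_minus_cnj_ge(1)[of a z] by linarith

lemma one_minus_cnj_swap: "cmod (1 - cnj a * z) = cmod (1 - cnj z * a)"
proof -
  have "cmod (1 - cnj a * z) = cmod (cnj (1 - cnj a * z))" by (rule complex_mod_cnj[symmetric])
  then show ?thesis by (simp add: mult.commute)
qed

lemma continuous_on_cnj_powr:
  "cmod a < 1 \<Longrightarrow> continuous_on unit_disc (\<lambda>z. cmod (1 - cnj a * z) powr s)"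
  using one_minus_cnj_pos by (intro continuous_intros) force

lemma dyadic_scale:
  fixes v \<delta> :: real
  assumes "\<delta> > 0" "\<delta> \<le> v"
  obtains k :: nat where "2 ^ k * \<delta> \<le> v" "v < 2 ^ Suc k * \<delta>"
proof -
  obtain n where "v / \<delta> < 2 ^ n" using real_arch_pow[of 2 "v / \<delta>"] by auto
  then have ex: "\<exists>n. v < 2 ^ n * \<delta>" using assms by (auto simp: field_simps)
  define n where "n = (LEAST n. v < 2 ^ n * \<delta>)"
  have n: "v < 2 ^ n * \<delta>" unfolding n_def using ex by (rule LeastI_ex)
  then have "n \<noteq> 0" using assms by (cases n) auto
  then obtain k where k: "n = Suc k" using not0_implies_Suc by blast
  have "\<not> v < 2 ^ k * \<delta>" using not_less_Least[of k "\<lambda>n. v < 2 ^ n * \<delta>"] k unfolding n_def by auto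
  then show thesis using n k that[of k] by auto
qed

lemma DERIV_inverse_linear_power:
  fixes c z :: complex
  assumes "1 - c * z \<noteq> 0"
  shows "((\<lambda>z. 1 / (1 - c * z) ^ M) has_field_derivative of_nat M * c / (1 - c * z) ^ Suc M) (at z)"
proof (cases M)
  case (Suc j)
  have "((\<lambda>z. 1 / (1 - c * z) ^ M) has_field_derivative
      - (of_nat M * (1 - c * z) ^ (M - 1) * (- c)) / ((1 - c * z) ^ M * (1 - c * z) ^ M)) (at z)"
    using assms by (auto intro!: derivative_eq_intros)
  also have "- (of_nat M * (1 - c * z) ^ (M - 1) * (- c)) / ((1 - c * z) ^ M * (1 - c * z) ^ M)
      = of_nat M * c / (1 - c * z) ^ Suc M"
    using assms by (simp add: Suc)
  finally show ?thesis .
qed simp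

text \<open>For \<open>a\<close> away from 0, |1 - cnj a z| = |a| |1 / cnj a - z|, so its sublevel
  sets are discs about the reflected point. The dyadic level 2^k \<delta> contributes area of order
  (2^k \<delta>)^2 times (2^k \<delta>)^(-s), a geometric series of ratio 2^(2-s). For |a| at most
  1/2 the integrand is bounded.\<close>

lemma forelli_rudin_unweighted:
  assumes s: "s > 2"
  shows "\<exists>C>0. \<forall>a. cmod a < 1 \<longrightarrow>
    dint (\<lambda>z. cmod (1 - cnj a * z) powr (- s)) \<le> ennreal (C * bd a powr (2 - s))"
proof -
  define \<theta> :: real where "\<theta> = 2 powr (2 - s)"
  have \<theta>: "0 < \<theta>" "\<theta> < 1" using s powr_less_mono[of "2 - s" 0 "2::real"] by (auto simp: \<theta>_def)
  define C where "C = max (2 powr s * pi) (16 * pi / (1 - \<theta>))"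
  have C: "C > 0" by (simp add: C_def less_max_iff_disj)
  have "dint (\<lambda>z. cmod (1 - cnj a * z) powr (- s)) \<le> ennreal (C * bd a powr (2 - s))"
    if a: "cmod a < 1" for a
  proof (cases "cmod a \<le> 1 / 2")
    case True
    have pt: "cmod (1 - cnj a * z) powr (- s) \<le> 2 powr s" if z: "z \<in> unit_disc" for z
    proof -
      have "1 / 2 \<le> cmod (1 - cnj a * z)" using one_minus_cnj_ge(1)[of a z] a z True by simp
      then have "cmod (1 - cnj a * z) powr (- s) \<le> (1 / 2) powr (- s)"
        using s by (intro powr_mono2') auto
      then show ?thesis by (simp add: powr_minus powr_divide)
    qed
    have "dint (\<lambda>z. cmod (1 - cnj a * z) powr (- s))
      \<le> (\<integral>\<^sup>+z. ennreal (2 powr s) * indicator unit_disc z \<partial>lborel)"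
      using pt by (intro nn_integral_mono) (auto split: split_indicator intro!: ennreal_leI)
    also have "\<dots> = ennreal (2 powr s) * emeasure lborel (ball (0::complex) 1)"
      by (subst nn_integral_cmult_indicator) (auto simp: unit_disc_def)
    also have "\<dots> = ennreal (2 powr s * pi * 1)"
      using emeasure_complex_ball[of 1 0] by (simp add: ennreal_mult)
    also have "\<dots> \<le> ennreal (C * bd a powr (2 - s))"
    proof (intro ennreal_leI mult_mono)
      show "2 powr s * pi \<le> C" by (simp add: C_def)
      have "1 powr (2 - s) \<le> bd a powr (2 - s)" using a s by (intro powr_mono2') auto
      then show "1 \<le> bd a powr (2 - s)" by simp
    qed (use C in auto)
    finally show ?thesis .
  next
    case False
    define \<delta> where "\<delta> = bd a"
    define b where "b = 1 / cnj a"
    have \<delta>: "\<delta> > 0" using a by (simp add: \<delta>_def)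
    have a0: "cnj a \<noteq> 0" using False by auto
    define h where "h = (\<lambda>(k::nat) z. ennreal ((2 ^ k * \<delta>) powr (- s)) * indicator (ball b (2 ^ (k + 2) * \<delta>)) z)"
    have pt: "ennreal (cmod (1 - cnj a * z) powr (- s)) \<le> (\<Sum>k. h k z)" if z: "z \<in> unit_disc" for z
    proof -
      define v where "v = cmod (1 - cnj a * z)"
      have "\<delta> \<le> v" using one_minus_cnj_ge(1)[of a z] a z by (simp add: v_def \<delta>_def)
      then obtain k where k: "2 ^ k * \<delta> \<le> v" "v < 2 ^ Suc k * \<delta>"
        using dyadic_scale[OF \<delta>] by blast
      have "1 - cnj a * z = cnj a * (b - z)" using a0 by (simp add: b_def field_simps)
      then have "v = cmod a * cmod (b - z)" by (simp add: v_def norm_mult)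
      moreover have "(1 / 2) * cmod (b - z) \<le> cmod a * cmod (b - z)"
        using False by (intro mult_right_mono) auto
      ultimately have "cmod (b - z) < 2 ^ (k + 2) * \<delta>" using k by simp
      then have hk: "h k z = ennreal ((2 ^ k * \<delta>) powr (- s))" by (simp add: h_def dist_norm)
      have "v powr (- s) \<le> (2 ^ k * \<delta>) powr (- s)"
        using s \<delta> k by (intro powr_mono2') auto
      then have "ennreal (v powr (- s)) \<le> h k z" unfolding hk by (rule ennreal_leI)
      also have "\<dots> \<le> (\<Sum>k. h k z)" using sum_le_suminf[of "\<lambda>k. h k z" "{k}"] by simp
      finally show ?thesis by (simp add: v_def)
    qed
    have int_h: "(\<integral>\<^sup>+z. h k z \<partial>lborel) = ennreal (16 * pi * \<delta> powr (2 - s) * \<theta> ^ k)" for k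
    proof -
      have "(\<integral>\<^sup>+z. h k z \<partial>lborel) = ennreal ((2 ^ k * \<delta>) powr (- s)) * emeasure lborel (ball b (2 ^ (k + 2) * \<delta>))"
        unfolding h_def by (subst nn_integral_cmult_indicator) auto
      also have "\<dots> = ennreal ((2 ^ k * \<delta>) powr (- s) * (pi * (2 ^ (k + 2) * \<delta>)\<^sup>2))"
        using \<delta> by (subst emeasure_complex_ball) (auto simp: ennreal_mult)
      also have "(2 ^ k * \<delta>) powr (- s) * (pi * (2 ^ (k + 2) * \<delta>)\<^sup>2)
          = 16 * pi * ((2 ^ k * \<delta>) powr (- s) * (2 ^ k * \<delta>) powr 2)"
        using \<delta> by (simp add: power_mult_distrib power_add)
      also have "(2 ^ k * \<delta>) powr (- s) * (2 ^ k * \<delta>) powr 2 = (2 ^ k * \<delta>) powr (2 - s)"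
        by (simp add: powr_add[symmetric])
      also have "\<dots> = \<delta> powr (2 - s) * \<theta> ^ k"
      proof -
        have "\<theta> ^ k = \<theta> powr real k" using \<theta> by (simp only: powr_realpow)
        also have "\<dots> = (2 powr real k) powr (2 - s)"
          unfolding \<theta>_def powr_powr by (simp add: mult.commute)
        also have "2 powr real k = 2 ^ k" by (rule powr_realpow) simp
        finally show ?thesis using \<delta> by (simp add: powr_mult)
      qed
      finally show ?thesis by (simp add: mult_ac)
    qed
    have meas: "h k \<in> borel_measurable lborel" for k
    proof -
      have "(\<lambda>z. indicator (ball b (2 ^ (k + 2) * \<delta>)) z :: ennreal) \<in> borel_measurable lborel"
        by (rule borel_measurable_indicator) simp
      then show ?thesis unfolding h_def by (rule borel_measurable_times_ennreal[OF borel_measurable_const])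
    qed
    have "dint (\<lambda>z. cmod (1 - cnj a * z) powr (- s))
        \<le> (\<integral>\<^sup>+z. (\<Sum>k. h k z) \<partial>lborel)"
    proof (rule nn_integral_mono)
      fix z
      show "ennreal (cmod (1 - cnj a * z) powr (- s)) * indicator unit_disc z \<le> (\<Sum>k. h k z)"
        using pt[of z] by (cases "z \<in> unit_disc") (simp_all del: unit_disc_iff)
    qed
    also have "\<dots> = (\<Sum>k. \<integral>\<^sup>+z. h k z \<partial>lborel)"
      using meas by (rule nn_integral_suminf)
    also have "\<dots> = ennreal (\<Sum>k. 16 * pi * \<delta> powr (2 - s) * \<theta> ^ k)"
      unfolding int_h using \<theta> by (intro suminf_ennreal2 summable_mult summable_geometric) auto
    also have "(\<Sum>k. 16 * pi * \<delta> powr (2 - s) * \<theta> ^ k) = 16 * pi / (1 - \<theta>) * \<delta> powr (2 - s)"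
      using \<theta> by (subst suminf_mult) (auto simp: suminf_geometric)
    also have "\<dots> \<le> C * \<delta> powr (2 - s)" by (intro mult_right_mono) (auto simp: C_def)
    finally show ?thesis by (simp add: \<delta>_def ennreal_leI)
  qed
  then show ?thesis using C by blast
qed

text \<open>The singular weight is removed by the Littlewood--Paley inequality with exponent 1 for
  the power -M of 1 - cnj a z. The derivative comes with the weight
  \<open>bd z powr (1 - \<epsilon>)\<close>, now a positive power, which |1 - cnj a z| dominates;
  what remains is the unweighted integral with exponent M + \<epsilon>.\<close>

lemma forelli_rudin_weighted:
  assumes \<epsilon>: "0 < \<epsilon>" "\<epsilon> \<le> 1 / 4" and M: "(M::nat) \<ge> 2"
  shows "\<exists>C>0. \<forall>a. cmod a < 1 \<longrightarrow>
    dint (\<lambda>z. bd z powr (- \<epsilon>) / cmod (1 - cnj a * z) ^ M)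
      \<le> ennreal (C * bd a powr (2 - \<epsilon> - real M))"
proof -
  obtain C1 where C1: "C1 > 0" and lp: "\<And>F. F holomorphic_on unit_disc \<Longrightarrow>
    dint (\<lambda>z. cmod (F z) powr 1 * bd z powr (- \<epsilon>))
      \<le> ennreal C1 * (ennreal (cmod (F 0) powr 1)
          + dint (\<lambda>z. cmod (deriv F z) powr 1 * bd z powr (- \<epsilon> + 1)))"
    using littlewood_paley_le[of 1 "- \<epsilon>"] \<epsilon> by auto
  obtain C2 where C2: "C2 > 0" and fr: "\<And>a. cmod a < 1 \<Longrightarrow>
    dint (\<lambda>z. cmod (1 - cnj a * z) powr (- (real M + \<epsilon>)))
      \<le> ennreal (C2 * bd a powr (2 - (real M + \<epsilon>)))"
    using forelli_rudin_unweighted[of "real M + \<epsilon>"] \<epsilon> M by force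
  define C where "C = C1 * (1 + real M * C2)"
  have C: "C > 0" using C1 C2 by (simp add: C_def add_pos_nonneg)
  have "dint (\<lambda>z. bd z powr (- \<epsilon>) / cmod (1 - cnj a * z) ^ M)
      \<le> ennreal (C * bd a powr (2 - \<epsilon> - real M))" if a: "cmod a < 1" for a
  proof -
    define F where "F = (\<lambda>z. 1 / (1 - cnj a * z) ^ M)"
    have nz: "1 - cnj a * z \<noteq> 0" if "z \<in> unit_disc" for z
      using one_minus_cnj_pos[OF a, of z] that by auto
    have der: "(F has_field_derivative (of_nat M * cnj a / (1 - cnj a * z) ^ Suc M)) (at z)"
      if z: "z \<in> unit_disc" for z
      unfolding F_def by (rule DERIV_inverse_linear_power[OF nz[OF z]])
    have hol: "F holomorphic_on unit_disc" unfolding F_def using nz by (intro holomorphic_intros) auto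
    have pt: "cmod (deriv F z) powr 1 * bd z powr (- \<epsilon> + 1) \<le> real M * cmod (1 - cnj a * z) powr (- (real M + \<epsilon>))"
      if z: "z \<in> unit_disc" for z
    proof -
      define v where "v = cmod (1 - cnj a * z)"
      have v: "v > 0" using one_minus_cnj_pos[OF a, of z] z by (simp add: v_def)
      have "cmod (deriv F z) = real M * cmod a * (1 / v ^ Suc M)"
        using DERIV_imp_deriv[OF der[OF z]] by (simp add: norm_mult norm_divide norm_power v_def)
      also have "\<dots> \<le> real M * 1 * (1 / v ^ Suc M)"
        using a v by (intro mult_right_mono mult_left_mono) auto
      also have "1 / v ^ Suc M = v powr (- real (Suc M))"
        using v by (simp only: powr_minus powr_realpow inverse_eq_divide)
      finally have "cmod (deriv F z) powr 1 \<le> real M * v powr (- real (Suc M))" by simp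
      moreover have "bd z powr (- \<epsilon> + 1) \<le> v powr (- \<epsilon> + 1)"
        using \<epsilon> one_minus_cnj_ge(2)[of a z] a z by (intro powr_mono2) (auto simp: v_def)
      ultimately have "cmod (deriv F z) powr 1 * bd z powr (- \<epsilon> + 1)
          \<le> real M * v powr (- real (Suc M)) * v powr (- \<epsilon> + 1)"
        by (intro mult_mono) auto
      also have "\<dots> = real M * v powr (- (real M + \<epsilon>))" by (simp add: powr_add[symmetric])
      finally show ?thesis by (simp add: v_def)
    qed
    define J where "J = dint (\<lambda>z. cmod (1 - cnj a * z) powr (- (real M + \<epsilon>)))"
    have "dint (\<lambda>z. bd z powr (- \<epsilon>) / cmod (1 - cnj a * z) ^ M)
        = dint (\<lambda>z. cmod (F z) powr 1 * bd z powr (- \<epsilon>))"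
      by (intro nn_integral_cong) (auto simp: F_def norm_divide norm_power split: split_indicator)
    also have "\<dots> \<le> ennreal C1 * (ennreal (cmod (F 0) powr 1)
          + dint (\<lambda>z. cmod (deriv F z) powr 1 * bd z powr (- \<epsilon> + 1)))"
      by (rule lp[OF hol])
    also have "dint (\<lambda>z. cmod (deriv F z) powr 1 * bd z powr (- \<epsilon> + 1))
        \<le> (\<integral>\<^sup>+z. ennreal (real M) * (ennreal (cmod (1 - cnj a * z) powr (- (real M + \<epsilon>))) * indicator unit_disc z) \<partial>lborel)"
      using pt by (intro nn_integral_mono)
         (auto simp: ennreal_mult[symmetric] split: split_indicator intro!: ennreal_leI)
    also have "\<dots> = ennreal (real M) * J"
      unfolding J_def
      using measurable_ennreal_indicator_continuous[OF continuous_on_cnj_powr[OF a] borel_unit_disc]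
      by (intro nn_integral_cmult) auto
    also have "J \<le> ennreal (C2 * bd a powr (2 - (real M + \<epsilon>)))" unfolding J_def by (rule fr[OF a])
    also have "ennreal (cmod (F 0) powr 1) \<le> ennreal (bd a powr (2 - (real M + \<epsilon>)))"
    proof (rule ennreal_leI)
      have "1 powr (2 - (real M + \<epsilon>)) \<le> bd a powr (2 - (real M + \<epsilon>))"
        using a M \<epsilon> by (intro powr_mono2') auto
      then show "cmod (F 0) powr 1 \<le> bd a powr (2 - (real M + \<epsilon>))" by (simp add: F_def)
    qed
    also have "ennreal C1 * (ennreal (bd a powr (2 - (real M + \<epsilon>))) + ennreal (real M) * ennreal (C2 * bd a powr (2 - (real M + \<epsilon>))))
        = ennreal (C1 * (bd a powr (2 - (real M + \<epsilon>)) + real M * (C2 * bd a powr (2 - (real M + \<epsilon>)))))"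
      using C1 C2 by (simp add: ennreal_mult[symmetric] ennreal_plus[symmetric] del: ennreal_plus)
    also have "C1 * (bd a powr (2 - (real M + \<epsilon>)) + real M * (C2 * bd a powr (2 - (real M + \<epsilon>))))
        = C * bd a powr (2 - \<epsilon> - real M)"
      by (simp add: C_def algebra_simps)
    finally show ?thesis by (simp add: add_left_mono add_right_mono mult_left_mono)
  qed
  then show ?thesis using C by blast
qed

section \<open>Separated sets and test functions\<close>

text \<open>Separation in the hyperbolic sense. Both orders of the pair are quantified, so the
  distance dominates \<open>bd a / 4\<close> as well as \<open>bd b / 4\<close>.\<close>

definition separated :: "complex set \<Rightarrow> bool" where
  "separated J \<longleftrightarrow> (\<forall>a\<in>J. \<forall>b\<in>J. a \<noteq> b \<longrightarrow> bd a \<le> 4 * cmod (a - b))"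

lemma separatedD: "separated J \<Longrightarrow> a \<in> J \<Longrightarrow> b \<in> J \<Longrightarrow> a \<noteq> b \<Longrightarrow> bd a \<le> 4 * cmod (a - b)"
  by (simp add: separated_def)

text \<open>A common point would give |a - b| < \<open>bd a / 8 + bd b / 8\<close>, and separation
  bounds each summand by |a - b| / 2.\<close>

lemma separated_balls_unique:
  assumes "separated J" "a \<in> J" "b \<in> J" "z \<in> ball a (bd a / 8)" "z \<in> ball b (bd b / 8)"
  shows "a = b"
proof (rule ccontr)
  assume "a \<noteq> b"
  then have "bd a \<le> 4 * cmod (a - b)" "bd b \<le> 4 * cmod (b - a)"
    using separatedD[OF assms(1)] assms(2,3) by auto
  moreover have "cmod (a - b) < bd a / 8 + bd b / 8"
  proof -
    have "dist a z < bd a / 8" "dist b z < bd b / 8" using assms by auto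
    then have "dist a b < bd a / 8 + bd b / 8" using dist_triangle2[of a b z] by linarith
    then show ?thesis by (simp only: dist_norm)
  qed
  ultimately show False by (simp add: norm_minus_commute field_simps)
qed

lemma nn_integral_separated_balls_le:
  assumes "finite J" "separated J" and "\<phi> \<in> borel_measurable borel"
    and "\<And>a. a \<in> J \<Longrightarrow> ball a (bd a / 8) \<subseteq> S"
  shows "(\<Sum>a\<in>J. \<integral>\<^sup>+z\<in>ball a (bd a / 8). \<phi> z \<partial>lborel) \<le> (\<integral>\<^sup>+z\<in>S. \<phi> z \<partial>lborel)"
proof -
  have "(\<Sum>a\<in>J. \<phi> z * indicator (ball a (bd a / 8)) z) \<le> \<phi> z * indicator S z" for z
  proof (cases "\<exists>a\<in>J. z \<in> ball a (bd a / 8)")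
    case True
    then obtain a where a: "a \<in> J" "z \<in> ball a (bd a / 8)" by blast
    have "(\<Sum>b\<in>J. \<phi> z * indicator (ball b (bd b / 8)) z)
        = (\<Sum>b\<in>J. if b = a then \<phi> z else 0)"
    proof (intro sum.cong refl)
      fix b assume b: "b \<in> J"
      show "\<phi> z * indicator (ball b (bd b / 8)) z = (if b = a then \<phi> z else 0)"
      proof (cases "b = a")
        case True
        then show ?thesis using a(2) by simp
      next
        case False
        then have "z \<notin> ball b (bd b / 8)"
          using separated_balls_unique[OF assms(2) b a(1) _ a(2)] by blast
        then show ?thesis using False by simp
      qed
    qed
    also have "\<dots> = \<phi> z" using a assms(1) by simp
    finally show ?thesis using a assms(4)[OF a(1)] by (auto split: split_indicator)
  next
    case False
    then have "(\<Sum>a\<in>J. \<phi> z * indicator (ball a (bd a / 8)) z) = 0"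
      by (intro sum.neutral) auto
    then show ?thesis by simp
  qed
  then have "(\<integral>\<^sup>+z. (\<Sum>a\<in>J. \<phi> z * indicator (ball a (bd a / 8)) z) \<partial>lborel) \<le> (\<integral>\<^sup>+z\<in>S. \<phi> z \<partial>lborel)"
    by (intro nn_integral_mono)
  moreover have "(\<lambda>z. \<phi> z * indicator (ball a (bd a / 8)) z) \<in> borel_measurable lborel" for a
    using assms(3) by (intro borel_measurable_times_ennreal borel_measurable_indicator) auto
  ultimately show ?thesis by (subst (asm) nn_integral_sum) auto
qed

text \<open>Comparison of areas: disjoint discs of radius at least \<open>e / 8\<close> lie in one
  disc of radius \<open>R\<close>.\<close>

lemma separated_card_bound:
  assumes "finite J" "separated J" "J \<subseteq> unit_disc" "0 < e" "\<And>a. a \<in> J \<Longrightarrow> e \<le> bd a"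
    and "\<And>a. a \<in> J \<Longrightarrow> ball a (bd a / 8) \<subseteq> ball z R" "R \<ge> 0"
  shows "real (card J) * e\<^sup>2 \<le> 64 * R\<^sup>2"
proof -
  have "ennreal (real (card J) * (pi * (e / 8)\<^sup>2)) = (\<Sum>a\<in>J. ennreal (pi * (e / 8)\<^sup>2))"
    by (simp add: ennreal_mult ennreal_of_nat_eq_real_of_nat)
  also have "\<dots> \<le> (\<Sum>a\<in>J. emeasure lborel (ball a (bd a / 8)))"
  proof (intro sum_mono)
    fix a assume a: "a \<in> J"
    have "(e / 8)\<^sup>2 \<le> (bd a / 8)\<^sup>2" using assms a by (intro power_mono) auto
    then show "ennreal (pi * (e / 8)\<^sup>2) \<le> emeasure lborel (ball a (bd a / 8))"
      using assms a by (subst emeasure_complex_ball) (auto intro!: ennreal_leI)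
  qed
  also have "\<dots> = (\<Sum>a\<in>J. \<integral>\<^sup>+z\<in>ball a (bd a / 8). 1 \<partial>lborel)" by simp
  also have "\<dots> \<le> (\<integral>\<^sup>+z\<in>ball z R. 1 \<partial>lborel)"
    using assms by (intro nn_integral_separated_balls_le) auto
  also have "\<dots> = ennreal (pi * R\<^sup>2)" using assms by (simp add: emeasure_complex_ball)
  finally have "real (card J) * (pi * (e / 8)\<^sup>2) \<le> pi * R\<^sup>2"
    by (subst (asm) ennreal_le_iff) auto
  then have "pi * (real (card J) * e\<^sup>2) \<le> pi * (64 * R\<^sup>2)"
    by (simp add: power_divide field_simps)
  then show ?thesis by simp
qed

text \<open>If \<open>z\<close> lies in the half-radius disc about \<open>a\<close>, then
  \<open>bd a\<close> is at least 2/3 of \<open>bd z\<close>, and the small disc about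
  \<open>a\<close> lies in the disc of radius \<open>2 * bd z\<close> about \<open>z\<close>. The
  area count gives 64 * 4 / (4/9) = 576.\<close>

lemma separated_overlap:
  assumes "finite J" "separated J" "J \<subseteq> unit_disc" "cmod z < 1"
  shows "card {a \<in> J. z \<in> ball a (bd a / 2)} \<le> 576"
proof -
  define I where "I = {a \<in> J. z \<in> ball a (bd a / 2)}"
  have near: "2 / 3 * bd z \<le> bd a" "ball a (bd a / 8) \<subseteq> ball z (2 * bd z)" if a: "a \<in> I" for a
  proof -
    have az: "cmod (a - z) < bd a / 2" "cmod a < 1"
      using a assms by (auto simp: I_def dist_norm subset_iff)
    have d: "\<bar>cmod a - cmod z\<bar> \<le> cmod (a - z)" by (rule norm_triangle_ineq3)
    show "2 / 3 * bd z \<le> bd a" using az d by (simp add: field_simps)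
    have 2: "bd a \<le> 2 * bd z" using az d by (simp add: field_simps)
    show "ball a (bd a / 8) \<subseteq> ball z (2 * bd z)"
    proof
      fix w assume "w \<in> ball a (bd a / 8)"
      then have "dist a w < bd a / 8" "dist a z < bd a / 2" using az by (auto simp: dist_norm)
      then have "dist z w < bd a / 2 + bd a / 8"
        using dist_triangle3[of z w a] by linarith
      then show "w \<in> ball z (2 * bd z)" using 2 assms(4) by simp
    qed
  qed
  have "real (card I) * (2 / 3 * bd z)\<^sup>2 \<le> 64 * (2 * bd z)\<^sup>2"
    using assms near by (intro separated_card_bound[of I _ z]) (auto simp: I_def separated_def)
  moreover have "(2 / 3 * bd z)\<^sup>2 = 4 / 9 * (bd z)\<^sup>2" "(2 * bd z)\<^sup>2 = 4 * (bd z)\<^sup>2"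
    unfolding power_mult_distrib by (simp_all add: power2_eq_square)
  ultimately have "real (card I) * (bd z)\<^sup>2 \<le> 576 * (bd z)\<^sup>2" by (simp only:)
  then have "real (card I) \<le> 576" using assms by simp
  then show ?thesis by (simp add: I_def)
qed

text \<open>On |z| \<le> \<open>R\<close> the area count bounds the cardinality of separated sets,
  so one of greatest cardinality exists. If it failed to cover a point, that point could be
  added.\<close>

lemma maximal_separated:
  assumes R: "R < 1"
  obtains J where "finite J" "separated J" "J \<subseteq> {z. 1 / 2 \<le> cmod z \<and> cmod z \<le> R}"
    "\<And>z. 1 / 2 \<le> cmod z \<Longrightarrow> cmod z \<le> R \<Longrightarrow> \<exists>a\<in>J. z \<in> ball a (bd a / 3)"
proof -
  define K where "K = {z. 1 / 2 \<le> cmod z \<and> cmod z \<le> R}"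
  define P where "P = (\<lambda>J. finite J \<and> separated J \<and> J \<subseteq> K)"
  obtain N :: nat where N: "256 / (1 - R)\<^sup>2 < real N" using reals_Archimedean2 by blast
  have "card J < N" if "P J" for J
  proof -
    have "real (card J) * (1 - R)\<^sup>2 \<le> 64 * 2\<^sup>2"
    proof (rule separated_card_bound)
      show "ball a (bd a / 8) \<subseteq> ball 0 2" if "a \<in> J" for a
      proof
        fix w assume "w \<in> ball a (bd a / 8)"
        moreover have "cmod a < 1" using \<open>P J\<close> \<open>a \<in> J\<close> R by (auto simp: P_def K_def)
        ultimately have "dist 0 w < 1 + bd a / 8"
          using dist_triangle[of 0 w a] by (simp add: field_simps)
        moreover have "bd a / 8 \<le> 1" using norm_ge_zero[of a] by (simp add: field_simps del: norm_ge_zero)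
        ultimately show "w \<in> ball 0 2" unfolding mem_ball by linarith
      qed
    qed (use that R in \<open>auto simp: P_def K_def\<close>)
    then have "real (card J) \<le> 256 / (1 - R)\<^sup>2" using R by (simp add: field_simps)
    then show ?thesis using N by simp
  qed
  moreover have "P {}" by (simp add: P_def separated_def)
  ultimately obtain J where J: "P J" and max: "\<And>I. P I \<Longrightarrow> card I \<le> card J"
    using ex_has_greatest_nat[of P "{}" card N] by blast
  show thesis
  proof (rule that)
    show "finite J" "separated J" "J \<subseteq> {z. 1 / 2 \<le> cmod z \<and> cmod z \<le> R}"
      using J by (auto simp: P_def K_def)
    show "\<exists>a\<in>J. z \<in> ball a (bd a / 3)" if z: "1 / 2 \<le> cmod z" "cmod z \<le> R" for z
    proof (rule ccontr)
      assume "\<not> (\<exists>a\<in>J. z \<in> ball a (bd a / 3))"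
      then have far: "bd a / 3 \<le> cmod (a - z)" if "a \<in> J" for a
        using that by (force simp: dist_norm)
      have lt: "cmod a < 1" if "a \<in> J" for a using J that R by (auto simp: P_def K_def)
      \<comment> \<open>An uncovered \<open>z\<close> satisfies \<open>bd a\<close> \<le> 3 |a - z|,
        and \<open>bd z\<close> exceeds \<open>bd a\<close> by at most |a - z|. This is how the
        radius 1/3 fits the constant 4 of \<open>separated\<close>.\<close>
      have "bd a \<le> 4 * cmod (a - z)" "bd z \<le> 4 * cmod (z - a)" if a: "a \<in> J" for a
        using far[OF a] lt[OF a] norm_triangle_ineq3[of a z] by (auto simp: norm_minus_commute)
      then have "separated (insert z J)" using J unfolding P_def separated_def by auto
      then have "P (insert z J)" using J z by (auto simp: P_def K_def)
      then have "card (insert z J) \<le> card J" by (rule max)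
      moreover have "z \<notin> J" using far[of z] lt[of z] by auto
      ultimately show False using J by (simp add: P_def)
    qed
  qed
qed

text \<open>The sum is a Riemann sum: on the disc of radius \<open>bd a / 8\<close> about
  \<open>a\<close> the modulus of 1 - cnj z w is at most twice its value at \<open>a\<close>, so
  each term is dominated by an integral over that disc. The discs are disjoint, and the
  Forelli--Rudin estimate with exponent 2 + \<eta> bounds the total.\<close>

lemma separated_sum_le:
  assumes \<eta>: "\<eta> > 0"
  shows "\<exists>C>0. \<forall>J z. finite J \<longrightarrow> separated J \<longrightarrow> J \<subseteq> unit_disc \<longrightarrow> cmod z < 1 \<longrightarrow>
    (\<Sum>a\<in>J. (bd a)\<^sup>2 * cmod (1 - cnj z * a) powr (- (2 + \<eta>))) \<le> C * bd z powr (- \<eta>)"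
proof -
  obtain C where C: "C > 0" and fr: "\<And>a. cmod a < 1 \<Longrightarrow>
    dint (\<lambda>z. cmod (1 - cnj a * z) powr (- (2 + \<eta>))) \<le> ennreal (C * bd a powr (2 - (2 + \<eta>)))"
    using forelli_rudin_unweighted[of "2 + \<eta>"] \<eta> by auto
  define L where "L = 64 / pi * 2 powr (2 + \<eta>)"
  have L: "L > 0" by (simp add: L_def)
  have "(\<Sum>a\<in>J. (bd a)\<^sup>2 * cmod (1 - cnj z * a) powr (- (2 + \<eta>))) \<le> L * C * bd z powr (- \<eta>)"
    if J: "finite J" "separated J" "J \<subseteq> unit_disc" and z: "cmod z < 1" for J z
  proof -
    define \<phi> where "\<phi> = (\<lambda>w. ennreal (cmod (1 - cnj z * w) powr (- (2 + \<eta>))) * indicator unit_disc w)"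
    have [measurable]: "\<phi> \<in> borel_measurable borel"
      unfolding \<phi>_def by (intro measurable_ennreal_indicator_continuous continuous_on_cnj_powr z) auto
    have term_le: "ennreal ((bd a)\<^sup>2 * cmod (1 - cnj z * a) powr (- (2 + \<eta>)))
        \<le> ennreal L * (\<integral>\<^sup>+w\<in>ball a (bd a / 8). \<phi> w \<partial>lborel)" if a: "a \<in> J" for a
    proof -
      define v where "v = cmod (1 - cnj z * a)"
      have a1: "cmod a < 1" using a J by auto
      have v: "v > 0" using one_minus_cnj_pos[OF z a1] by (simp add: v_def)
      have pt: "ennreal ((2 * v) powr (- (2 + \<eta>))) \<le> \<phi> w" if w: "w \<in> ball a (bd a / 8)" for w
      proof -
        have w1: "cmod (w - a) < bd a / 8" using w by (simp add: dist_norm norm_minus_commute)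
        then have w2: "cmod w < 1" using norm_triangle_ineq2[of w a] a1 by (simp add: field_simps)
        have "1 - cnj z * w = (1 - cnj z * a) - cnj z * (w - a)" by (simp add: algebra_simps)
        then have "cmod (1 - cnj z * w) \<le> v + cmod z * cmod (w - a)"
          by (metis norm_triangle_ineq4 v_def norm_mult complex_mod_cnj)
        also have "cmod z * cmod (w - a) \<le> 1 * (bd a / 8)" using z w1 by (intro mult_mono) auto
        also have "v + 1 * (bd a / 8) \<le> 2 * v"
          using one_minus_cnj_ge(2)[of z a] z a1 by (simp add: v_def)
        finally have "cmod (1 - cnj z * w) \<le> 2 * v" by simp
        then have "(2 * v) powr (- (2 + \<eta>)) \<le> cmod (1 - cnj z * w) powr (- (2 + \<eta>))"
          using one_minus_cnj_pos[OF z w2] \<eta> by (intro powr_mono2') auto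
        then show ?thesis using w2 by (simp add: \<phi>_def ennreal_leI)
      qed
      have "(bd a)\<^sup>2 * v powr (- (2 + \<eta>)) = L * ((2 * v) powr (- (2 + \<eta>)) * (pi * (bd a / 8)\<^sup>2))"
      proof -
        define Q :: real where "Q = 2 powr (- (2 + \<eta>))"
        define V where "V = v powr (- (2 + \<eta>))"
        define P :: real where "P = 2 powr (2 + \<eta>)"
        have PQ: "P * Q = 1" unfolding P_def Q_def powr_add[symmetric] by simp
        have "L * (Q * V * (pi * (bd a / 8)\<^sup>2)) = (P * Q) * ((bd a)\<^sup>2 * V)"
          unfolding L_def P_def[symmetric] power_divide by simp
        then show ?thesis using PQ by (simp only: powr_mult Q_def V_def mult_1_left)
      qed
      then have "ennreal ((bd a)\<^sup>2 * v powr (- (2 + \<eta>)))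
          = ennreal L * (ennreal ((2 * v) powr (- (2 + \<eta>))) * emeasure lborel (ball a (bd a / 8)))"
        using L a1 by (subst emeasure_complex_ball) (auto simp: ennreal_mult)
      also have "ennreal ((2 * v) powr (- (2 + \<eta>))) * emeasure lborel (ball a (bd a / 8))
          = (\<integral>\<^sup>+w. ennreal ((2 * v) powr (- (2 + \<eta>))) * indicator (ball a (bd a / 8)) w \<partial>lborel)"
        by (subst nn_integral_cmult_indicator) auto
      also have "\<dots> \<le> (\<integral>\<^sup>+w\<in>ball a (bd a / 8). \<phi> w \<partial>lborel)"
        using pt by (intro nn_integral_mono) (auto split: split_indicator)
      finally show ?thesis by (simp add: v_def mult_left_mono)
    qed
    have "ennreal (\<Sum>a\<in>J. (bd a)\<^sup>2 * cmod (1 - cnj z * a) powr (- (2 + \<eta>)))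
        = (\<Sum>a\<in>J. ennreal ((bd a)\<^sup>2 * cmod (1 - cnj z * a) powr (- (2 + \<eta>))))"
      by (subst sum_ennreal) auto
    also have "\<dots> \<le> (\<Sum>a\<in>J. ennreal L * (\<integral>\<^sup>+w\<in>ball a (bd a / 8). \<phi> w \<partial>lborel))"
      by (intro sum_mono term_le)
    also have "\<dots> = ennreal L * (\<Sum>a\<in>J. \<integral>\<^sup>+w\<in>ball a (bd a / 8). \<phi> w \<partial>lborel)"
      by (simp add: sum_distrib_left)
    also have "(\<Sum>a\<in>J. \<integral>\<^sup>+w\<in>ball a (bd a / 8). \<phi> w \<partial>lborel) \<le> (\<integral>\<^sup>+w\<in>UNIV. \<phi> w \<partial>lborel)"
      using J by (intro nn_integral_separated_balls_le) auto
    also have "\<dots> \<le> ennreal (C * bd z powr (2 - (2 + \<eta>)))"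
      using fr[OF z] by (simp add: \<phi>_def)
    also have "ennreal L * \<dots> = ennreal (L * C * bd z powr (- \<eta>))"
      using L C by (simp add: ennreal_mult[symmetric] mult.assoc)
    finally have "ennreal (\<Sum>a\<in>J. (bd a)\<^sup>2 * cmod (1 - cnj z * a) powr (- (2 + \<eta>))) \<le> ennreal (L * C * bd z powr (- \<eta>))"
      by (simp add: mult_left_mono)
    then show ?thesis using L C by (subst (asm) ennreal_le_iff) auto
  qed
  then show ?thesis using L C by (intro exI[of _ "L * C"]) auto
qed

section \<open>Sums of normalised kernels over separated sets\<close>

lemma holder_sum:
  fixes u v :: "'a \<Rightarrow> real"
  assumes "p > 1" "finite J" "\<And>a. a \<in> J \<Longrightarrow> u a \<ge> 0" "\<And>a. a \<in> J \<Longrightarrow> v a \<ge> 0"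
  shows "(\<Sum>a\<in>J. u a * v a) powr p
    \<le> (\<Sum>a\<in>J. u a powr p) * (\<Sum>a\<in>J. v a powr (p / (p - 1))) powr (p - 1)"
proof -
  define p' where "p' = p / (p - 1)"
  have p': "p' > 1" "1 / p + 1 / p' = 1" using assms(1) by (auto simp: p'_def field_simps)
  define U where "U = (\<Sum>a\<in>J. u a powr p)"
  define V where "V = (\<Sum>a\<in>J. v a powr p')"
  have nn: "U \<ge> 0" "V \<ge> 0" by (auto simp: U_def V_def intro: sum_nonneg)
  show ?thesis
  proof (cases "U = 0 \<or> V = 0")
    case True
    have "(\<Sum>a\<in>J. u a * v a) = 0"
    proof (rule sum.neutral, rule ballI)
      fix a assume a: "a \<in> J"
      have "u a powr p = 0 \<or> v a powr p' = 0"
        using True a assms(2) by (auto simp: U_def V_def sum_nonneg_eq_0_iff)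
      then show "u a * v a = 0" by auto
    qed
    then show ?thesis using nn assms(1) by (simp add: U_def)
  next
    case False
    then have pos: "U > 0" "V > 0" using nn by auto
    define s where "s = U powr (1 / p)"
    define t where "t = V powr (1 / p')"
    have st: "s > 0" "t > 0" using pos by (auto simp: s_def t_def)
    have sp: "s powr p = U" "t powr p' = V" using pos assms(1) p' by (auto simp: s_def t_def powr_powr)
    have "(\<Sum>a\<in>J. (u a / s) * (v a / t)) \<le> (\<Sum>a\<in>J. (u a / s) powr p / p + (v a / t) powr p' / p')"
      using assms p' st by (intro sum_mono Youngs_inequality) auto
    also have "\<dots> = (\<Sum>a\<in>J. u a powr p / (U * p)) + (\<Sum>a\<in>J. v a powr p' / (V * p'))"
      using assms st sp by (simp add: sum.distrib powr_divide)
    also have "\<dots> = U / (U * p) + V / (V * p')"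
      by (simp add: U_def V_def sum_divide_distrib[symmetric])
    also have "\<dots> = 1" using pos p' by simp
    finally have "(\<Sum>a\<in>J. u a * v a) \<le> s * t"
      using st by (simp add: sum_divide_distrib[symmetric] field_simps)
    then have "(\<Sum>a\<in>J. u a * v a) powr p \<le> (s * t) powr p"
      using assms by (intro powr_mono2 sum_nonneg) auto
    also have "\<dots> = U * V powr (p - 1)"
    proof -
      have "1 / p' * p = p - 1" using assms(1) by (simp add: p'_def)
      then show ?thesis using st sp pos by (simp add: powr_mult t_def powr_powr)
    qed
    finally show ?thesis by (simp add: U_def V_def p'_def)
  qed
qed

text \<open>After division by the total every term lies in [0, 1], where raising to a power at most
  1 does not decrease it.\<close>

lemma powr_sum_subadditive:
  fixes f :: "'a \<Rightarrow> real"
  assumes "0 < p" "p \<le> 1" "finite J" "\<And>a. a \<in> J \<Longrightarrow> f a \<ge> 0"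
  shows "(\<Sum>a\<in>J. f a) powr p \<le> (\<Sum>a\<in>J. f a powr p)"
proof (cases "(\<Sum>a\<in>J. f a) = 0")
  case True
  then show ?thesis by (simp add: sum_nonneg)
next
  case False
  define s where "s = (\<Sum>a\<in>J. f a)"
  have "s \<ge> 0" unfolding s_def using assms(4) by (rule sum_nonneg)
  then have s: "s > 0" using False by (simp add: s_def)
  have "1 = (\<Sum>a\<in>J. f a / s)" using s by (simp add: sum_divide_distrib[symmetric] s_def[symmetric])
  also have "\<dots> \<le> (\<Sum>a\<in>J. (f a / s) powr p)"
  proof (intro sum_mono)
    fix a assume a: "a \<in> J"
    have fs: "f a \<le> s" unfolding s_def using a assms by (intro member_le_sum) auto
    show "f a / s \<le> (f a / s) powr p"
      using powr_mono'[of p 1 "f a / s"] assms a fs s by simp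
  qed
  also have "\<dots> = (\<Sum>a\<in>J. f a powr p) / s powr p"
    using assms s by (simp add: powr_divide sum_divide_distrib)
  finally show ?thesis using s by (simp add: s_def field_simps)
qed

text \<open>A power of the Cauchy--Szego kernel at \<open>a\<close>. By the Forelli--Rudin estimate
  the numerator keeps the integral of the p-th power of the modulus bounded in \<open>a\<close> once
  M p > 2.\<close>

definition kern :: "nat \<Rightarrow> real \<Rightarrow> complex \<Rightarrow> complex \<Rightarrow> complex" where
  "kern M p a z = of_real (bd a powr (real M - 2 / p)) / (1 - cnj a * z) ^ M"

lemma cmod_kern:
  assumes "cmod a < 1" "cmod z < 1"
  shows "cmod (kern M p a z) = bd a powr (real M - 2 / p) * cmod (1 - cnj a * z) powr (- real M)"
  using one_minus_cnj_pos[OF assms]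
  unfolding kern_def norm_divide norm_power by (simp add: powr_minus powr_realpow divide_inverse)

lemma nn_integral_weighted_sum_le:
  fixes \<kappa> :: "'a \<Rightarrow> complex \<Rightarrow> real"
  assumes "finite J" and T: "\<And>a. a \<in> J \<Longrightarrow> T a \<ge> 0" and \<kappa>: "\<And>a z. a \<in> J \<Longrightarrow> \<kappa> a z \<ge> 0"
    and cont: "\<And>a. a \<in> J \<Longrightarrow> continuous_on unit_disc (\<kappa> a)"
    and int: "\<And>a. a \<in> J \<Longrightarrow> dint (\<lambda>z. \<kappa> a z) \<le> ennreal (t a)"
    and t: "\<And>a. a \<in> J \<Longrightarrow> t a \<ge> 0"
  shows "dint (\<lambda>z. \<Sum>a\<in>J. T a * \<kappa> a z) \<le> ennreal (\<Sum>a\<in>J. T a * t a)"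
proof -
  have meas: "(\<lambda>z. ennreal (\<kappa> a z) * indicator unit_disc z) \<in> borel_measurable lborel" if "a \<in> J" for a
    using measurable_ennreal_indicator_continuous[OF cont[OF that] borel_unit_disc] by simp
  have "dint (\<lambda>z. \<Sum>a\<in>J. T a * \<kappa> a z)
      = (\<integral>\<^sup>+z. (\<Sum>a\<in>J. ennreal (T a) * (ennreal (\<kappa> a z) * indicator unit_disc z)) \<partial>lborel)"
  proof (rule nn_integral_cong)
    fix z
    have "ennreal (\<Sum>a\<in>J. T a * \<kappa> a z) = (\<Sum>a\<in>J. ennreal (T a) * ennreal (\<kappa> a z))"
      using T \<kappa> by (subst sum_ennreal[symmetric]) (auto simp: ennreal_mult intro!: sum.cong)
    then show "ennreal (\<Sum>a\<in>J. T a * \<kappa> a z) * indicator unit_disc z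
        = (\<Sum>a\<in>J. ennreal (T a) * (ennreal (\<kappa> a z) * indicator unit_disc z))"
      by (simp add: sum_distrib_right mult.assoc)
  qed
  also have "\<dots> = (\<Sum>a\<in>J. \<integral>\<^sup>+z. ennreal (T a) * (ennreal (\<kappa> a z) * indicator unit_disc z) \<partial>lborel)"
    by (intro nn_integral_sum borel_measurable_times_ennreal borel_measurable_const meas)
  also have "\<dots> = (\<Sum>a\<in>J. ennreal (T a) * dint (\<lambda>z. \<kappa> a z))"
    by (intro sum.cong refl nn_integral_cmult meas)
  also have "\<dots> \<le> (\<Sum>a\<in>J. ennreal (T a) * ennreal (t a))"
    by (intro sum_mono mult_left_mono int) auto
  also have "\<dots> = ennreal (\<Sum>a\<in>J. T a * t a)"
    using T t by (subst sum_ennreal[symmetric]) (auto simp: ennreal_mult intro!: sum.cong)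
  finally show ?thesis .
qed

text \<open>For \<open>p\<close> \<le> 1 subadditivity of the p-th power decouples the kernels, and
  each is integrated on its own.\<close>

lemma kern_sum_powr_integral_le_1:
  assumes p: "0 < p" "p \<le> 1" and M: "real M * p > 2"
  shows "\<exists>C>0. \<forall>J c. finite J \<longrightarrow> J \<subseteq> unit_disc \<longrightarrow>
    dint (\<lambda>z. cmod (\<Sum>a\<in>J. c a * kern M p a z) powr p)
      \<le> ennreal (C * (\<Sum>a\<in>J. cmod (c a) powr p))"
proof -
  obtain C where C: "C > 0" and fr: "\<And>a. cmod a < 1 \<Longrightarrow>
    dint (\<lambda>z. cmod (1 - cnj a * z) powr (- (real M * p)))
      \<le> ennreal (C * bd a powr (2 - real M * p))"
    using forelli_rudin_unweighted[OF M] by blast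
  have "dint (\<lambda>z. cmod (\<Sum>a\<in>J. c a * kern M p a z) powr p)
      \<le> ennreal (C * (\<Sum>a\<in>J. cmod (c a) powr p))"
    if J: "finite J" "J \<subseteq> unit_disc" for J c
  proof -
    define T where "T = (\<lambda>a. cmod (c a) powr p * bd a powr (real M * p - 2))"
    have pt: "cmod (\<Sum>a\<in>J. c a * kern M p a z) powr p
        \<le> (\<Sum>a\<in>J. T a * cmod (1 - cnj a * z) powr (- (real M * p)))" if z: "cmod z < 1" for z
    proof -
      have "cmod (\<Sum>a\<in>J. c a * kern M p a z) powr p \<le> (\<Sum>a\<in>J. cmod (c a * kern M p a z)) powr p"
        using p by (intro powr_mono2 norm_sum) auto
      also have "\<dots> \<le> (\<Sum>a\<in>J. cmod (c a * kern M p a z) powr p)"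
        using p J by (intro powr_sum_subadditive) auto
      also have "\<dots> = (\<Sum>a\<in>J. T a * cmod (1 - cnj a * z) powr (- (real M * p)))"
      proof (intro sum.cong refl)
        fix a assume a: "a \<in> J"
        define v where "v = cmod (1 - cnj a * z)"
        have v: "v > 0" using one_minus_cnj_pos[of a z] a J z by (auto simp: v_def)
        have "cmod (kern M p a z) powr p = (bd a powr (real M - 2 / p) * v powr (- real M)) powr p"
          using cmod_kern[of a z] a J z by (auto simp: v_def)
        also have "\<dots> = bd a powr ((real M - 2 / p) * p) * v powr (- (real M * p))"
          using v by (simp add: powr_mult powr_powr)
        also have "(real M - 2 / p) * p = real M * p - 2" using p by (simp add: field_simps)
        finally show "cmod (c a * kern M p a z) powr p = T a * v powr (- (real M * p))"
          by (simp add: norm_mult powr_mult T_def)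
      qed
      finally show ?thesis .
    qed
    have "dint (\<lambda>z. cmod (\<Sum>a\<in>J. c a * kern M p a z) powr p)
      \<le> dint (\<lambda>z. \<Sum>a\<in>J. T a * cmod (1 - cnj a * z) powr (- (real M * p)))"
      using pt by (intro nn_integral_mono) (auto split: split_indicator intro!: ennreal_leI)
    also have "\<dots> \<le> ennreal (\<Sum>a\<in>J. T a * (C * bd a powr (2 - real M * p)))"
      using J C by (intro nn_integral_weighted_sum_le fr continuous_on_cnj_powr) (auto simp: T_def)
    also have "(\<Sum>a\<in>J. T a * (C * bd a powr (2 - real M * p))) = (\<Sum>a\<in>J. C * cmod (c a) powr p)"
    proof (intro sum.cong refl)
      fix a assume "a \<in> J"
      then have "bd a \<noteq> 0" using J by auto
      then have "bd a powr (real M * p - 2) * bd a powr (2 - real M * p) = 1"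
        by (simp add: powr_add[symmetric])
      then show "T a * (C * bd a powr (2 - real M * p)) = C * cmod (c a) powr p"
        by (simp add: T_def)
    qed
    finally show ?thesis by (simp add: sum_distrib_left)
  qed
  then show ?thesis using C by blast
qed

text \<open>Schur's test: the Hoelder weights \<open>bd a powr \<epsilon>\<close> avoid the logarithmic divergence of the sum of the
  kernels over a separated set.\<close>

lemma kern_sum_powr_integral_gt_1:
  assumes p: "p > 1" and M: "M \<ge> 3"
  shows "\<exists>C>0. \<forall>J c. finite J \<longrightarrow> separated J \<longrightarrow> J \<subseteq> unit_disc \<longrightarrow>
    dint (\<lambda>z. cmod (\<Sum>a\<in>J. c a * kern M p a z) powr p)
      \<le> ennreal (C * (\<Sum>a\<in>J. cmod (c a) powr p))"
proof -
  define p' where "p' = p / (p - 1)"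
  have p': "p' > 1" "1 / p + 1 / p' = 1" "p' * (p - 1) = p" using p by (auto simp: p'_def field_simps)
  \<comment> \<open>Small enough for both uses: \<epsilon> p must lie in the range of
    \<open>forelli_rudin_weighted\<close>, and \<eta> = \<epsilon> p' must stay below M - 2.\<close>
  define \<epsilon> where "\<epsilon> = min (1 / (4 * p)) (1 / (4 * p'))"
  define \<eta> where "\<eta> = \<epsilon> * p'"
  have \<epsilon>: "\<epsilon> > 0" using p p' by (simp add: \<epsilon>_def)
  have "\<epsilon> * p \<le> 1 / (4 * p) * p" using p by (intro mult_right_mono) (auto simp: \<epsilon>_def)
  then have \<epsilon>p: "0 < \<epsilon> * p" "\<epsilon> * p \<le> 1 / 4" using p \<epsilon> by auto
  have "\<epsilon> * p' \<le> 1 / (4 * p') * p'" using p' by (intro mult_right_mono) (auto simp: \<epsilon>_def)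
  then have \<eta>: "0 < \<eta>" "\<eta> \<le> 1 / 4" using p' \<epsilon> by (auto simp: \<eta>_def)
  have \<eta>p: "\<eta> * (p - 1) = \<epsilon> * p" using p'(3) by (simp add: \<eta>_def)
  obtain C1 where C1: "C1 > 0" and sep: "\<And>J z. finite J \<Longrightarrow> separated J \<Longrightarrow> J \<subseteq> unit_disc \<Longrightarrow> cmod z < 1 \<Longrightarrow>
    (\<Sum>a\<in>J. (bd a)\<^sup>2 * cmod (1 - cnj z * a) powr (- (2 + \<eta>))) \<le> C1 * bd z powr (- \<eta>)"
    using separated_sum_le[OF \<eta>(1)] by blast
  obtain C2 where C2: "C2 > 0" and fr: "\<And>a. cmod a < 1 \<Longrightarrow>
    dint (\<lambda>z. bd z powr (- (\<epsilon> * p)) / cmod (1 - cnj a * z) ^ M)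
      \<le> ennreal (C2 * bd a powr (2 - \<epsilon> * p - real M))"
    using forelli_rudin_weighted[OF \<epsilon>p, of M] M by auto
  define C where "C = C1 powr (p - 1) * C2"
  have C: "C > 0" using C1 C2 by (simp add: C_def)
  have "dint (\<lambda>z. cmod (\<Sum>a\<in>J. c a * kern M p a z) powr p)
      \<le> ennreal (C * (\<Sum>a\<in>J. cmod (c a) powr p))"
    if J: "finite J" "separated J" "J \<subseteq> unit_disc" for J c
  proof -
    define T where "T = (\<lambda>a. C1 powr (p - 1) * (cmod (c a) powr p * bd a powr (real M - 2 + \<epsilon> * p)))"
    define \<kappa> where "\<kappa> = (\<lambda>a z. bd z powr (- (\<epsilon> * p)) / cmod (1 - cnj a * z) ^ M)"
    have pt: "cmod (\<Sum>a\<in>J. c a * kern M p a z) powr p \<le> (\<Sum>a\<in>J. T a * \<kappa> a z)" if z: "cmod z < 1" for z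
    proof -
      \<comment> \<open>Each term is split as u v, with \<open>W\<close> shared in the proportion 1
        / p to 1 / p'. The opposite powers of \<open>bd a\<close> with exponent \<epsilon> cancel in
        the product; they make the sum of the powers of \<open>v\<close> at most a multiple of
        \<open>bd z powr (- \<eta>)\<close>, whose power p - 1 is the weight
        \<open>bd z powr (- (\<epsilon> * p))\<close>.\<close>
      define W where "W = (\<lambda>a. cmod (1 - cnj a * z) powr real M)"
      define u where "u = (\<lambda>a. cmod (c a) * bd a powr ((real M - 2) / p + \<epsilon>) * W a powr (- (1 / p)))"
      define v where "v = (\<lambda>a. bd a powr (real M / p' - \<epsilon>) * W a powr (- (1 / p')))"
      have a1: "cmod a < 1" "cmod (1 - cnj a * z) > 0" if "a \<in> J" for a
        using that J one_minus_cnj_pos[of a z] z by auto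
      have W: "W a = cmod (1 - cnj a * z) ^ M" "W a > 0" if "a \<in> J" for a
        using a1[OF that] by (auto simp: W_def powr_realpow)
      have uv: "cmod (c a * kern M p a z) = u a * v a" if a: "a \<in> J" for a
      proof -
        have "u a * v a = cmod (c a) * (bd a powr ((real M - 2) / p + \<epsilon>) * bd a powr (real M / p' - \<epsilon>))
            * (W a powr (- (1 / p)) * W a powr (- (1 / p')))"
          by (simp add: u_def v_def)
        also have "W a powr (- (1 / p)) * W a powr (- (1 / p')) = W a powr (- 1)"
          unfolding powr_add[symmetric] using p'(2) by (intro arg_cong2[where f="(powr)"]) auto
        also have "bd a powr ((real M - 2) / p + \<epsilon>) * bd a powr (real M / p' - \<epsilon>) = bd a powr (real M - 2 / p)"
        proof -
          have "(real M - 2) / p + \<epsilon> + (real M / p' - \<epsilon>) = real M * (1 / p + 1 / p') - 2 / p"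
            by (simp add: diff_divide_distrib distrib_left)
          then show ?thesis unfolding powr_add[symmetric] p'(2) by simp
        qed
        also have "W a powr (- 1) = cmod (1 - cnj a * z) powr (- real M)"
          by (simp only: W_def powr_powr) simp
        finally show ?thesis using a1[OF a] cmod_kern[of a z] z by (simp add: norm_mult)
      qed
      have up: "u a powr p = cmod (c a) powr p * bd a powr (real M - 2 + \<epsilon> * p) / W a" if a: "a \<in> J" for a
      proof -
        have "u a powr p = cmod (c a) powr p * bd a powr (((real M - 2) / p + \<epsilon>) * p) * W a powr (- (1 / p) * p)"
          by (simp only: u_def powr_mult powr_powr)
        also have "((real M - 2) / p + \<epsilon>) * p = real M - 2 + \<epsilon> * p" using p by (simp add: field_simps)
        also have "- (1 / p) * p = - 1" using p by simp
        finally show ?thesis using W[OF a] by (simp add: powr_minus divide_inverse)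
      qed
      have vp: "v a powr p' \<le> (bd a)\<^sup>2 * cmod (1 - cnj z * a) powr (- (2 + \<eta>))" if a: "a \<in> J" for a
      proof -
        define x where "x = cmod (1 - cnj a * z)"
        have x: "x > 0" using a1[OF a] by (simp add: x_def)
        have "v a powr p' = bd a powr ((real M / p' - \<epsilon>) * p') * W a powr (- (1 / p') * p')"
          by (simp only: v_def powr_mult powr_powr)
        also have "(real M / p' - \<epsilon>) * p' = 2 + (real M - 2 - \<eta>)" using p' by (simp add: field_simps \<eta>_def)
        also have "- (1 / p') * p' = - 1" using p' by simp
        also have "W a powr (- 1) = x powr (- real M)" unfolding W_def x_def powr_powr by simp
        also have "bd a powr (2 + (real M - 2 - \<eta>)) = (bd a)\<^sup>2 * bd a powr (real M - 2 - \<eta>)"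
          unfolding powr_add using a1[OF a] by simp
        \<comment> \<open>The surplus power of \<open>bd a\<close> is traded for the same power of
          \<open>x\<close>, which is at least \<open>bd a\<close>; the exponent is nonnegative
          because \<open>M\<close> \<ge> 3 and \<eta> \<le> 1/4.\<close>
        also have "\<dots> * x powr (- real M) \<le> (bd a)\<^sup>2 * x powr (real M - 2 - \<eta>) * x powr (- real M)"
          using a1[OF a] z M \<eta> one_minus_cnj_ge(1)[of a z]
          by (intro mult_right_mono mult_left_mono powr_mono2) (auto simp: x_def)
        also have "\<dots> = (bd a)\<^sup>2 * x powr (- (2 + \<eta>))" by (simp add: powr_add[symmetric])
        finally show ?thesis by (simp add: x_def one_minus_cnj_swap[of a z])
      qed
      have "cmod (\<Sum>a\<in>J. c a * kern M p a z) powr p \<le> (\<Sum>a\<in>J. u a * v a) powr p"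
        using p norm_sum[of "\<lambda>a. c a * kern M p a z" J] by (intro powr_mono2) (auto simp: uv)
      also have "\<dots> \<le> (\<Sum>a\<in>J. u a powr p) * (\<Sum>a\<in>J. v a powr p') powr (p - 1)"
        unfolding p'_def using p J by (intro holder_sum) (auto simp: u_def v_def)
      also have "(\<Sum>a\<in>J. v a powr p') powr (p - 1) \<le> (C1 * bd z powr (- \<eta>)) powr (p - 1)"
        using p by (intro powr_mono2 sum_nonneg order.trans[OF sum_mono[OF vp] sep] J z) auto
      also have "(C1 * bd z powr (- \<eta>)) powr (p - 1) = C1 powr (p - 1) * bd z powr (- (\<epsilon> * p))"
        using C1 \<eta>p by (simp add: powr_mult powr_powr)
      also have "(\<Sum>a\<in>J. u a powr p) * (C1 powr (p - 1) * bd z powr (- (\<epsilon> * p))) = (\<Sum>a\<in>J. T a * \<kappa> a z)"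
        unfolding sum_distrib_right by (intro sum.cong refl) (simp add: up T_def \<kappa>_def W(1))
      finally show ?thesis by (simp add: mult_left_mono sum_nonneg)
    qed
    have "dint (\<lambda>z. cmod (\<Sum>a\<in>J. c a * kern M p a z) powr p)
      \<le> dint (\<lambda>z. \<Sum>a\<in>J. T a * \<kappa> a z)"
      using pt by (intro nn_integral_mono) (auto split: split_indicator intro!: ennreal_leI)
    also have "\<dots> \<le> ennreal (\<Sum>a\<in>J. T a * (C2 * bd a powr (2 - \<epsilon> * p - real M)))"
    proof (rule nn_integral_weighted_sum_le)
      show "continuous_on unit_disc (\<kappa> a)" if "a \<in> J" for a
      proof -
        have "1 - cnj a * z \<noteq> 0" if "z \<in> unit_disc" for z
          using one_minus_cnj_pos[of a z] that J \<open>a \<in> J\<close> by auto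
        then show ?thesis unfolding \<kappa>_def by (intro continuous_intros) auto
      qed
      show "dint (\<lambda>z. \<kappa> a z) \<le> ennreal (C2 * bd a powr (2 - \<epsilon> * p - real M))"
        if "a \<in> J" for a
        unfolding \<kappa>_def using that J by (intro fr) auto
    qed (use J C2 in \<open>auto simp: T_def \<kappa>_def\<close>)
    also have "(\<Sum>a\<in>J. T a * (C2 * bd a powr (2 - \<epsilon> * p - real M))) = (\<Sum>a\<in>J. C * cmod (c a) powr p)"
    proof (intro sum.cong refl)
      fix a assume "a \<in> J"
      then have "bd a \<noteq> 0" using J by auto
      then have "bd a powr (real M - 2 + \<epsilon> * p) * bd a powr (2 - \<epsilon> * p - real M) = 1"
        by (simp add: powr_add[symmetric])
      then show "T a * (C2 * bd a powr (2 - \<epsilon> * p - real M)) = C * cmod (c a) powr p"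
        by (simp add: T_def C_def)
    qed
    finally show ?thesis by (simp add: sum_distrib_left)
  qed
  then show ?thesis using C by blast
qed

lemma kern_sum_powr_integral:
  assumes "p > 0" "real M * p > 2" "M \<ge> 3"
  shows "\<exists>C>0. \<forall>J c. finite J \<longrightarrow> separated J \<longrightarrow> J \<subseteq> unit_disc \<longrightarrow>
    dint (\<lambda>z. cmod (\<Sum>a\<in>J. c a * kern M p a z) powr p)
      \<le> ennreal (C * (\<Sum>a\<in>J. cmod (c a) powr p))"
proof (cases "p \<le> 1")
  case True
  then show ?thesis using kern_sum_powr_integral_le_1[of p M] assms by blast
next
  case False
  then show ?thesis using kern_sum_powr_integral_gt_1[of p M] assms by auto
qed

section \<open>The operator and its action on test functions\<close>

lemma holomorphic_kern:
  assumes "cmod a < 1" shows "kern M p a holomorphic_on unit_disc"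
proof -
  have "1 - cnj a * z \<noteq> 0" if "z \<in> unit_disc" for z
    using one_minus_cnj_pos[OF assms, of z] that by auto
  then show ?thesis unfolding kern_def by (intro holomorphic_intros) auto
qed

lemma higher_deriv_kern:
  assumes a: "cmod a < 1" and z: "cmod z < 1"
  shows "(deriv ^^ k) (kern M p a) z
    = of_real (bd a powr (real M - 2 / p)) * pochhammer (of_nat M) k * cnj a ^ k / (1 - cnj a * z) ^ (M + k)"
  using z
proof (induction k arbitrary: z)
  case 0
  then show ?case by (simp add: kern_def)
next
  case (Suc k)
  define c :: complex where "c = of_real (bd a powr (real M - 2 / p)) * pochhammer (of_nat M) k * cnj a ^ k"
  have nz: "1 - cnj a * z \<noteq> 0" using one_minus_cnj_pos[OF a Suc.prems] by auto
  have "((\<lambda>z. c * (1 / (1 - cnj a * z) ^ (M + k))) has_field_derivative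
      c * (of_nat (M + k) * cnj a / (1 - cnj a * z) ^ Suc (M + k))) (at z)"
    by (intro DERIV_cmult DERIV_inverse_linear_power nz)
  then have "((deriv ^^ k) (kern M p a) has_field_derivative
      c * (of_nat (M + k) * cnj a / (1 - cnj a * z) ^ Suc (M + k))) (at z)"
    by (rule has_field_derivative_transform_within_open[where S=unit_disc])
       (use Suc in \<open>auto simp: c_def\<close>)
  then have "(deriv ^^ Suc k) (kern M p a) z = c * (of_nat (M + k) * cnj a / (1 - cnj a * z) ^ Suc (M + k))"
    by (simp add: DERIV_imp_deriv)
  then show ?case by (simp add: c_def pochhammer_Suc algebra_simps)
qed

section \<open>A linear system of rising factorials\<close>

lemma pochhammer_diff:
  fixes x :: complex
  shows "pochhammer (x + 1) (Suc j) - pochhammer x (Suc j) = of_nat (Suc j) * pochhammer (x + 1) j"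
  by (subst pochhammer_rec, subst pochhammer_Suc) (simp add: algebra_simps)

text \<open>Consecutive differences lower the size of the system with matrix \<open>pochhammer (M + i) j\<close> by one.\<close>

lemma pochhammer_system:
  "\<exists>C>0. \<forall>u. \<forall>k<n. cmod (u k)
    \<le> C * (\<Sum>i<n. cmod (\<Sum>j<n. pochhammer (of_nat (M + i)) j * u j))"
proof (induction n arbitrary: M)
  case 0
  then show ?case by (intro exI[of _ 1]) auto
next
  case (Suc n)
  obtain C where C: "C > 0" and IH: "\<And>u k. k < n \<Longrightarrow> cmod (u k)
    \<le> C * (\<Sum>i<n. cmod (\<Sum>j<n. pochhammer (of_nat (Suc M + i)) j * u j))"
    using Suc[of "Suc M"] by blast
  define P where "P = (\<Sum>j<n. cmod (pochhammer (of_nat M) (Suc j)))"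
  define C' where "C' = 1 + 2 * C + P * (2 * C)"
  have P: "P \<ge> 0" by (simp add: P_def sum_nonneg)
  have C': "C' > 0" using C P by (simp add: C'_def add_pos_nonneg)
  have "cmod (u k) \<le> C' * (\<Sum>i<Suc n. cmod (\<Sum>j<Suc n. pochhammer (of_nat (M + i)) j * u j))"
    if k: "k < Suc n" for u k
  proof -
    define v where "v = (\<lambda>i. \<Sum>j<Suc n. pochhammer (of_nat (M + i)) j * u j)"
    define S where "S = (\<Sum>i<Suc n. cmod (v i))"
    have S: "S \<ge> 0" by (simp add: S_def sum_nonneg)
    \<comment> \<open>By \<open>pochhammer_diff\<close>, consecutive rows differ by a row of the
      system with base M + 1 in the unknowns u'. The induction hypothesis thus bounds
      \<open>u 1\<close>, \<open>u 2\<close> and so on, and row 0 then yields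
      \<open>u 0\<close>.\<close>
    define u' where "u' = (\<lambda>j. of_nat (Suc j) * u (Suc j))"
    have diff: "(\<Sum>j<n. pochhammer (of_nat (Suc M + i)) j * u' j) = v (Suc i) - v i" for i
    proof -
      have "v (Suc i) - v i = (\<Sum>j<Suc n. (pochhammer (of_nat (M + Suc i)) j - pochhammer (of_nat (M + i)) j) * u j)"
        by (simp only: v_def left_diff_distrib sum_subtractf)
      also have "\<dots> = (\<Sum>j<n. (pochhammer (of_nat (M + i) + 1) (Suc j) - pochhammer (of_nat (M + i)) (Suc j)) * u (Suc j))"
        by (subst sum.lessThan_Suc_shift) (simp add: add_ac)
      also have "\<dots> = (\<Sum>j<n. pochhammer (of_nat (Suc M + i)) j * u' j)"
        unfolding pochhammer_diff by (intro sum.cong refl) (simp add: u'_def algebra_simps)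
      finally show ?thesis by simp
    qed
    have "(\<Sum>i<n. cmod (v (Suc i) - v i)) \<le> (\<Sum>i<n. cmod (v (Suc i)) + cmod (v i))"
      by (intro sum_mono norm_triangle_ineq4)
    also have "\<dots> = (\<Sum>i<n. cmod (v (Suc i))) + (\<Sum>i<n. cmod (v i))" by (rule sum.distrib)
    also have "\<dots> \<le> 2 * S"
    proof -
      have "(\<Sum>i<n. cmod (v (Suc i))) \<le> S" unfolding S_def by (subst sum.lessThan_Suc_shift) simp
      moreover have "(\<Sum>i<n. cmod (v i)) \<le> S" by (simp add: S_def)
      ultimately show ?thesis by simp
    qed
    finally have dS: "(\<Sum>i<n. cmod (v (Suc i) - v i)) \<le> 2 * S" .
    have usuc: "cmod (u (Suc j)) \<le> 2 * C * S" if "j < n" for j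
    proof -
      have "1 * cmod (u (Suc j)) \<le> real (Suc j) * cmod (u (Suc j))" by (intro mult_right_mono) auto
      also have "\<dots> = cmod (u' j)" by (simp only: u'_def norm_mult norm_of_nat)
      also have "\<dots> \<le> C * (\<Sum>i<n. cmod (v (Suc i) - v i))"
        using IH[OF that, of u'] by (simp only: diff)
      also have "\<dots> \<le> C * (2 * S)" using C dS by (intro mult_left_mono) auto
      finally show ?thesis by simp
    qed
    have u0: "cmod (u 0) \<le> (1 + P * (2 * C)) * S"
    proof -
      have "v 0 = u 0 + (\<Sum>j<n. pochhammer (of_nat M) (Suc j) * u (Suc j))"
        unfolding v_def by (subst sum.lessThan_Suc_shift) simp
      then have "cmod (u 0) = cmod (v 0 - (\<Sum>j<n. pochhammer (of_nat M) (Suc j) * u (Suc j)))" by simp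
      also have "\<dots> \<le> cmod (v 0) + (\<Sum>j<n. cmod (pochhammer (of_nat M) (Suc j) * u (Suc j)))"
        by (intro order.trans[OF norm_triangle_ineq4] add_left_mono norm_sum)
      also have "\<dots> \<le> S + (\<Sum>j<n. cmod (pochhammer (of_nat M) (Suc j)) * (2 * C * S))"
        unfolding norm_mult S_def
        by (intro add_mono sum_mono mult_left_mono usuc[unfolded S_def] member_le_sum) auto
      also have "\<dots> = (1 + P * (2 * C)) * S" by (simp add: P_def sum_distrib_right[symmetric] distrib_right)
      finally show ?thesis .
    qed
    have "cmod (u k) \<le> C' * S"
    proof (cases k)
      case 0
      have "(1 + P * (2 * C)) * S \<le> C' * S" using S C by (intro mult_right_mono) (auto simp: C'_def)
      then show ?thesis using u0 0 by simp
    next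
      case (Suc j)
      have "2 * C * S \<le> C' * S" using S C P by (intro mult_right_mono) (auto simp: C'_def)
      then show ?thesis using usuc[of j] k Suc by simp
    qed
    then show ?thesis by (simp add: S_def v_def)
  qed
  then show ?case using C' by blast
qed

text \<open>A choice of signs is encoded by the set of indices with sign +1, so an expectation over
  random signs becomes a finite sum over \<open>Pow J\<close>.\<close>

definition flip :: "'a set \<Rightarrow> 'a \<Rightarrow> complex" where
  "flip S b = (if b \<in> S then 1 else - 1)"

lemma cmod_flip [simp]: "cmod (flip S b) = 1"
  by (simp add: flip_def)

text \<open>Only the trivial part of Khinchine's inequality is needed: flipping a single sign.\<close>

lemma sum_flip_lower_bound:
  assumes "finite J" "a \<in> J" "q > 0"
  shows "2 ^ card J * cmod (c a) powr q \<le> 2 * (\<Sum>S\<in>Pow J. cmod (\<Sum>b\<in>J. flip S b * c b) powr q)"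
proof -
  define I where "I = J - {a}"
  have I: "finite I" "a \<notin> I" "J = insert a I" using assms by (auto simp: I_def)
  define h where "h = (\<lambda>S. cmod (\<Sum>b\<in>J. flip S b * c b) powr q)"
  define R where "R = (\<lambda>S. \<Sum>b\<in>I. flip S b * c b)"
  have h1: "h S = cmod (R S - c a) powr q" if "S \<in> Pow I" for S
  proof -
    have "a \<notin> S" using that I by auto
    then show ?thesis using I by (simp add: h_def R_def flip_def)
  qed
  have h2: "h (insert a S) = cmod (R S + c a) powr q" if "S \<in> Pow I" for S
  proof -
    have "(\<Sum>b\<in>I. flip (insert a S) b * c b) = R S"
      unfolding R_def using I(2) by (intro sum.cong refl) (auto simp: flip_def)
    then show ?thesis using I by (simp add: h_def flip_def add.commute)
  qed
  \<comment> \<open>The two choices differ only in the sign at \<open>a\<close>. Since 2 c a is the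
    difference of the two sums, one of them has modulus at least |c a|.\<close>
  have ge: "cmod (c a) powr q \<le> h S + h (insert a S)" if S: "S \<in> Pow I" for S
  proof -
    have "2 * cmod (c a) = cmod ((R S + c a) - (R S - c a))"
      by (simp add: norm_mult)
    also have "\<dots> \<le> cmod (R S + c a) + cmod (R S - c a)" by (rule norm_triangle_ineq4)
    finally have "cmod (c a) \<le> cmod (R S + c a) \<or> cmod (c a) \<le> cmod (R S - c a)" by linarith
    then have "cmod (c a) powr q \<le> cmod (R S + c a) powr q \<or> cmod (c a) powr q \<le> cmod (R S - c a) powr q"
      using assms(3) by (auto intro: powr_mono2)
    then show ?thesis unfolding h1[OF S] h2[OF S]
      by (auto intro: add_increasing add_increasing2)
  qed
  have "2 ^ card J * cmod (c a) powr q = 2 * (\<Sum>S\<in>Pow I. cmod (c a) powr q)"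
    using I by (simp add: card_Pow)
  also have "\<dots> \<le> 2 * (\<Sum>S\<in>Pow I. h S + h (insert a S))"
    using ge by (intro mult_left_mono sum_mono) auto
  also have "(\<Sum>S\<in>Pow I. h S + h (insert a S)) = (\<Sum>S\<in>Pow I. h S) + (\<Sum>S\<in>insert a ` Pow I. h S)"
  proof -
    have "inj_on (insert a) (Pow I)" using I(2) by (auto simp: inj_on_def)
    then show ?thesis by (simp add: sum.distrib sum.reindex)
  qed
  also have "\<dots> = (\<Sum>S\<in>Pow J. h S)"
    unfolding I(3) Pow_insert using I by (subst sum.union_disjoint) auto
  finally show ?thesis by (simp add: h_def)
qed

section \<open>Iterated integration and the operator \<open>Ig\<close>\<close>

lemma Iop_properties:
  assumes "h holomorphic_on unit_disc"
  shows "Iop h holomorphic_on unit_disc" "cmod z < 1 \<Longrightarrow> deriv (Iop h) z = h z" "Iop h 0 = 0"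
proof -
  have conv: "convex unit_disc" by (simp add: unit_disc_def)
  obtain G where G: "\<And>x. x \<in> unit_disc \<Longrightarrow> (G has_field_derivative h x) (at x)"
    using holomorphic_convex_primitive'[OF conv open_unit_disc assms]
    by (metis at_within_open open_unit_disc)
  have eq: "Iop h z = G z - G 0" if z: "z \<in> unit_disc" for z
  proof -
    have seg: "closed_segment 0 z \<subseteq> unit_disc"
      using z conv by (intro closed_segment_subset) auto
    have "(h has_contour_integral (G (pathfinish (linepath 0 z)) - G (pathstart (linepath 0 z)))) (linepath 0 z)"
    proof (rule contour_integral_primitive[where S=unit_disc])
      show "(G has_field_derivative h x) (at x within unit_disc)" if "x \<in> unit_disc" for x
        using G[OF that] by (rule has_field_derivative_at_within)
    qed (use seg in \<open>simp_all only: path_image_linepath valid_path_linepath\<close>)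
    then show ?thesis unfolding Iop_def by (simp add: contour_integral_unique)
  qed
  have der: "(Iop h has_field_derivative h z) (at z)" if z: "z \<in> unit_disc" for z
  proof (rule has_field_derivative_transform_within_open[where S=unit_disc])
    show "((\<lambda>z. G z - G 0) has_field_derivative h z) (at z)"
      using G[OF z] by (auto intro!: derivative_eq_intros)
  qed (use z eq in auto)
  then show "Iop h holomorphic_on unit_disc"
    by (meson holomorphic_onI field_differentiable_def field_differentiable_at_within)
  show "deriv (Iop h) z = h z" if "cmod z < 1" using der[of z] that by (simp add: DERIV_imp_deriv)
  show "Iop h 0 = 0" using eq[of 0] by simp
qed

lemma funpow_Iop:
  assumes "h holomorphic_on unit_disc"
  shows "(Iop ^^ n) h holomorphic_on unit_disc"
    and "cmod z < 1 \<Longrightarrow> (deriv ^^ n) ((Iop ^^ n) h) z = h z"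
proof -
  show hol: "(Iop ^^ n) h holomorphic_on unit_disc" for n
    using assms by (induction n) (auto intro: Iop_properties)
  show "(deriv ^^ n) ((Iop ^^ n) h) z = h z" if "cmod z < 1"
    using that
  proof (induction n arbitrary: z)
    case (Suc n)
    have "(deriv ^^ Suc n) ((Iop ^^ Suc n) h) z = (deriv ^^ n) (deriv (Iop ((Iop ^^ n) h))) z"
      by (simp add: funpow_Suc_right del: funpow.simps) (simp add: funpow_swap1)
    also have "\<dots> = (deriv ^^ n) ((Iop ^^ n) h) z"
      using Suc.prems Iop_properties[OF hol]
      by (intro higher_deriv_transform_within_open[where S=unit_disc] holomorphic_deriv hol) auto
    finally show ?case using Suc by simp
  qed simp
qed

lemma holomorphic_Ig_integrand:
  assumes "f holomorphic_on unit_disc" "\<forall>k<n. g k holomorphic_on unit_disc"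
  shows "(\<lambda>z. \<Sum>k<n. (deriv ^^ k) f z * g k z) holomorphic_on unit_disc"
  using assms by (intro holomorphic_intros holomorphic_higher_deriv) auto

lemma Ig_properties:
  assumes "f holomorphic_on unit_disc" "\<forall>k<n. g k holomorphic_on unit_disc"
  shows "Ig n g f holomorphic_on unit_disc"
    and "cmod z < 1 \<Longrightarrow> (deriv ^^ n) (Ig n g f) z = (\<Sum>k<n. (deriv ^^ k) f z * g k z)"
  unfolding Ig_def using funpow_Iop[OF holomorphic_Ig_integrand[OF assms]] by auto

lemma higher_deriv_weighted_sum:
  assumes "finite J" "\<And>a. a \<in> J \<Longrightarrow> f a holomorphic_on unit_disc" "cmod z < 1"
  shows "(deriv ^^ k) (\<lambda>z. \<Sum>a\<in>J. c a * f a z) z = (\<Sum>a\<in>J. c a * (deriv ^^ k) (f a) z)"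
  using assms
proof (induction J)
  case empty
  then show ?case by (simp add: higher_deriv_const)
next
  case (insert b J)
  have "(deriv ^^ k) (\<lambda>z. c b * f b z + (\<Sum>a\<in>J. c a * f a z)) z
      = (deriv ^^ k) (\<lambda>z. c b * f b z) z + (deriv ^^ k) (\<lambda>z. \<Sum>a\<in>J. c a * f a z) z"
    using insert by (intro higher_deriv_add[where S=unit_disc] holomorphic_intros) auto
  also have "(deriv ^^ k) (\<lambda>z. c b * f b z) z = c b * (deriv ^^ k) (f b) z"
    using insert by (intro higher_deriv_cmult[where A=unit_disc]) auto
  finally show ?case using insert by simp
qed

section \<open>From norms to unnormalised integrals\<close>

lemma nn_integral_disc_int:
  "dint (\<lambda>z. u z) = ennreal pi * disc_int u"
proof -
  define N where "N = dint (\<lambda>z. u z)"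
  have "ennreal pi * (N / ennreal pi) = N * ennreal pi / ennreal pi"
    by (simp add: ennreal_times_divide mult.commute)
  also have "\<dots> = N" by (rule ennreal_mult_divide_eq) auto
  finally show ?thesis by (simp add: N_def disc_int_def)
qed

lemma disc_int_finite_iff:
  "disc_int u < \<infinity> \<longleftrightarrow> dint (\<lambda>z. u z) < \<infinity>"
  unfolding nn_integral_disc_int by (auto simp: ennreal_mult_less_top)

lemma Bergman_iff:
  "f \<in> Bergman p \<longleftrightarrow> f holomorphic_on unit_disc \<and>
     dint (\<lambda>z. cmod (f z) powr p) < \<infinity>"
  unfolding Bergman_def disc_int_finite_iff by simp

lemma Bergman_norm_nonneg: "Bergman_norm p f \<ge> 0"
  by (simp add: Bergman_norm_def)

lemma nn_integral_Bergman_norm: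
  assumes "f \<in> Bergman p" "p > 0"
  shows "dint (\<lambda>z. cmod (f z) powr p) = ennreal (pi * Bergman_norm p f powr p)"
proof -
  define D where "D = disc_int (\<lambda>z. cmod (f z) powr p)"
  have "D < \<infinity>" using assms by (simp add: Bergman_def D_def)
  then have "D = ennreal (enn2real D)" by simp
  also have "enn2real D = Bergman_norm p f powr p"
    using assms by (simp add: Bergman_norm_def D_def powr_powr)
  finally show ?thesis unfolding nn_integral_disc_int D_def by (simp add: ennreal_mult)
qed

text \<open>Boundedness in the form applied to test functions, where a bound \<open>B\<close> for
  the integral is known but not its value; homogeneity produces the exponent q / p.\<close>

lemma bounded_op_integral:
  assumes bdd: "bounded_op p q T" and p: "p > 0" and q: "q > 0"
  shows "\<exists>C>0. \<forall>f B. f holomorphic_on unit_disc \<longrightarrow> B \<ge> 0 \<longrightarrow>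
    dint (\<lambda>z. cmod (f z) powr p) \<le> ennreal B \<longrightarrow>
    dint (\<lambda>z. cmod (T f z) powr q) \<le> ennreal (C * B powr (q / p))"
proof -
  obtain C0 where C0: "\<And>f. f \<in> Bergman p \<Longrightarrow> Bergman_norm q (T f) \<le> C0 * Bergman_norm p f"
    and T: "\<And>f. f \<in> Bergman p \<Longrightarrow> T f \<in> Bergman q"
    using bdd by (auto simp: bounded_op_def)
  \<comment> \<open>The constant in \<open>bounded_op\<close> may be zero or negative.\<close>
  define C1 where "C1 = max C0 1"
  define C where "C = pi * C1 powr q * (1 / pi) powr (q / p)"
  have C: "C > 0" by (simp add: C_def C1_def)
  have "dint (\<lambda>z. cmod (T f z) powr q) \<le> ennreal (C * B powr (q / p))"
    if f: "f holomorphic_on unit_disc" "B \<ge> 0"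
      "dint (\<lambda>z. cmod (f z) powr p) \<le> ennreal B" for f B
  proof -
    have fB: "f \<in> Bergman p"
      using f by (auto simp: Bergman_iff intro: le_less_trans)
    have "ennreal (pi * Bergman_norm p f powr p) \<le> ennreal B"
      using f(3) unfolding nn_integral_Bergman_norm[OF fB p] .
    then have "pi * Bergman_norm p f powr p \<le> B" using f by (simp add: ennreal_le_iff)
    then have "Bergman_norm p f powr p \<le> B / pi" by (simp add: field_simps)
    then have "(Bergman_norm p f powr p) powr (q / p) \<le> (B / pi) powr (q / p)"
      using p q by (intro powr_mono2) auto
    then have le: "Bergman_norm p f powr q \<le> B powr (q / p) * (1 / pi) powr (q / p)"
      using p f by (simp add: powr_powr powr_divide)
    have "Bergman_norm q (T f) \<le> C1 * Bergman_norm p f"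
      using C0[OF fB] mult_right_mono[of C0 C1 "Bergman_norm p f"] Bergman_norm_nonneg[of p f]
      by (simp add: C1_def)
    then have "Bergman_norm q (T f) powr q \<le> (C1 * Bergman_norm p f) powr q"
      using q Bergman_norm_nonneg by (intro powr_mono2) auto
    also have "\<dots> = C1 powr q * Bergman_norm p f powr q"
      by (simp add: powr_mult C1_def Bergman_norm_nonneg)
    also have "\<dots> \<le> C1 powr q * (B powr (q / p) * (1 / pi) powr (q / p))"
      using le by (intro mult_left_mono) auto
    finally have "pi * Bergman_norm q (T f) powr q \<le> C * B powr (q / p)"
      by (simp add: C_def mult_ac)
    then show ?thesis unfolding nn_integral_Bergman_norm[OF T[OF fB] q] by (rule ennreal_leI)
  qed
  then show ?thesis using C by blast
qed

section \<open>Testing a bounded operator on sums of kernels\<close>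

lemma ball_half_subset:
  assumes "cmod a < 1" "z \<in> ball a (bd a / 2)"
  shows "cmod z < 1" "bd a \<le> 2 * bd z" "bd z \<le> 2 * bd a"
proof -
  have d: "cmod (a - z) < bd a / 2" using assms by (simp add: dist_norm)
  have e: "\<bar>cmod a - cmod z\<bar> \<le> cmod (a - z)" by (rule norm_triangle_ineq3)
  show "cmod z < 1" "bd a \<le> 2 * bd z" "bd z \<le> 2 * bd a"
    using d e assms(1) by (auto simp: field_simps)
qed

lemma continuous_on_weighted_powr:
  assumes "f holomorphic_on unit_disc" "q > 0"
  shows "continuous_on unit_disc (\<lambda>z. (cmod (f z) * bd z ^ n) powr q)"
  using assms
  by (intro continuous_on_powr' continuous_intros holomorphic_on_imp_continuous_on) auto

lemma measurable_ball_weighted_powr: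
  assumes "f holomorphic_on unit_disc" "q > 0" "cmod a < 1"
  shows "(\<lambda>z. ennreal ((cmod (f z) * bd z ^ n) powr q) * indicator (ball a (bd a / 2)) z) \<in> borel_measurable lborel"
proof -
  have "ball a (bd a / 2) \<subseteq> unit_disc" using ball_half_subset(1)[OF assms(3)] by auto
  then have "continuous_on (ball a (bd a / 2)) (\<lambda>z. (cmod (f z) * bd z ^ n) powr q)"
    using continuous_on_weighted_powr[OF assms(1,2)] by (rule continuous_on_subset[rotated])
  from measurable_ennreal_indicator_continuous[OF this] show ?thesis by simp
qed

text \<open>On the disc this is the n-th derivative of \<open>Ig n g (kern M p a)\<close>, by
  \<open>Ig_properties\<close>.\<close>

definition test_image :: "nat \<Rightarrow> (nat \<Rightarrow> complex \<Rightarrow> complex) \<Rightarrow> real \<Rightarrow> nat \<Rightarrow> complex \<Rightarrow> complex \<Rightarrow> complex" where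
  "test_image n g p M a z = (\<Sum>k<n. (deriv ^^ k) (kern M p a) z * g k z)"

lemma holomorphic_test_image:
  assumes "\<forall>k<n. g k holomorphic_on unit_disc" "cmod a < 1"
  shows "test_image n g p M a holomorphic_on unit_disc"
  unfolding test_image_def by (rule holomorphic_Ig_integrand[OF holomorphic_kern[OF assms(2)] assms(1)])

text \<open>The operator is applied to every signed sum of the kernels, and all bounds are
  independent of the signs. Summing over the 2^|J| sign choices and cancelling this number leaves
  the local contributions without interference between different \<open>a\<close>. The coefficients
  \<open>l\<close> stay free for the duality argument.\<close>

lemma bounded_test_inequality:
  assumes bdd: "bounded_op p q (Ig n g)" and g: "\<forall>k<n. g k holomorphic_on unit_disc"
    and p: "p > 0" and q: "q > 0" and M: "real M * p > 2" "M \<ge> 3"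
  shows "\<exists>C>0. \<forall>J l. finite J \<longrightarrow> separated J \<longrightarrow> J \<subseteq> unit_disc \<longrightarrow> (\<forall>a\<in>J. l a \<ge> 0) \<longrightarrow>
    (\<Sum>a\<in>J. ennreal (l a powr q)
       * (\<integral>\<^sup>+z\<in>ball a (bd a / 2). ennreal ((cmod (test_image n g p M a z) * bd z ^ n) powr q) \<partial>lborel))
    \<le> ennreal (C * (\<Sum>a\<in>J. l a powr p) powr (q / p))"
proof -
  obtain C1 where C1: "C1 > 0" and kern: "\<And>J c. finite J \<Longrightarrow> separated J \<Longrightarrow> J \<subseteq> unit_disc \<Longrightarrow>
    dint (\<lambda>z. cmod (\<Sum>a\<in>J. c a * kern M p a z) powr p)
      \<le> ennreal (C1 * (\<Sum>a\<in>J. cmod (c a) powr p))"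
    using kern_sum_powr_integral[OF p M] by blast
  obtain C2 where C2: "C2 > 0" and T: "\<And>f B. f holomorphic_on unit_disc \<Longrightarrow> B \<ge> 0 \<Longrightarrow>
    dint (\<lambda>z. cmod (f z) powr p) \<le> ennreal B \<Longrightarrow>
    dint (\<lambda>z. cmod (Ig n g f z) powr q) \<le> ennreal (C2 * B powr (q / p))"
    using bounded_op_integral[OF bdd p q] by blast
  obtain C3 where C3: "C3 > 0" and wd: "\<And>f. f holomorphic_on unit_disc \<Longrightarrow>
    dint (\<lambda>z. (cmod ((deriv ^^ n) f z) * bd z ^ n) powr q)
      \<le> ennreal C3 * dint (\<lambda>z. cmod (f z) powr q)"
    using weighted_deriv_le[OF q] by blast
  define E where "E = C3 * (C2 * C1 powr (q / p))"
  have E: "E > 0" using C1 C2 C3 by (simp add: E_def)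
  have "(\<Sum>a\<in>J. ennreal (l a powr q)
       * (\<integral>\<^sup>+z\<in>ball a (bd a / 2). ennreal ((cmod (test_image n g p M a z) * bd z ^ n) powr q) \<partial>lborel))
    \<le> ennreal (1152 * E * (\<Sum>a\<in>J. l a powr p) powr (q / p))"
    if J: "finite J" "separated J" "J \<subseteq> unit_disc" and l: "\<forall>a\<in>J. l a \<ge> 0" for J l
  proof -
    define Q where "Q = test_image n g p M"
    define L where "L = (\<Sum>a\<in>J. l a powr p)"
    have L: "L \<ge> 0" by (simp add: L_def sum_nonneg)
    define F where "F = (\<lambda>S z. \<Sum>a\<in>J. (flip S a * of_real (l a)) * kern M p a z)"
    define c where "c = (\<lambda>z a. of_real (l a) * Q a z * of_real (bd z ^ n))"
    define X where "X = (\<lambda>S z. cmod (\<Sum>a\<in>J. flip S a * c z a) powr q)"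
    have a1: "cmod a < 1" if "a \<in> J" for a using that J by auto
    have holQ: "Q a holomorphic_on unit_disc" if "a \<in> J" for a
      unfolding Q_def using g a1[OF that] by (rule holomorphic_test_image)
    have holF: "F S holomorphic_on unit_disc" for S
      unfolding F_def using a1 by (intro holomorphic_intros holomorphic_kern) auto
    have intX: "dint (\<lambda>z. X S z) \<le> ennreal (E * L powr (q / p))" for S
    proof -
      have "dint (\<lambda>z. cmod (F S z) powr p)
          \<le> ennreal (C1 * (\<Sum>a\<in>J. cmod (flip S a * of_real (l a)) powr p))"
        unfolding F_def by (rule kern[OF J])
      also have "(\<Sum>a\<in>J. cmod (flip S a * of_real (l a)) powr p) = L"
        unfolding L_def using l by (intro sum.cong) (auto simp: norm_mult)
      finally have "dint (\<lambda>z. cmod (Ig n g (F S) z) powr q)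
          \<le> ennreal (C2 * (C1 * L) powr (q / p))"
        using C1 L by (intro T holF) auto
      then have "ennreal C3 * dint (\<lambda>z. cmod (Ig n g (F S) z) powr q)
          \<le> ennreal C3 * ennreal (C2 * (C1 * L) powr (q / p))" by (intro mult_left_mono) auto
      also have "\<dots> = ennreal (E * L powr (q / p))"
        using C1 C2 C3 L by (simp add: ennreal_mult[symmetric] powr_mult E_def mult_ac)
      finally have 1: "dint (\<lambda>z. (cmod ((deriv ^^ n) (Ig n g (F S)) z) * bd z ^ n) powr q)
          \<le> ennreal (E * L powr (q / p))"
        using wd[OF Ig_properties(1)[OF holF g, of S]] by (rule order.trans[rotated])
      have "cmod ((deriv ^^ n) (Ig n g (F S)) z) * bd z ^ n = cmod (\<Sum>a\<in>J. flip S a * c z a)"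
        if z: "cmod z < 1" for z
      proof -
        have "(deriv ^^ n) (Ig n g (F S)) z = (\<Sum>k<n. (deriv ^^ k) (F S) z * g k z)"
          by (rule Ig_properties(2)[OF holF g z])
        also have "\<dots> = (\<Sum>k<n. \<Sum>a\<in>J. (flip S a * of_real (l a)) * ((deriv ^^ k) (kern M p a) z * g k z))"
        proof (intro sum.cong refl)
          fix k
          have "(deriv ^^ k) (F S) z = (\<Sum>a\<in>J. (flip S a * of_real (l a)) * (deriv ^^ k) (kern M p a) z)"
            unfolding F_def using J a1 z by (intro higher_deriv_weighted_sum holomorphic_kern) auto
          then show "(deriv ^^ k) (F S) z * g k z
              = (\<Sum>a\<in>J. (flip S a * of_real (l a)) * ((deriv ^^ k) (kern M p a) z * g k z))"
            by (simp add: sum_distrib_right mult.assoc)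
        qed
        also have "\<dots> = (\<Sum>a\<in>J. flip S a * (of_real (l a) * Q a z))"
          by (subst sum.swap) (simp add: Q_def test_image_def sum_distrib_left mult.assoc)
        finally have "(deriv ^^ n) (Ig n g (F S)) z * of_real (bd z ^ n) = (\<Sum>a\<in>J. flip S a * c z a)"
          by (simp add: c_def sum_distrib_right mult.assoc)
        then have "cmod ((deriv ^^ n) (Ig n g (F S)) z * of_real (bd z ^ n)) = cmod (\<Sum>a\<in>J. flip S a * c z a)"
          by simp
        then show ?thesis using z by (simp add: norm_mult norm_power del: of_real_power of_real_diff)
      qed
      then have "dint (\<lambda>z. X S z)
          = dint (\<lambda>z. (cmod ((deriv ^^ n) (Ig n g (F S)) z) * bd z ^ n) powr q)"
        by (intro nn_integral_cong) (auto simp: X_def split: split_indicator)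
      then show ?thesis using 1 by simp
    qed
    define Y where "Y = (\<lambda>a z. ennreal ((cmod (Q a z) * bd z ^ n) powr q) * indicator (ball a (bd a / 2)) z)"
    have measY: "Y a \<in> borel_measurable lborel" if "a \<in> J" for a
      unfolding Y_def using that holQ q a1 by (intro measurable_ball_weighted_powr)
    have measX: "(\<lambda>z. ennreal (X S z) * indicator unit_disc z) \<in> borel_measurable lborel" for S
    proof -
      have "continuous_on unit_disc (X S)"
        unfolding X_def c_def using q holQ
        by (intro continuous_on_powr' continuous_intros holomorphic_on_imp_continuous_on) auto
      from measurable_ennreal_indicator_continuous[OF this borel_unit_disc] show ?thesis by simp
    qed
    \<comment> \<open>Each \<open>a\<close> whose disc contains \<open>z\<close> is isolated by
      \<open>sum_flip_lower_bound\<close> at the cost of 2. At most 576 discs overlap at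
      \<open>z\<close>, whence 1152.\<close>
    have pt: "(\<Sum>a\<in>J. ennreal (2 ^ card J * l a powr q) * Y a z)
        \<le> (\<Sum>S\<in>Pow J. 1152 * (ennreal (X S z) * indicator unit_disc z))" for z
    proof (cases "cmod z < 1")
      case False
      have "Y a z = 0" if "a \<in> J" for a
      proof -
        have "z \<notin> ball a (bd a / 2)" using ball_half_subset(1)[OF a1[OF that], of z] False by blast
        then show ?thesis unfolding Y_def by (simp del: mem_ball)
      qed
      then show ?thesis by simp
    next
      case True
      define I where "I = {a \<in> J. z \<in> ball a (bd a / 2)}"
      have I: "finite I" "I \<subseteq> J" using J by (auto simp: I_def)
      have "(\<Sum>a\<in>J. ennreal (2 ^ card J * l a powr q) * Y a z) = (\<Sum>a\<in>I. ennreal (2 ^ card J * l a powr q) * Y a z)"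
        using J(1) by (intro sum.mono_neutral_right) (auto simp: I_def Y_def)
      also have "\<dots> = (\<Sum>a\<in>I. ennreal (2 ^ card J * cmod (c z a) powr q))"
      proof (intro sum.cong refl)
        fix a assume a: "a \<in> I"
        have "cmod (c z a) = l a * (cmod (Q a z) * bd z ^ n)"
          using True l a I by (auto simp: c_def norm_mult norm_power simp del: of_real_power of_real_diff)
        then have "cmod (c z a) powr q = l a powr q * (cmod (Q a z) * bd z ^ n) powr q"
          using True l a I by (simp add: powr_mult subset_iff)
        then show "ennreal (2 ^ card J * l a powr q) * Y a z = ennreal (2 ^ card J * cmod (c z a) powr q)"
          using a by (simp add: Y_def I_def ennreal_mult[symmetric] mult.assoc)
      qed
      also have "\<dots> \<le> (\<Sum>a\<in>I. ennreal (2 * (\<Sum>S\<in>Pow J. X S z)))"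
        unfolding X_def using I q J
        by (intro sum_mono ennreal_leI sum_flip_lower_bound) auto
      also have "\<dots> = of_nat (card I) * ennreal (2 * (\<Sum>S\<in>Pow J. X S z))" by simp
      also have "\<dots> \<le> of_nat 576 * ennreal (2 * (\<Sum>S\<in>Pow J. X S z))"
        unfolding I_def using separated_overlap[OF J True] by (intro mult_right_mono) (simp_all only: of_nat_mono zero_le)
      also have "\<dots> = 1152 * ennreal (\<Sum>S\<in>Pow J. X S z)"
      proof -
        have "ennreal (2 * x) = 2 * ennreal x" if "x \<ge> 0" for x
          using that by (simp add: ennreal_mult)
        moreover have "(\<Sum>S\<in>Pow J. X S z) \<ge> 0" by (simp add: X_def sum_nonneg)
        ultimately show ?thesis by (simp add: mult.assoc[symmetric])
      qed
      also have "\<dots> = (\<Sum>S\<in>Pow J. 1152 * (ennreal (X S z) * indicator unit_disc z))"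
      proof -
        have "ennreal (\<Sum>S\<in>Pow J. X S z) = (\<Sum>S\<in>Pow J. ennreal (X S z))"
          by (rule sum_ennreal[symmetric]) (simp add: X_def)
        then show ?thesis using True by (simp only: sum_distrib_left unit_disc_iff indicator_simps mult_1_right)
      qed
      finally show ?thesis .
    qed
    have "ennreal (2 ^ card J) * (\<Sum>a\<in>J. ennreal (l a powr q) * (\<integral>\<^sup>+z. Y a z \<partial>lborel))
        = (\<Sum>a\<in>J. \<integral>\<^sup>+z. ennreal (2 ^ card J * l a powr q) * Y a z \<partial>lborel)"
      unfolding sum_distrib_left
    proof (intro sum.cong refl)
      fix a assume a: "a \<in> J"
      show "ennreal (2 ^ card J) * (ennreal (l a powr q) * (\<integral>\<^sup>+z. Y a z \<partial>lborel))
          = (\<integral>\<^sup>+z. ennreal (2 ^ card J * l a powr q) * Y a z \<partial>lborel)"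
        by (subst nn_integral_cmult[OF measY[OF a]]) (simp add: ennreal_mult mult.assoc)
    qed
    also have "\<dots> = (\<integral>\<^sup>+z. (\<Sum>a\<in>J. ennreal (2 ^ card J * l a powr q) * Y a z) \<partial>lborel)"
      by (intro nn_integral_sum[symmetric] borel_measurable_times_ennreal borel_measurable_const measY)
    also have "\<dots> \<le> (\<integral>\<^sup>+z. (\<Sum>S\<in>Pow J. 1152 * (ennreal (X S z) * indicator unit_disc z)) \<partial>lborel)"
      by (intro nn_integral_mono pt)
    also have "\<dots> = (\<Sum>S\<in>Pow J. \<integral>\<^sup>+z. 1152 * (ennreal (X S z) * indicator unit_disc z) \<partial>lborel)"
      by (intro nn_integral_sum borel_measurable_times_ennreal borel_measurable_const measX)
    also have "\<dots> = (\<Sum>S\<in>Pow J. 1152 * dint (\<lambda>z. X S z))"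
      by (intro sum.cong refl nn_integral_cmult measX)
    also have "\<dots> \<le> (\<Sum>S\<in>Pow J. 1152 * ennreal (E * L powr (q / p)))"
      by (intro sum_mono mult_left_mono intX) auto
    also have "\<dots> = ennreal (2 ^ card J) * ennreal (1152 * E * L powr (q / p))"
    proof -
      have "(\<Sum>S\<in>Pow J. 1152 * ennreal (E * L powr (q / p))) = (\<Sum>S\<in>Pow J. ennreal (1152 * E * L powr (q / p)))"
        using E by (simp add: ennreal_mult mult.assoc)
      also have "\<dots> = ennreal (\<Sum>S\<in>Pow J. 1152 * E * L powr (q / p))"
        using E by (subst sum_ennreal) auto
      also have "\<dots> = ennreal (2 ^ card J * (1152 * E * L powr (q / p)))"
        using J by (simp add: card_Pow)
      also have "\<dots> = ennreal (2 ^ card J) * ennreal (1152 * E * L powr (q / p))"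
        using E by (intro ennreal_mult) auto
      finally show ?thesis .
    qed
    finally have "(\<Sum>a\<in>J. ennreal (l a powr q) * (\<integral>\<^sup>+z. Y a z \<partial>lborel)) \<le> ennreal (1152 * E * L powr (q / p))"
      by (subst (asm) ennreal_mult_le_mult_iff) auto
    then show ?thesis by (simp add: Y_def Q_def L_def)
  qed
  then show ?thesis using E by (intro exI[of _ "1152 * E"]) auto
qed

text \<open>For \<open>n\<close> consecutive exponents \<open>M\<close> the values \<open>test_image n g p M a z\<close> determine all \<open>g k z\<close>.
  The factor \<open>cnj a ^ k\<close> forces \<open>a\<close> to stay away from \<open>0\<close>.\<close>

lemma test_image_lower_bound:
  assumes p: "p > 0" and q: "q > 0" and k: "k < n"
  shows "\<exists>C>0. \<forall>g a z. 1 / 2 \<le> cmod a \<longrightarrow> cmod a < 1 \<longrightarrow> z \<in> ball a (bd a / 2) \<longrightarrow>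
    (cmod (g k z) * bd z ^ (n - k)) powr q
      \<le> C * bd a powr (2 * q / p) * (\<Sum>i<n. (cmod (test_image n g p (M + i) a z) * bd z ^ n) powr q)"
proof -
  obtain C0 where C0: "C0 > 0" and sys: "\<And>u k. k < n \<Longrightarrow> cmod (u k)
    \<le> C0 * (\<Sum>i<n. cmod (\<Sum>j<n. pochhammer (of_nat (M + i)) j * u j))"
    using pochhammer_system[of n M] by blast
  define L where "L = (12::real) ^ k * C0 * 3 ^ (M + n)"
  define C where "C = L powr q * real n powr q"
  have C: "C > 0" using C0 k by (simp add: C_def L_def)
  have "(cmod (g k z) * bd z ^ (n - k)) powr q
      \<le> C * bd a powr (2 * q / p) * (\<Sum>i<n. (cmod (test_image n g p (M + i) a z) * bd z ^ n) powr q)"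
    if a: "1 / 2 \<le> cmod a" "cmod a < 1" and z: "z \<in> ball a (bd a / 2)" for g a z
  proof -
    note zb = ball_half_subset[OF a(2) z]
    define w where "w = 1 - cnj a * z"
    define Q where "Q = (\<lambda>i. test_image n g p (M + i) a z)"
    have w1: "bd a \<le> cmod w" unfolding w_def using one_minus_cnj_ge(1)[of a z] a zb by simp
    have w0: "cmod w > 0" "w \<noteq> 0" using w1 a by auto
    \<comment> \<open>Replacing \<open>z\<close> by \<open>a\<close> gives 1 - |a|^2, which is at
      most \<open>2 * bd a\<close>; moving back to \<open>z\<close> adds at most
      \<open>bd a / 2\<close>.\<close>
    have w3: "cmod w \<le> 3 * bd a"
    proof -
      have "w = of_real (1 - (cmod a)\<^sup>2) + cnj a * (a - z)"
        by (simp add: w_def algebra_simps complex_norm_square[symmetric])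
      then have "cmod w \<le> cmod (of_real (1 - (cmod a)\<^sup>2)) + cmod a * cmod (a - z)"
        by (metis norm_triangle_ineq norm_mult complex_mod_cnj)
      also have "cmod (of_real (1 - (cmod a)\<^sup>2)) = 1 - (cmod a)\<^sup>2"
        using a by (simp add: abs_square_le_1 power_le_one del: of_real_diff)
      also have "\<dots> = bd a * (1 + cmod a)" by (simp add: algebra_simps power2_eq_square)
      also have "\<dots> \<le> bd a * 2" using a by (intro mult_left_mono) auto
      also have "cmod a * cmod (a - z) \<le> 1 * (bd a / 2)" using a z by (intro mult_mono) (auto simp: dist_norm)
      finally show ?thesis using a by (simp add: field_simps)
    qed
    \<comment> \<open>With these unknowns \<open>Q i\<close> is a scalar of modulus comparable to
      \<open>bd a powr (- (2 / p))\<close> times row \<open>i\<close> of the system in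
      \<open>pochhammer_system\<close>.\<close>
    define u where "u = (\<lambda>j. cnj a ^ j * g j z / w ^ j)"
    have Qu: "cmod (\<Sum>j<n. pochhammer (of_nat (M + i)) j * u j) \<le> 3 ^ (M + n) * bd a powr (2 / p) * cmod (Q i)"
      if i: "i < n" for i
    proof -
      let ?V = "\<Sum>j<n. pochhammer (of_nat (M + i)) j * u j"
      have "Q i = (\<Sum>j<n. (of_real (bd a powr (real (M + i) - 2 / p)) / w ^ (M + i)) * (pochhammer (of_nat (M + i)) j * u j))"
        unfolding Q_def test_image_def using a zb w0
        by (intro sum.cong refl) (simp add: higher_deriv_kern w_def[symmetric] u_def power_add)
      also have "\<dots> = (of_real (bd a powr (real (M + i) - 2 / p)) / w ^ (M + i)) * ?V"
        by (simp only: sum_distrib_left)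
      finally have "cmod (Q i) = bd a powr (real (M + i) - 2 / p) / cmod w ^ (M + i) * cmod ?V"
        by (simp add: norm_mult norm_divide norm_power)
      then have V: "cmod ?V = cmod w ^ (M + i) * bd a powr (2 / p - real (M + i)) * cmod (Q i)"
        using w0 a by (simp add: powr_diff field_simps)
      have "cmod w ^ (M + i) \<le> (3 * bd a) ^ (M + i)" using w3 by (intro power_mono) auto
      also have "\<dots> = 3 ^ (M + i) * bd a powr real (M + i)"
        unfolding power_mult_distrib using a by (subst powr_realpow) auto
      also have "\<dots> \<le> 3 ^ (M + n) * bd a powr real (M + i)"
        using i by (intro mult_right_mono power_increasing) auto
      finally have "cmod w ^ (M + i) * bd a powr (2 / p - real (M + i)) \<le> 3 ^ (M + n) * bd a powr real (M + i) * bd a powr (2 / p - real (M + i))"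
        by (intro mult_right_mono) auto
      also have "\<dots> = 3 ^ (M + n) * bd a powr (2 / p)"
        by (simp add: mult.assoc powr_add[symmetric])
      finally show ?thesis unfolding V by (intro mult_right_mono) auto
    qed
    \<comment> \<open>Solving for \<open>g k z\<close> costs 2^k because |a| \<ge> 1/2, and 6^k
      because |w| is at most \<open>3 * bd a\<close>, hence at most \<open>6 * bd z\<close>.\<close>
    have gu: "cmod (g k z) * bd z ^ (n - k) \<le> 12 ^ k * (cmod (u k) * bd z ^ n)"
    proof -
      have "cmod (g k z) * cmod a ^ k = cmod (u k) * cmod w ^ k"
        using w0 by (simp add: u_def norm_mult norm_divide norm_power)
      also have "\<dots> \<le> cmod (u k) * (6 * bd z) ^ k"
        using w3 zb by (intro mult_left_mono power_mono) auto
      finally have 1: "cmod (g k z) * cmod a ^ k \<le> cmod (u k) * (6 * bd z) ^ k" .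
      have "cmod (g k z) = cmod (g k z) * ((1 / 2) ^ k * 2 ^ k)" by (simp add: power_mult_distrib[symmetric])
      also have "\<dots> \<le> cmod (g k z) * (cmod a ^ k * 2 ^ k)"
        using a by (intro mult_left_mono mult_right_mono power_mono) auto
      also have "\<dots> \<le> cmod (u k) * (6 * bd z) ^ k * 2 ^ k"
        using mult_right_mono[OF 1, of "2 ^ k"] by (simp add: mult.assoc)
      also have "\<dots> = 12 ^ k * (cmod (u k) * bd z ^ k)"
        by (simp add: power_mult_distrib[symmetric] mult_ac)
      finally have "cmod (g k z) * bd z ^ (n - k) \<le> 12 ^ k * (cmod (u k) * bd z ^ k) * bd z ^ (n - k)"
        using zb by (intro mult_right_mono) auto
      also have "\<dots> = 12 ^ k * (cmod (u k) * (bd z ^ k * bd z ^ (n - k)))" by (simp add: mult.assoc)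
      also have "bd z ^ k * bd z ^ (n - k) = bd z ^ n" using k by (simp add: power_add[symmetric])
      finally show ?thesis .
    qed
    have "cmod (u k) \<le> C0 * (\<Sum>i<n. cmod (\<Sum>j<n. pochhammer (of_nat (M + i)) j * u j))"
      by (rule sys[OF k])
    also have "\<dots> \<le> C0 * (\<Sum>i<n. 3 ^ (M + n) * bd a powr (2 / p) * cmod (Q i))"
    proof (intro mult_left_mono sum_mono)
      fix i assume "i \<in> {..<n}"
      then show "cmod (\<Sum>j<n. pochhammer (of_nat (M + i)) j * u j) \<le> 3 ^ (M + n) * bd a powr (2 / p) * cmod (Q i)"
        by (intro Qu) simp
    qed (use C0 in simp)
    finally have "12 ^ k * (cmod (u k) * bd z ^ n)
        \<le> 12 ^ k * (C0 * (\<Sum>i<n. 3 ^ (M + n) * bd a powr (2 / p) * cmod (Q i)) * bd z ^ n)"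
      using zb by (intro mult_left_mono mult_right_mono) auto
    also have "\<dots> = L * bd a powr (2 / p) * (\<Sum>i<n. cmod (Q i) * bd z ^ n)"
      by (simp add: L_def sum_distrib_left sum_distrib_right mult_ac)
    finally have "cmod (g k z) * bd z ^ (n - k) \<le> L * bd a powr (2 / p) * (\<Sum>i<n. cmod (Q i) * bd z ^ n)"
      using gu by (rule order.trans[rotated])
    then have "(cmod (g k z) * bd z ^ (n - k)) powr q \<le> (L * bd a powr (2 / p) * (\<Sum>i<n. cmod (Q i) * bd z ^ n)) powr q"
      using zb q by (intro powr_mono2) auto
    also have "\<dots> = L powr q * bd a powr (2 * q / p) * (\<Sum>i<n. cmod (Q i) * bd z ^ n) powr q"
    proof -
      have "(bd a powr (2 / p)) powr q = bd a powr (2 * q / p)" by (simp add: powr_powr)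
      then show ?thesis using C0 zb by (simp add: powr_mult L_def sum_nonneg)
    qed
    also have "\<dots> \<le> L powr q * bd a powr (2 * q / p) * (real (card {..<n}) powr q * (\<Sum>i<n. (cmod (Q i) * bd z ^ n) powr q))"
      using q zb by (intro mult_left_mono powr_sum_le) auto
    also have "\<dots> = C * bd a powr (2 * q / p) * (\<Sum>i<n. (cmod (Q i) * bd z ^ n) powr q)"
      by (simp add: C_def mult_ac)
    finally show ?thesis by (simp add: Q_def)
  qed
  then show ?thesis using C by blast
qed

lemma uniform_constant:
  fixes P :: "nat \<Rightarrow> real \<Rightarrow> bool"
  assumes "\<And>i. i < n \<Longrightarrow> \<exists>C>0. P i C" and mono: "\<And>i C D. P i C \<Longrightarrow> C \<le> D \<Longrightarrow> P i D"
  shows "\<exists>C>0. \<forall>i<n. P i C"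
proof -
  obtain c where c: "\<And>i. i < n \<Longrightarrow> c i > 0 \<and> P i (c i)" using assms(1) by metis
  define C where "C = 1 + (\<Sum>i<n. c i)"
  have s: "(\<Sum>i<n. c i) \<ge> 0" using c by (intro sum_nonneg) (auto intro: less_imp_le)
  have "c i \<le> C" if "i < n" for i
  proof -
    have "c i \<le> (\<Sum>i<n. c i)" using that c by (intro member_le_sum) (auto intro: less_imp_le)
    then show ?thesis by (simp add: C_def)
  qed
  then have "\<forall>i<n. P i C" using c mono by blast
  moreover have "C > 0" using s by (simp add: C_def)
  ultimately show ?thesis by blast
qed

text \<open>The test inequalities for the exponents M, ..., M + n - 1 are added up and converted
  into a statement about a single coefficient. The factor \<open>bd a powr (- (2 * q / p))\<close>
  compensates the normalisation of the kernels. \<open>M\<close> is chosen so large that all these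
  exponents meet the conditions of the kernel sum estimate.\<close>

lemma bounded_local_integrals:
  assumes bdd: "bounded_op p q (Ig n g)" and g: "\<forall>k<n. g k holomorphic_on unit_disc"
    and p: "p > 0" and q: "q > 0" and k: "k < n"
  shows "\<exists>C>0. \<forall>J l. finite J \<longrightarrow> separated J \<longrightarrow> J \<subseteq> {z. 1 / 2 \<le> cmod z \<and> cmod z < 1} \<longrightarrow> (\<forall>a\<in>J. l a \<ge> 0) \<longrightarrow>
    (\<Sum>a\<in>J. ennreal (l a powr q * bd a powr (- (2 * q / p)))
       * (\<integral>\<^sup>+z\<in>ball a (bd a / 2). ennreal ((cmod (g k z) * bd z ^ (n - k)) powr q) \<partial>lborel))
    \<le> ennreal (C * (\<Sum>a\<in>J. l a powr p) powr (q / p))"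
proof -
  obtain M0 :: nat where M0: "2 / p < real M0" using reals_Archimedean2 by blast
  define M where "M = max M0 3"
  have M: "real (M + i) * p > 2" "M + i \<ge> 3" for i
  proof -
    have "2 / p < real (M + i)" using M0 by (auto simp: M_def)
    then show "real (M + i) * p > 2" using p by (simp add: field_simps)
  qed (simp add: M_def)
  define Y where "Y = (\<lambda>i a. \<integral>\<^sup>+z\<in>ball a (bd a / 2). ennreal ((cmod (test_image n g p (M + i) a z) * bd z ^ n) powr q) \<partial>lborel)"
  define P where "P = (\<lambda>i C. \<forall>J l. finite J \<longrightarrow> separated J \<longrightarrow> J \<subseteq> unit_disc \<longrightarrow> (\<forall>a\<in>J. l a \<ge> 0) \<longrightarrow>
    (\<Sum>a\<in>J. ennreal (l a powr q) * Y i a) \<le> ennreal (C * (\<Sum>a\<in>J. l a powr p) powr (q / p)))"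
  have "\<exists>C>0. \<forall>i<n. P i C"
  proof (rule uniform_constant)
    show "\<exists>C>0. P i C" for i
      unfolding P_def Y_def by (rule bounded_test_inequality[OF bdd g p q M])
    show "P i D" if "P i C" "C \<le> D" for i C D
      unfolding P_def
    proof (intro allI impI)
      fix J and l :: "complex \<Rightarrow> real"
      assume J: "finite J" "separated J" "J \<subseteq> unit_disc" "\<forall>a\<in>J. l a \<ge> 0"
      have "(\<Sum>a\<in>J. ennreal (l a powr q) * Y i a) \<le> ennreal (C * (\<Sum>a\<in>J. l a powr p) powr (q / p))"
        using that(1) J unfolding P_def by blast
      also have "\<dots> \<le> ennreal (D * (\<Sum>a\<in>J. l a powr p) powr (q / p))"
        using that(2) by (intro ennreal_leI mult_right_mono) auto
      finally show "(\<Sum>a\<in>J. ennreal (l a powr q) * Y i a) \<le> ennreal (D * (\<Sum>a\<in>J. l a powr p) powr (q / p))" .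
    qed
  qed
  then obtain C1 where C1: "C1 > 0" and test: "\<And>i J l. i < n \<Longrightarrow> finite J \<Longrightarrow> separated J \<Longrightarrow> J \<subseteq> unit_disc \<Longrightarrow> (\<forall>a\<in>J. l a \<ge> 0) \<Longrightarrow>
    (\<Sum>a\<in>J. ennreal (l a powr q) * Y i a) \<le> ennreal (C1 * (\<Sum>a\<in>J. l a powr p) powr (q / p))"
    unfolding P_def by blast
  obtain C2 where C2: "C2 > 0" and low: "\<And>a z. 1 / 2 \<le> cmod a \<Longrightarrow> cmod a < 1 \<Longrightarrow> z \<in> ball a (bd a / 2) \<Longrightarrow>
    (cmod (g k z) * bd z ^ (n - k)) powr q
      \<le> C2 * bd a powr (2 * q / p) * (\<Sum>i<n. (cmod (test_image n g p (M + i) a z) * bd z ^ n) powr q)"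
    using test_image_lower_bound[OF p q k, of M] by blast
  define C where "C = C2 * real n * C1"
  have C: "C > 0" using C1 C2 k by (simp add: C_def)
  have "(\<Sum>a\<in>J. ennreal (l a powr q * bd a powr (- (2 * q / p)))
       * (\<integral>\<^sup>+z\<in>ball a (bd a / 2). ennreal ((cmod (g k z) * bd z ^ (n - k)) powr q) \<partial>lborel))
    \<le> ennreal (C * (\<Sum>a\<in>J. l a powr p) powr (q / p))"
    if J: "finite J" "separated J" "J \<subseteq> {z. 1 / 2 \<le> cmod z \<and> cmod z < 1}" and l: "\<forall>a\<in>J. l a \<ge> 0" for J l
  proof -
    have JD: "J \<subseteq> unit_disc" using J by auto
    have term_le: "ennreal (bd a powr (- (2 * q / p)))
       * (\<integral>\<^sup>+z\<in>ball a (bd a / 2). ennreal ((cmod (g k z) * bd z ^ (n - k)) powr q) \<partial>lborel)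
       \<le> ennreal C2 * (\<Sum>i<n. Y i a)" if a: "a \<in> J" for a
    proof -
      have a1: "1 / 2 \<le> cmod a" "cmod a < 1" using a J by auto
      define B where "B = ball a (bd a / 2)"
      define G where "G = (\<lambda>i z. ennreal ((cmod (test_image n g p (M + i) a z) * bd z ^ n) powr q) * indicator B z)"
      have measG: "G i \<in> borel_measurable lborel" for i
        unfolding G_def B_def using g q a1
        by (intro measurable_ball_weighted_powr holomorphic_test_image) auto
      have "(\<integral>\<^sup>+z\<in>B. ennreal ((cmod (g k z) * bd z ^ (n - k)) powr q) \<partial>lborel)
          \<le> (\<integral>\<^sup>+z. ennreal (C2 * bd a powr (2 * q / p)) * (\<Sum>i<n. G i z) \<partial>lborel)"
      proof (intro nn_integral_mono)
        fix z
        show "ennreal ((cmod (g k z) * bd z ^ (n - k)) powr q) * indicator B z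
            \<le> ennreal (C2 * bd a powr (2 * q / p)) * (\<Sum>i<n. G i z)"
        proof (cases "z \<in> B")
          case True
          have "ennreal ((cmod (g k z) * bd z ^ (n - k)) powr q)
              \<le> ennreal (C2 * bd a powr (2 * q / p) * (\<Sum>i<n. (cmod (test_image n g p (M + i) a z) * bd z ^ n) powr q))"
            using low[OF a1] True by (intro ennreal_leI) (simp add: B_def)
          also have "\<dots> = ennreal (C2 * bd a powr (2 * q / p)) * ennreal (\<Sum>i<n. (cmod (test_image n g p (M + i) a z) * bd z ^ n) powr q)"
            using C2 by (intro ennreal_mult sum_nonneg) auto
          also have "ennreal (\<Sum>i<n. (cmod (test_image n g p (M + i) a z) * bd z ^ n) powr q) = (\<Sum>i<n. G i z)"
          proof -
            have "ennreal (\<Sum>i<n. (cmod (test_image n g p (M + i) a z) * bd z ^ n) powr q)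
                = (\<Sum>i<n. ennreal ((cmod (test_image n g p (M + i) a z) * bd z ^ n) powr q))"
              by (rule sum_ennreal[symmetric]) simp
            then show ?thesis using True by (simp only: G_def indicator_simps mult_1_right)
          qed
          finally show ?thesis using True by simp
        qed simp
      qed
      also have "\<dots> = ennreal (C2 * bd a powr (2 * q / p)) * (\<integral>\<^sup>+z. (\<Sum>i<n. G i z) \<partial>lborel)"
        by (intro nn_integral_cmult borel_measurable_sum measG)
      also have "(\<integral>\<^sup>+z. (\<Sum>i<n. G i z) \<partial>lborel) = (\<Sum>i<n. Y i a)"
        by (subst nn_integral_sum[OF measG]) (simp add: Y_def G_def B_def)
      finally have "ennreal (bd a powr (- (2 * q / p))) * (\<integral>\<^sup>+z\<in>B. ennreal ((cmod (g k z) * bd z ^ (n - k)) powr q) \<partial>lborel)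
          \<le> ennreal (bd a powr (- (2 * q / p))) * (ennreal (C2 * bd a powr (2 * q / p)) * (\<Sum>i<n. Y i a))"
        by (intro mult_left_mono) auto
      also have "\<dots> = ennreal (bd a powr (- (2 * q / p)) * (C2 * bd a powr (2 * q / p))) * (\<Sum>i<n. Y i a)"
        using C2 by (subst ennreal_mult) (auto simp: mult.assoc)
      also have "bd a powr (- (2 * q / p)) * (C2 * bd a powr (2 * q / p)) = C2"
        using a1 by (simp add: powr_minus)
      finally show ?thesis by (simp add: B_def)
    qed
    have "(\<Sum>a\<in>J. ennreal (l a powr q * bd a powr (- (2 * q / p)))
       * (\<integral>\<^sup>+z\<in>ball a (bd a / 2). ennreal ((cmod (g k z) * bd z ^ (n - k)) powr q) \<partial>lborel))
      \<le> (\<Sum>a\<in>J. ennreal (l a powr q) * (ennreal C2 * (\<Sum>i<n. Y i a)))"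
    proof (intro sum_mono)
      fix a assume a: "a \<in> J"
      show "ennreal (l a powr q * bd a powr (- (2 * q / p)))
       * (\<integral>\<^sup>+z\<in>ball a (bd a / 2). ennreal ((cmod (g k z) * bd z ^ (n - k)) powr q) \<partial>lborel)
       \<le> ennreal (l a powr q) * (ennreal C2 * (\<Sum>i<n. Y i a))"
        using mult_left_mono[OF term_le[OF a], of "ennreal (l a powr q)"]
        by (simp add: ennreal_mult mult.assoc)
    qed
    also have "\<dots> = ennreal C2 * (\<Sum>i<n. \<Sum>a\<in>J. ennreal (l a powr q) * Y i a)"
      by (subst sum.swap) (simp add: sum_distrib_left mult_ac)
    also have "\<dots> \<le> ennreal C2 * (\<Sum>i<n. ennreal (C1 * (\<Sum>a\<in>J. l a powr p) powr (q / p)))"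
      using test J JD l by (intro mult_left_mono sum_mono) auto
    also have "\<dots> = ennreal (C * (\<Sum>a\<in>J. l a powr p) powr (q / p))"
      using C1 C2 by (simp add: C_def ennreal_mult ennreal_of_nat_eq_real_of_nat mult_ac)
    finally show ?thesis .
  qed
  then show ?thesis using C by blast
qed

text \<open>The converse of Hoelder's inequality for finite sequences, with conjugate exponents p /
  q and p / (p - q). The extremal choice \<open>l a = B a powr (t / p)\<close> turns both sums into
  \<open>X\<close> and gives X \<le> C X^(q/p), which can be solved because \<open>X\<close> is
  finite.\<close>

lemma duality_bound:
  fixes B :: "'a \<Rightarrow> real"
  assumes pq: "0 < q" "q < p" and J: "finite J" and B: "\<And>a. a \<in> J \<Longrightarrow> B a \<ge> 0" and C: "C > 0"
    and le: "\<And>l. \<forall>a\<in>J. l a \<ge> 0 \<Longrightarrow> (\<Sum>a\<in>J. l a powr q * B a) \<le> C * (\<Sum>a\<in>J. l a powr p) powr (q / p)"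
  shows "(\<Sum>a\<in>J. B a powr (p / (p - q))) \<le> C powr (p / (p - q))"
proof -
  define t where "t = p / (p - q)"
  define X where "X = (\<Sum>a\<in>J. B a powr t)"
  have t: "t > 0" using pq by (simp add: t_def)
  have e: "t / p * q + 1 = t" using pq by (simp add: t_def field_simps)
  have X: "X \<ge> 0" by (simp add: X_def sum_nonneg)
  define l where "l = (\<lambda>a. B a powr (t / p))"
  have 1: "l a powr q * B a = B a powr t" if "a \<in> J" for a
  proof (cases "B a = 0")
    case False
    then have "B a > 0" using B[OF that] by simp
    then have "l a powr q * B a = B a powr (t / p * q) * B a powr 1" by (simp add: l_def powr_powr)
    also have "\<dots> = B a powr t" unfolding powr_add[symmetric] e ..
    finally show ?thesis .
  qed (use t in simp)
  have 2: "l a powr p = B a powr t" for a using pq by (simp add: l_def powr_powr)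
  have "(\<Sum>a\<in>J. l a powr q * B a) \<le> C * (\<Sum>a\<in>J. l a powr p) powr (q / p)"
    by (rule le) (simp add: l_def)
  then have XC: "X \<le> C * X powr (q / p)" by (simp add: 1 2 X_def)
  have "X \<le> C powr t"
  proof (cases "X = 0")
    case False
    then have X0: "X > 0" using X by simp
    have "X powr (1 - q / p) = X / X powr (q / p)" using X0 by (simp add: powr_diff)
    also have "\<dots> \<le> C" using XC X0 by (simp add: field_simps)
    finally have "(X powr (1 - q / p)) powr t \<le> C powr t" using t by (intro powr_mono2) auto
    moreover have "(1 - q / p) * t = 1" using pq by (simp add: t_def field_simps)
    ultimately show ?thesis using X0 by (simp add: powr_powr)
  qed simp
  then show ?thesis by (simp add: X_def t_def)
qed

section \<open>Boundedness implies integrability of the coefficients\<close>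

text \<open>The kernels are tested only at |a| \<ge> 1/2, so the central disc is treated by a crude
  bound; a bound on the rest that is uniform in \<open>R\<close> passes to the limit by monotone
  convergence.\<close>

lemma nn_integral_disc_from_annuli:
  assumes [measurable]: "\<phi> \<in> borel_measurable borel"
    and inner: "\<And>z. cmod z < 1 / 2 \<Longrightarrow> \<phi> z \<le> ennreal B0"
    and outer: "\<And>R. R < 1 \<Longrightarrow> (\<integral>\<^sup>+z. \<phi> z * indicator {z. 1 / 2 \<le> cmod z \<and> cmod z \<le> R} z \<partial>lborel) \<le> ennreal B1"
  shows "(\<integral>\<^sup>+z\<in>unit_disc. \<phi> z \<partial>lborel) < \<infinity>"
proof -
  define r where "r = (\<lambda>k. 1 - 1 / real 2 ^ k)"
  have r: "r 0 = 0" "r k < 1" for k by (auto simp: r_def)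
  have "(\<integral>\<^sup>+z\<in>unit_disc. \<phi> z \<partial>lborel) \<le> ennreal B0 * ennreal pi + ennreal B1"
  proof (rule nn_integral_disc_rings_le[OF _ r_def])
    fix N
    have "(\<Sum>k<N. \<integral>\<^sup>+z\<in>annulus (r k) (r (Suc k)). \<phi> z \<partial>lborel) = (\<integral>\<^sup>+z\<in>annulus 0 (r N). \<phi> z \<partial>lborel)"
      using nn_integral_rings[of \<phi> r N] radius_mono[OF _ r_def] r by simp
    also have "\<dots> \<le> (\<integral>\<^sup>+z. (ennreal B0 * indicator (ball 0 1) z
        + \<phi> z * indicator {z. 1 / 2 \<le> cmod z \<and> cmod z \<le> r N} z) \<partial>lborel)"
    proof (intro nn_integral_mono)
      fix z
      show "\<phi> z * indicator (annulus 0 (r N)) z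
          \<le> ennreal B0 * indicator (ball 0 1) z + \<phi> z * indicator {z. 1 / 2 \<le> cmod z \<and> cmod z \<le> r N} z"
      proof (cases "cmod z < 1 / 2")
        case True
        then show ?thesis using inner[OF True] by (auto simp: indicator_def annulus_def)
      next
        case False
        then show ?thesis by (auto simp: indicator_def annulus_def intro: add_increasing)
      qed
    qed
    also have "\<dots> = (\<integral>\<^sup>+z. ennreal B0 * indicator (ball (0::complex) 1) z \<partial>lborel)
        + (\<integral>\<^sup>+z. \<phi> z * indicator {z. 1 / 2 \<le> cmod z \<and> cmod z \<le> r N} z \<partial>lborel)"
    proof (rule nn_integral_add)
      have "{z::complex. 1 / 2 \<le> cmod z \<and> cmod z \<le> r N} \<in> sets borel" by measurable
      then show "(\<lambda>z. \<phi> z * indicator {z. 1 / 2 \<le> cmod z \<and> cmod z \<le> r N} z) \<in> borel_measurable lborel"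
        using assms(1) by (intro borel_measurable_times_ennreal borel_measurable_indicator) auto
    qed (intro borel_measurable_times_ennreal borel_measurable_const borel_measurable_indicator, simp)
    also have "\<dots> \<le> ennreal B0 * ennreal pi + ennreal B1"
    proof (rule add_mono)
      show "(\<integral>\<^sup>+z. ennreal B0 * indicator (ball (0::complex) 1) z \<partial>lborel) \<le> ennreal B0 * ennreal pi"
        using emeasure_complex_ball[of 1 0] by (subst nn_integral_cmult_indicator) auto
    qed (rule outer[OF r(2)])
    finally show "(\<Sum>k<N. \<integral>\<^sup>+z\<in>annulus (r k) (r (Suc k)). \<phi> z \<partial>lborel) \<le> ennreal B0 * ennreal pi + ennreal B1" .
  qed auto
  also have "\<dots> < \<infinity>" by (simp add: ennreal_mult_less_top)
  finally show ?thesis .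
qed

text \<open>With \<open>h\<close> the weighted coefficient and s = q t, the local bound for
  \<open>g k\<close> dominates h^s on the disc of radius \<open>bd a / 3\<close> by the t-th power
  of an average of h^q over the disc of radius \<open>bd a / 2\<close>. Such discs about a maximal
  separated set cover, and \<open>duality_bound\<close> controls the sum of the t-th powers.\<close>

theorem bounded_imp_coefficient_integrable:
  assumes bdd: "bounded_op p q (Ig n g)" and g: "\<forall>k<n. g k holomorphic_on unit_disc"
    and pq: "0 < q" "q < p" and k: "k < n"
  shows "dint (\<lambda>z. (cmod (g k z) * bd z ^ (n - k)) powr (p * q / (p - q))) < \<infinity>"
proof -
  have p: "p > 0" using pq by simp
  define N where "N = n - k"
  define t where "t = p / (p - q)"
  define s where "s = p * q / (p - q)"
  have t: "t > 0" "q * t = s" and s: "s > 0" using pq by (auto simp: t_def s_def field_simps)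
  define h where "h = (\<lambda>z. cmod (g k z) * bd z ^ N)"
  have holg: "g k holomorphic_on unit_disc" using g k by blast
  define b where "b = (\<lambda>a. \<integral>\<^sup>+z\<in>ball a (bd a / 2). ennreal (h z powr q) \<partial>lborel)"
  obtain C1 where C1: "C1 > 0" and loc: "\<And>J l. finite J \<Longrightarrow> separated J \<Longrightarrow> J \<subseteq> {z. 1 / 2 \<le> cmod z \<and> cmod z < 1} \<Longrightarrow> (\<forall>a\<in>J. l a \<ge> 0) \<Longrightarrow>
    (\<Sum>a\<in>J. ennreal (l a powr q * bd a powr (- (2 * q / p))) * b a) \<le> ennreal (C1 * (\<Sum>a\<in>J. l a powr p) powr (q / p))"
    using bounded_local_integrals[OF bdd g p pq(1) k] unfolding b_def h_def N_def by blast
  obtain C2 where C2: "C2 > 0" and sub: "\<And>f (a::complex) r. r > 0 \<Longrightarrow> f holomorphic_on ball a r \<Longrightarrow>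
           ennreal (cmod (f a) powr q * r\<^sup>2)
             \<le> ennreal C2 * (\<integral>\<^sup>+z\<in>ball a r. ennreal (cmod (f z) powr q) \<partial>lborel)"
    using holomorphic_powr_local_bound[OF pq(1)] by blast
  define \<beta> where "\<beta> = (\<lambda>a. enn2real (b a))"
  have \<beta>_nonneg: "\<beta> a \<ge> 0" for a by (simp add: \<beta>_def)
  define B where "B = (\<lambda>a. bd a powr (- (2 * q / p)) * \<beta> a)"
  \<comment> \<open>Testing on the singleton {a} shows that the local integral is finite.\<close>
  have \<beta>: "b a = ennreal (\<beta> a)" if a: "1 / 2 \<le> cmod a" "cmod a < 1" for a
  proof -
    have "(\<Sum>a\<in>{a}. ennreal (1 powr q * bd a powr (- (2 * q / p))) * b a) \<le> ennreal (C1 * (\<Sum>a\<in>{a}. 1 powr p) powr (q / p))"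
      using a by (intro loc) (auto simp: separated_def)
    then have "ennreal (bd a powr (- (2 * q / p))) * b a < \<infinity>"
      by (auto intro: le_less_trans)
    then have "b a < \<infinity>" using a by (auto simp: ennreal_mult_less_top)
    then show ?thesis by (simp add: \<beta>_def)
  qed
  \<comment> \<open>The radius \<delta> / 6 fits between 1/3 and 1/2 and gives 36; comparing
    \<open>bd z\<close> with \<open>bd w\<close> through \<open>bd a\<close> loses 2 twice, hence
    the 4.\<close>
  define D where "D = 36 * C2 * (4 ^ N) powr q"
  define K0 where "K0 = D powr t * (pi / 9)"
  have K0: "K0 > 0" "D > 0" using C2 by (auto simp: K0_def D_def)
  have local_int: "(\<integral>\<^sup>+z\<in>ball a (bd a / 3). ennreal (h z powr s) \<partial>lborel) \<le> ennreal (K0 * B a powr t)"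
    if a: "1 / 2 \<le> cmod a" "cmod a < 1" for a
  proof -
    define \<delta> where "\<delta> = bd a"
    have \<delta>: "\<delta> > 0" using a by (simp add: \<delta>_def)
    have pt: "h z powr s \<le> D powr t * (\<delta> powr (- 2) * \<beta> a) powr t" if z: "z \<in> ball a (\<delta> / 3)" for z
    proof -
      have subset: "ball z (\<delta> / 6) \<subseteq> ball a (\<delta> / 2)"
      proof
        fix w assume "w \<in> ball z (\<delta> / 6)"
        then have "dist z w < \<delta> / 6" "dist a z < \<delta> / 3" using z by auto
        then show "w \<in> ball a (\<delta> / 2)" using dist_triangle[of a w z] \<delta> by simp
      qed
      have subD: "ball a (\<delta> / 2) \<subseteq> unit_disc"
        using ball_half_subset(1)[OF a(2)] by (auto simp: \<delta>_def)
      have "z \<in> ball z (\<delta> / 6)" using \<delta> by simp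
      then have z2: "z \<in> ball a (\<delta> / 2)" using subset by blast
      note zb = ball_half_subset[OF a(2) z2[unfolded \<delta>_def]]
      have "ennreal (cmod (g k z) powr q * (\<delta> / 6)\<^sup>2)
          \<le> ennreal C2 * (\<integral>\<^sup>+w\<in>ball z (\<delta> / 6). ennreal (cmod (g k w) powr q) \<partial>lborel)"
        using \<delta> holg subset subD by (intro sub) (auto intro: holomorphic_on_subset)
      then have "ennreal ((bd z ^ N) powr q) * ennreal (cmod (g k z) powr q * (\<delta> / 6)\<^sup>2)
          \<le> ennreal ((bd z ^ N) powr q) * (ennreal C2 * (\<integral>\<^sup>+w\<in>ball z (\<delta> / 6). ennreal (cmod (g k w) powr q) \<partial>lborel))"
        by (intro mult_left_mono) auto
      also have "\<dots> = ennreal C2 * (ennreal ((bd z ^ N) powr q) * (\<integral>\<^sup>+w\<in>ball z (\<delta> / 6). ennreal (cmod (g k w) powr q) \<partial>lborel))"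
        by (simp only: mult_ac)
      also have "ennreal ((bd z ^ N) powr q) * (\<integral>\<^sup>+w\<in>ball z (\<delta> / 6). ennreal (cmod (g k w) powr q) \<partial>lborel)
          = (\<integral>\<^sup>+w. ennreal ((bd z ^ N) powr q) * (ennreal (cmod (g k w) powr q) * indicator (ball z (\<delta> / 6)) w) \<partial>lborel)"
      proof (rule nn_integral_cmult[symmetric])
        have "continuous_on (ball z (\<delta> / 6)) (\<lambda>w. cmod (g k w) powr q)"
          using pq(1) holomorphic_on_imp_continuous_on[OF holg] subset subD
          by (intro continuous_on_powr' continuous_intros) (auto intro: continuous_on_subset)
        from measurable_ennreal_indicator_continuous[OF this]
        show "(\<lambda>w. ennreal (cmod (g k w) powr q) * indicator (ball z (\<delta> / 6)) w) \<in> borel_measurable lborel" by simp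
      qed
      also have "\<dots> \<le> (\<integral>\<^sup>+w. ennreal ((4 ^ N) powr q) * (ennreal (h w powr q) * indicator (ball a (\<delta> / 2)) w) \<partial>lborel)"
      proof (intro nn_integral_mono)
        fix w
        show "ennreal ((bd z ^ N) powr q) * (ennreal (cmod (g k w) powr q) * indicator (ball z (\<delta> / 6)) w)
          \<le> ennreal ((4 ^ N) powr q) * (ennreal (h w powr q) * indicator (ball a (\<delta> / 2)) w)"
        proof (cases "w \<in> ball z (\<delta> / 6)")
          case True
          then have w: "w \<in> ball a (\<delta> / 2)" using subset by blast
          note wb = ball_half_subset[OF a(2) w[unfolded \<delta>_def]]
          have "(bd z ^ N) powr q \<le> ((4 * bd w) ^ N) powr q"
            using zb wb pq by (intro powr_mono2 power_mono) auto
          then have "(bd z ^ N) powr q * cmod (g k w) powr q \<le> ((4 * bd w) ^ N) powr q * cmod (g k w) powr q"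
            by (intro mult_right_mono) auto
          also have "\<dots> = (4 ^ N) powr q * h w powr q"
            by (simp only: h_def power_mult_distrib powr_mult mult_ac)
          finally have "ennreal ((bd z ^ N) powr q * cmod (g k w) powr q) \<le> ennreal ((4 ^ N) powr q * h w powr q)"
            by (rule ennreal_leI)
          then show ?thesis using True w by (simp add: ennreal_mult del: mem_ball)
        qed simp
      qed
      also have "\<dots> = ennreal ((4 ^ N) powr q) * b a"
      proof -
        have "(\<lambda>w. ennreal (h w powr q) * indicator (ball a (\<delta> / 2)) w) \<in> borel_measurable lborel"
          unfolding h_def \<delta>_def by (rule measurable_ball_weighted_powr[OF holg pq(1) a(2)])
        then show ?thesis unfolding b_def \<delta>_def[symmetric] by (rule nn_integral_cmult)
      qed
      also have "\<dots> = ennreal ((4 ^ N) powr q * \<beta> a)" by (simp add: \<beta>[OF a] ennreal_mult \<beta>_nonneg)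
      finally have "ennreal ((bd z ^ N) powr q) * ennreal (cmod (g k z) powr q * (\<delta> / 6)\<^sup>2)
          \<le> ennreal C2 * ennreal ((4 ^ N) powr q * \<beta> a)" by (simp add: mult_left_mono)
      then have "ennreal ((bd z ^ N) powr q * (cmod (g k z) powr q * (\<delta> / 6)\<^sup>2)) \<le> ennreal (C2 * ((4 ^ N) powr q * \<beta> a))"
        using C2 by (simp add: ennreal_mult[symmetric] \<beta>_nonneg del: ennreal_mult'')
      then have "(bd z ^ N) powr q * (cmod (g k z) powr q * (\<delta> / 6)\<^sup>2) \<le> C2 * ((4 ^ N) powr q * \<beta> a)"
        using C2 by (subst (asm) ennreal_le_iff) (auto simp: \<beta>_nonneg)
      then have "h z powr q * \<delta>\<^sup>2 \<le> D * \<beta> a"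
        using zb by (simp add: h_def D_def powr_mult power_divide field_simps)
      then have "h z powr q \<le> D * (\<delta> powr (- 2) * \<beta> a)"
        using \<delta> by (simp add: powr_minus field_simps)
      then have "(h z powr q) powr t \<le> (D * (\<delta> powr (- 2) * \<beta> a)) powr t"
        using t by (intro powr_mono2) auto
      then show ?thesis using t K0 by (simp add: powr_powr powr_mult \<beta>_nonneg)
    qed
    have "(\<integral>\<^sup>+z\<in>ball a (\<delta> / 3). ennreal (h z powr s) \<partial>lborel)
        \<le> (\<integral>\<^sup>+z. ennreal (D powr t * (\<delta> powr (- 2) * \<beta> a) powr t) * indicator (ball a (\<delta> / 3)) z \<partial>lborel)"
    proof (intro nn_integral_mono)
      fix z show "ennreal (h z powr s) * indicator (ball a (\<delta> / 3)) z
        \<le> ennreal (D powr t * (\<delta> powr (- 2) * \<beta> a) powr t) * indicator (ball a (\<delta> / 3)) z"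
        using pt[of z] by (cases "z \<in> ball a (\<delta> / 3)") (simp_all add: ennreal_leI del: mem_ball)
    qed
    also have "\<dots> = ennreal (D powr t * (\<delta> powr (- 2) * \<beta> a) powr t) * emeasure lborel (ball a (\<delta> / 3))"
      by (rule nn_integral_cmult_indicator) simp
    also have "\<dots> = ennreal (D powr t * (\<delta> powr (- 2) * \<beta> a) powr t * (pi * (\<delta> / 3)\<^sup>2))"
      using \<delta> by (subst emeasure_complex_ball) (auto simp: ennreal_mult)
    also have "D powr t * (\<delta> powr (- 2) * \<beta> a) powr t * (pi * (\<delta> / 3)\<^sup>2) = K0 * B a powr t"
    proof -
      \<comment> \<open>The area of the disc against the normalisation of the average gives exactly
        the power of \<open>bd a\<close> built into \<open>B\<close>.\<close>
      have e: "- 2 * t + 2 = - (2 * q / p) * t" using pq by (simp add: t_def field_simps)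
      have "(\<delta> powr (- 2) * \<beta> a) powr t * \<delta>\<^sup>2 = \<beta> a powr t * (\<delta> powr (- 2 * t) * \<delta> powr 2)"
        using \<delta> by (simp only: powr_mult powr_powr powr_numeral mult_ac)
      also have "\<delta> powr (- 2 * t) * \<delta> powr 2 = \<delta> powr (- (2 * q / p) * t)"
        by (simp only: powr_add[symmetric] e)
      finally have "(\<delta> powr (- 2) * \<beta> a) powr t * \<delta>\<^sup>2 = B a powr t"
        by (simp only: B_def \<delta>_def[symmetric] powr_mult powr_powr mult_ac)
      then show ?thesis by (simp add: K0_def power_divide)
    qed
    finally show ?thesis by (simp only: \<delta>_def)
  qed
  \<comment> \<open>The separated set depends on \<open>R\<close> and may grow with it, but the
    bound \<open>C1\<close> to the power \<open>t\<close> from duality does not.\<close>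
  have outer: "(\<integral>\<^sup>+z. (ennreal (h z powr s) * indicator unit_disc z) * indicator {z. 1 / 2 \<le> cmod z \<and> cmod z \<le> R} z \<partial>lborel)
      \<le> ennreal (K0 * C1 powr t)" if R: "R < 1" for R
  proof -
    obtain J where J: "finite J" "separated J" "J \<subseteq> {z. 1 / 2 \<le> cmod z \<and> cmod z \<le> R}"
      and cover: "\<And>z. 1 / 2 \<le> cmod z \<Longrightarrow> cmod z \<le> R \<Longrightarrow> \<exists>a\<in>J. z \<in> ball a (bd a / 3)"
      using maximal_separated[OF R] by blast
    have J': "J \<subseteq> {z. 1 / 2 \<le> cmod z \<and> cmod z < 1}" using J R by auto
    define H where "H = (\<lambda>a z. ennreal (h z powr s) * indicator (ball a (bd a / 3)) z)"
    have measH: "H a \<in> borel_measurable lborel" if "a \<in> J" for a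
    proof -
      have a1: "cmod a < 1" using that J' by auto
      have "ball a (bd a / 3) \<subseteq> ball a (bd a / 2)" using a1 by (intro subset_ball) simp
      also have "\<dots> \<subseteq> unit_disc" using ball_half_subset(1)[OF a1] by auto
      finally have "continuous_on (ball a (bd a / 3)) (\<lambda>z. h z powr s)"
        unfolding h_def using continuous_on_weighted_powr[OF holg s] by (rule continuous_on_subset[rotated])
      from measurable_ennreal_indicator_continuous[OF this] show ?thesis by (simp add: H_def)
    qed
    have "(\<integral>\<^sup>+z. (ennreal (h z powr s) * indicator unit_disc z) * indicator {z. 1 / 2 \<le> cmod z \<and> cmod z \<le> R} z \<partial>lborel)
        \<le> (\<integral>\<^sup>+z. (\<Sum>a\<in>J. H a z) \<partial>lborel)"
    proof (intro nn_integral_mono)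
      fix z
      show "(ennreal (h z powr s) * indicator unit_disc z) * indicator {z. 1 / 2 \<le> cmod z \<and> cmod z \<le> R} z \<le> (\<Sum>a\<in>J. H a z)"
      proof (cases "1 / 2 \<le> cmod z \<and> cmod z \<le> R")
        case True
        then obtain a where a: "a \<in> J" "z \<in> ball a (bd a / 3)" using cover by blast
        then have "ennreal (h z powr s) = H a z" by (simp add: H_def)
        also have "\<dots> \<le> (\<Sum>a\<in>J. H a z)" using a J by (intro member_le_sum) auto
        finally show ?thesis using True R by simp
      qed simp
    qed
    also have "\<dots> = (\<Sum>a\<in>J. \<integral>\<^sup>+z. H a z \<partial>lborel)"
      by (rule nn_integral_sum[OF measH])
    also have "\<dots> \<le> (\<Sum>a\<in>J. ennreal (K0 * B a powr t))"
      unfolding H_def using J' by (intro sum_mono local_int) auto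
    also have "\<dots> = ennreal (\<Sum>a\<in>J. K0 * B a powr t)"
      using K0 by (intro sum_ennreal) auto
    also have "\<dots> \<le> ennreal (K0 * C1 powr t)"
    proof (rule ennreal_leI)
      have "(\<Sum>a\<in>J. B a powr (p / (p - q))) \<le> C1 powr (p / (p - q))"
      proof (rule duality_bound[OF pq J(1) _ C1])
        fix l :: "complex \<Rightarrow> real" assume l: "\<forall>a\<in>J. l a \<ge> 0"
        have "(\<Sum>a\<in>J. ennreal (l a powr q * bd a powr (- (2 * q / p))) * b a) = (\<Sum>a\<in>J. ennreal (l a powr q * B a))"
        proof (intro sum.cong refl)
          fix a assume "a \<in> J"
          then have "b a = ennreal (\<beta> a)" using J' by (intro \<beta>) auto
          then show "ennreal (l a powr q * bd a powr (- (2 * q / p))) * b a = ennreal (l a powr q * B a)"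
            by (simp add: ennreal_mult[symmetric] \<beta>_nonneg B_def mult.assoc)
        qed
        also have "\<dots> = ennreal (\<Sum>a\<in>J. l a powr q * B a)"
          by (rule sum_ennreal) (simp add: B_def \<beta>_nonneg)
        finally have "ennreal (\<Sum>a\<in>J. l a powr q * B a) \<le> ennreal (C1 * (\<Sum>a\<in>J. l a powr p) powr (q / p))"
          using loc[OF J(1,2) J' l] by simp
        then show "(\<Sum>a\<in>J. l a powr q * B a) \<le> C1 * (\<Sum>a\<in>J. l a powr p) powr (q / p)"
          using C1 by (subst (asm) ennreal_le_iff) auto
      qed (simp add: B_def \<beta>_nonneg)
      then show "(\<Sum>a\<in>J. K0 * B a powr t) \<le> K0 * C1 powr t"
        using K0 by (simp add: sum_distrib_left[symmetric] t_def)
    qed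
    finally show ?thesis .
  qed
  have cont: "continuous_on unit_disc (\<lambda>z. h z powr s)"
    unfolding h_def by (rule continuous_on_weighted_powr[OF holg s])
  have "compact ((\<lambda>z. h z powr s) ` cball 0 (1 / 2))"
    using cont by (intro compact_continuous_image) (auto intro: continuous_on_subset)
  then have "bounded ((\<lambda>z. h z powr s) ` cball 0 (1 / 2))" by (rule compact_imp_bounded)
  then obtain B0 where B0: "\<And>x. x \<in> (\<lambda>z. h z powr s) ` cball 0 (1 / 2) \<Longrightarrow> norm x \<le> B0"
    unfolding bounded_iff by blast
  have "(\<integral>\<^sup>+z\<in>unit_disc. (ennreal (h z powr s) * indicator unit_disc z) \<partial>lborel) < \<infinity>"
  proof (rule nn_integral_disc_from_annuli[OF _ _ outer])
    show "(\<lambda>z. ennreal (h z powr s) * indicator unit_disc z) \<in> borel_measurable borel"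
      by (rule measurable_ennreal_indicator_continuous[OF cont]) simp
    show "ennreal (h z powr s) * indicator unit_disc z \<le> ennreal B0" if "cmod z < 1 / 2" for z
    proof -
      have "norm (h z powr s) \<le> B0" using that by (intro B0 imageI) simp
      then show ?thesis by (auto simp: indicator_def intro: ennreal_leI)
    qed
  qed
  moreover have "(\<integral>\<^sup>+z\<in>unit_disc. (ennreal (h z powr s) * indicator unit_disc z) \<partial>lborel)
      = dint (\<lambda>z. h z powr s)"
    by (intro nn_integral_cong) (auto split: split_indicator)
  ultimately show ?thesis by (simp add: h_def N_def s_def)
qed

section \<open>Compactness\<close>

text \<open>Each application of \<open>Iop\<close> vanishes at 0, so the Littlewood--Paley
  inequality loses its value term and merely adds \<open>q\<close> to the exponent of the
  weight.\<close>

lemma funpow_Iop_integral_le: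
  assumes q: "q > 0" and \<alpha>: "\<alpha> \<ge> 0"
  shows "\<exists>C>0. \<forall>h. h holomorphic_on unit_disc \<longrightarrow>
    dint (\<lambda>z. cmod ((Iop ^^ n) h z) powr q * bd z powr \<alpha>)
      \<le> ennreal C * dint (\<lambda>z. cmod (h z) powr q * bd z powr (\<alpha> + real n * q))"
proof (induction n)
  case 0
  then show ?case by (intro exI[of _ 1]) auto
next
  case (Suc n)
  obtain C1 where C1: "C1 > 0" and IH: "\<And>h. h holomorphic_on unit_disc \<Longrightarrow>
    dint (\<lambda>z. cmod ((Iop ^^ n) h z) powr q * bd z powr \<alpha>)
      \<le> ennreal C1 * dint (\<lambda>z. cmod (h z) powr q * bd z powr (\<alpha> + real n * q))"
    using Suc by blast
  have "\<alpha> + real n * q \<ge> 0" using q \<alpha> by simp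
  then have "\<alpha> + real n * q \<ge> - 1 / 4" by linarith
  then obtain C2 where C2: "C2 > 0" and lp: "\<And>F. F holomorphic_on unit_disc \<Longrightarrow>
    dint (\<lambda>z. cmod (F z) powr q * bd z powr (\<alpha> + real n * q))
      \<le> ennreal C2 * (ennreal (cmod (F 0) powr q)
          + dint (\<lambda>z. cmod (deriv F z) powr q * bd z powr (\<alpha> + real n * q + q)))"
    using littlewood_paley_le[OF q, of "\<alpha> + real n * q"] by blast
  have "dint (\<lambda>z. cmod ((Iop ^^ Suc n) h z) powr q * bd z powr \<alpha>)
      \<le> ennreal (C1 * C2) * dint (\<lambda>z. cmod (h z) powr q * bd z powr (\<alpha> + real (Suc n) * q))"
    if hol: "h holomorphic_on unit_disc" for h
  proof -
    note I = Iop_properties[OF hol]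
    have "dint (\<lambda>z. cmod ((Iop ^^ Suc n) h z) powr q * bd z powr \<alpha>)
        \<le> ennreal C1 * dint (\<lambda>z. cmod (Iop h z) powr q * bd z powr (\<alpha> + real n * q))"
      using IH[OF I(1)] by (simp add: funpow_swap1)
    also have "\<dots> \<le> ennreal C1 * (ennreal C2 * (ennreal (cmod (Iop h 0) powr q)
          + dint (\<lambda>z. cmod (deriv (Iop h) z) powr q * bd z powr (\<alpha> + real n * q + q))))"
      by (intro mult_left_mono lp I) auto
    also have "dint (\<lambda>z. cmod (deriv (Iop h) z) powr q * bd z powr (\<alpha> + real n * q + q))
        = dint (\<lambda>z. cmod (h z) powr q * bd z powr (\<alpha> + real (Suc n) * q))"
      using I(2) by (intro nn_integral_cong) (auto simp: algebra_simps split: split_indicator)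
    finally show ?thesis using q I(3) C1 C2 by (simp add: ennreal_mult mult.assoc)
  qed
  then show ?case using C1 C2 by (intro exI[of _ "C1 * C2"]) auto
qed

text \<open>Young's inequality with a small factor on the p-th power. Keeping the product inside the
  minimum makes the remainder vanish when \<open>x\<close> tends to 0, while its bound by a power of
  \<open>y\<close> is independent of \<open>x\<close>: exactly what dominated convergence asks
  for.\<close>

lemma young_min:
  fixes p q \<eta> :: real
  assumes pq: "0 < q" "q < p" and \<eta>: "\<eta> > 0"
  shows "\<exists>K>0. \<forall>x\<ge>0. \<forall>y\<ge>0. x powr q * y powr q
    \<le> \<eta> * x powr p + min (x powr q * y powr q) (K * y powr (p * q / (p - q)))"
proof -
  define \<kappa> where "\<kappa> = \<eta> powr (1 / q)"
  have \<kappa>: "\<kappa> > 0" "\<kappa> powr q = \<eta>" using \<eta> pq by (auto simp: \<kappa>_def powr_powr)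
  \<comment> \<open>Below the threshold \<open>y = \<kappa> * x powr ((p - q) / q)\<close> the first
    term suffices. Above it, solving for \<open>x powr q\<close> produces this exponent of
    \<open>y\<close>.\<close>
  define e where "e = q * q / (p - q)"
  define K where "K = \<kappa> powr (- e)"
  have K: "K > 0" using \<kappa> by (simp add: K_def)
  have e: "e + q = p * q / (p - q)" using pq by (simp add: e_def field_simps)
  have "x powr q * y powr q \<le> \<eta> * x powr p + min (x powr q * y powr q) (K * y powr (p * q / (p - q)))"
    if xy: "x \<ge> 0" "y \<ge> 0" for x y
  proof (cases "y \<le> \<kappa> * x powr ((p - q) / q)")
    case True
    have "y powr q \<le> (\<kappa> * x powr ((p - q) / q)) powr q" using True xy pq by (intro powr_mono2) auto
    also have "\<dots> = \<eta> * x powr (p - q)" using \<kappa> pq xy by (simp add: powr_mult powr_powr)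
    finally have "x powr q * y powr q \<le> x powr q * (\<eta> * x powr (p - q))" by (intro mult_left_mono) auto
    also have "\<dots> = \<eta> * (x powr q * x powr (p - q))" by (simp only: mult_ac)
    also have "x powr q * x powr (p - q) = x powr p" by (simp add: powr_add[symmetric])
    finally show ?thesis using xy K by (simp add: add_increasing2)
  next
    case False
    then have "x powr ((p - q) / q) \<le> y / \<kappa>" using \<kappa> by (simp add: field_simps)
    then have "(x powr ((p - q) / q)) powr (q * q / (p - q)) \<le> (y / \<kappa>) powr e"
      unfolding e_def using pq by (intro powr_mono2) auto
    then have "x powr q \<le> (y / \<kappa>) powr e" using pq xy by (simp add: powr_powr)
    also have "\<dots> = K * y powr e" using \<kappa> xy by (simp add: powr_divide K_def powr_minus field_simps)
    finally have "x powr q * y powr q \<le> K * y powr e * y powr q" by (intro mult_right_mono) auto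
    also have "\<dots> = K * y powr (p * q / (p - q))" by (simp only: mult.assoc powr_add[symmetric] e)
    finally have "x powr q * y powr q \<le> K * y powr (p * q / (p - q))" .
    then have "min (x powr q * y powr q) (K * y powr (p * q / (p - q))) = x powr q * y powr q" by simp
    then show ?thesis using \<eta> by simp
  qed
  then show ?thesis using K by blast
qed

text \<open>The combination is assumed on the disc only, since derivatives are controlled nowhere
  else; the segment from 0 to \<open>z\<close> never leaves the disc.\<close>

lemma funpow_Iop_linear:
  assumes "a holomorphic_on unit_disc" "b holomorphic_on unit_disc"
    and "\<And>z. cmod z < 1 \<Longrightarrow> u z = c * a z + d * b z" and "cmod z < 1"
  shows "(Iop ^^ n) u z = c * (Iop ^^ n) a z + d * (Iop ^^ n) b z"
  using assms(3,4)
proof (induction n arbitrary: z)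
  case (Suc n)
  have seg: "closed_segment 0 z \<subseteq> unit_disc"
    using Suc.prems(2) by (intro closed_segment_subset) (auto simp: unit_disc_def)
  have int: "(Iop ^^ n) h contour_integrable_on linepath 0 z" if "h holomorphic_on unit_disc" for h
    using holomorphic_on_imp_continuous_on[OF funpow_Iop(1)[OF that]] seg
    by (intro contour_integrable_continuous_linepath) (rule continuous_on_subset)
  have "(Iop ^^ Suc n) u z = contour_integral (linepath 0 z) (\<lambda>w. c * (Iop ^^ n) a w + d * (Iop ^^ n) b w)"
    unfolding funpow.simps comp_def Iop_def[of "(Iop ^^ n) u"]
  proof (rule contour_integral_eq)
    fix w assume "w \<in> path_image (linepath 0 z)"
    then have "cmod w < 1" using seg by auto
    then show "(Iop ^^ n) u w = c * (Iop ^^ n) a w + d * (Iop ^^ n) b w" using Suc by blast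
  qed
  also have "\<dots> = c * (Iop ^^ Suc n) a z + d * (Iop ^^ Suc n) b z"
    using int[OF assms(1)] int[OF assms(2)]
    by (simp add: contour_integral_add contour_integrable_lmul contour_integral_lmul Iop_def)
  finally show ?case .
qed simp

lemma Ig_linear:
  assumes f: "f holomorphic_on unit_disc" and h: "h holomorphic_on unit_disc"
    and g: "\<forall>k<n. g k holomorphic_on unit_disc" and z: "cmod z < 1"
  shows "Ig n g (\<lambda>z. c * f z + d * h z) z = c * Ig n g f z + d * Ig n g h z"
  unfolding Ig_def
proof (rule funpow_Iop_linear[OF holomorphic_Ig_integrand[OF f g] holomorphic_Ig_integrand[OF h g] _ z])
  fix z :: complex assume z: "cmod z < 1"
  have der: "(deriv ^^ k) (\<lambda>z. c * f z + d * h z) z = c * (deriv ^^ k) f z + d * (deriv ^^ k) h z" for k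
  proof -
    have "(deriv ^^ k) (\<lambda>z. c * f z + d * h z) z = (deriv ^^ k) (\<lambda>z. c * f z) z + (deriv ^^ k) (\<lambda>z. d * h z) z"
      using f h z by (intro higher_deriv_add[where S=unit_disc] holomorphic_intros) auto
    also have "(deriv ^^ k) (\<lambda>z. c * f z) z = c * (deriv ^^ k) f z"
      using f z by (intro higher_deriv_cmult[where A=unit_disc]) auto
    also have "(deriv ^^ k) (\<lambda>z. d * h z) z = d * (deriv ^^ k) h z"
      using h z by (intro higher_deriv_cmult[where A=unit_disc]) auto
    finally show ?thesis .
  qed
  show "(\<Sum>k<n. (deriv ^^ k) (\<lambda>z. c * f z + d * h z) z * g k z)
      = c * (\<Sum>k<n. (deriv ^^ k) f z * g k z) + d * (\<Sum>k<n. (deriv ^^ k) h z * g k z)"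
    by (simp add: der sum_distrib_left sum.distrib distrib_right mult.assoc)
qed

section \<open>The Bergman quasi-norm, and boundedness of compact operators\<close>

lemma Bergman_norm_cong:
  assumes "\<And>z. cmod z < 1 \<Longrightarrow> cmod (f z) = cmod (h z)"
  shows "Bergman_norm p f = Bergman_norm p h"
proof -
  have "disc_int (\<lambda>z. cmod (f z) powr p) = disc_int (\<lambda>z. cmod (h z) powr p)"
    unfolding disc_int_def
    using assms by (intro arg_cong2[where f="(/)"] nn_integral_cong) (auto split: split_indicator)
  then show ?thesis by (simp add: Bergman_norm_def)
qed

lemma nn_integral_powr_combination_le:
  assumes "f holomorphic_on unit_disc" "h holomorphic_on unit_disc" "q > 0"
    and "\<And>z. cmod z < 1 \<Longrightarrow> cmod (u z) \<le> cmod (f z) + cmod (h z)"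
  shows "dint (\<lambda>z. cmod (u z) powr q)
    \<le> ennreal (2 powr q) * (dint (\<lambda>z. cmod (f z) powr q)
        + dint (\<lambda>z. cmod (h z) powr q))"
proof -
  have m1: "(\<lambda>z. ennreal (cmod (f z) powr q) * indicator unit_disc z) \<in> borel_measurable lborel"
    using measurable_holomorphic_powr[OF assms(1,3)] by simp
  have m2: "(\<lambda>z. ennreal (cmod (h z) powr q) * indicator unit_disc z) \<in> borel_measurable lborel"
    using measurable_holomorphic_powr[OF assms(2,3)] by simp
  have "dint (\<lambda>z. cmod (u z) powr q)
      \<le> (\<integral>\<^sup>+z. ennreal (2 powr q) * (ennreal (cmod (f z) powr q) * indicator unit_disc z
          + ennreal (cmod (h z) powr q) * indicator unit_disc z) \<partial>lborel)"
  proof (intro nn_integral_mono)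
    fix z
    show "ennreal (cmod (u z) powr q) * indicator unit_disc z
      \<le> ennreal (2 powr q) * (ennreal (cmod (f z) powr q) * indicator unit_disc z
          + ennreal (cmod (h z) powr q) * indicator unit_disc z)"
    proof (cases "cmod z < 1")
      case True
      have "cmod (u z) powr q \<le> (cmod (f z) + cmod (h z)) powr q"
        using assms True by (intro powr_mono2) auto
      also have "\<dots> \<le> 2 powr q * (cmod (f z) powr q + cmod (h z) powr q)"
        using assms by (intro power_add_le_powr) auto
      finally have "ennreal (cmod (u z) powr q) \<le> ennreal (2 powr q * (cmod (f z) powr q + cmod (h z) powr q))"
        by (rule ennreal_leI)
      then show ?thesis using True by (simp add: ennreal_mult)
    qed simp
  qed
  also have "\<dots> = ennreal (2 powr q) * (\<integral>\<^sup>+z. (ennreal (cmod (f z) powr q) * indicator unit_disc z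
          + ennreal (cmod (h z) powr q) * indicator unit_disc z) \<partial>lborel)"
    by (intro nn_integral_cmult borel_measurable_add m1 m2)
  also have "(\<integral>\<^sup>+z. (ennreal (cmod (f z) powr q) * indicator unit_disc z
          + ennreal (cmod (h z) powr q) * indicator unit_disc z) \<partial>lborel)
      = dint (\<lambda>z. cmod (f z) powr q)
        + dint (\<lambda>z. cmod (h z) powr q)"
    by (rule nn_integral_add[OF m1 m2])
  finally show ?thesis .
qed

text \<open>A quasi-triangle inequality for the q-th powers, valid below exponent 1 too; it is
  stated for a pointwise majorant so that sums and differences are covered alike.\<close>

lemma Bergman_norm_triangle:
  assumes "f \<in> Bergman q" "h \<in> Bergman q" "u \<in> Bergman q" "q > 0"
    and "\<And>z. cmod z < 1 \<Longrightarrow> cmod (u z) \<le> cmod (f z) + cmod (h z)"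
  shows "Bergman_norm q u powr q \<le> 2 powr q * (Bergman_norm q f powr q + Bergman_norm q h powr q)"
proof -
  have "dint (\<lambda>z. cmod (u z) powr q)
    \<le> ennreal (2 powr q) * (dint (\<lambda>z. cmod (f z) powr q)
        + dint (\<lambda>z. cmod (h z) powr q))"
    using assms by (intro nn_integral_powr_combination_le) (auto simp: Bergman_def)
  then have "ennreal (pi * Bergman_norm q u powr q)
      \<le> ennreal (2 powr q * (pi * Bergman_norm q f powr q + pi * Bergman_norm q h powr q))"
    unfolding nn_integral_Bergman_norm[OF assms(1,4)] nn_integral_Bergman_norm[OF assms(2,4)]
      nn_integral_Bergman_norm[OF assms(3,4)]
    by (simp add: ennreal_mult)
  then have "pi * Bergman_norm q u powr q
      \<le> 2 powr q * (pi * Bergman_norm q f powr q + pi * Bergman_norm q h powr q)"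
    by (subst (asm) ennreal_le_iff) auto
  then have "pi * Bergman_norm q u powr q
      \<le> pi * (2 powr q * (Bergman_norm q f powr q + Bergman_norm q h powr q))"
    by (simp add: algebra_simps)
  then show ?thesis by simp
qed

lemma Bergman_scale:
  assumes "f \<in> Bergman p" "p > 0"
  shows "(\<lambda>z. c * f z) \<in> Bergman p" "Bergman_norm p (\<lambda>z. c * f z) = cmod c * Bergman_norm p f"
proof -
  have hol: "f holomorphic_on unit_disc" using assms by (simp add: Bergman_def)
  have "dint (\<lambda>z. cmod (c * f z) powr p)
      = (\<integral>\<^sup>+z. ennreal (cmod c powr p) * (ennreal (cmod (f z) powr p) * indicator unit_disc z) \<partial>lborel)"
    by (intro nn_integral_cong) (auto simp: norm_mult powr_mult ennreal_mult split: split_indicator)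
  also have "\<dots> = ennreal (cmod c powr p) * dint (\<lambda>z. cmod (f z) powr p)"
    using measurable_holomorphic_powr[OF hol assms(2)] by (intro nn_integral_cmult) simp
  also have "\<dots> = ennreal (pi * (cmod c powr p * Bergman_norm p f powr p))"
    unfolding nn_integral_Bergman_norm[OF assms] by (simp add: ennreal_mult mult_ac)
  finally have eq: "dint (\<lambda>z. cmod (c * f z) powr p)
      = ennreal (pi * (cmod c powr p * Bergman_norm p f powr p))" .
  then show mem: "(\<lambda>z. c * f z) \<in> Bergman p"
    using hol unfolding Bergman_iff by (auto intro: holomorphic_intros)
  have "pi * Bergman_norm p (\<lambda>z. c * f z) powr p = pi * (cmod c powr p * Bergman_norm p f powr p)"
    using eq unfolding nn_integral_Bergman_norm[OF mem assms(2)] by (subst (asm) ennreal_inj) auto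
  then have "Bergman_norm p (\<lambda>z. c * f z) powr p = (cmod c * Bergman_norm p f) powr p"
    by (simp add: powr_mult Bergman_norm_nonneg)
  then have "(Bergman_norm p (\<lambda>z. c * f z) powr p) powr (1 / p) = ((cmod c * Bergman_norm p f) powr p) powr (1 / p)"
    by simp
  then show "Bergman_norm p (\<lambda>z. c * f z) = cmod c * Bergman_norm p f"
    using assms(2) by (simp add: powr_powr Bergman_norm_nonneg)
qed

text \<open>An unbounded operator admits arguments of norm at most 1 whose images have norm at least
  \<open>j\<close>. A convergent subsequence of images would be bounded.\<close>

theorem compact_imp_bounded_op:
  assumes comp: "compact_op p q (Ig n g)" and g: "\<forall>k<n. g k holomorphic_on unit_disc"
    and p: "p > 0" and q: "q > 0"
  shows "bounded_op p q (Ig n g)"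
proof (rule ccontr)
  let ?T = "Ig n g"
  have T: "\<And>f. f \<in> Bergman p \<Longrightarrow> ?T f \<in> Bergman q" using comp by (simp add: compact_op_def)
  assume "\<not> bounded_op p q ?T"
  then have "\<forall>C. \<exists>f\<in>Bergman p. C * Bergman_norm p f < Bergman_norm q (?T f)"
    using T by (auto simp: bounded_op_def not_le)
  then have "\<forall>j::nat. \<exists>f\<in>Bergman p. real j * Bergman_norm p f < Bergman_norm q (?T f)" by blast
  then obtain f where f: "\<And>j. f j \<in> Bergman p" "\<And>j. real j * Bergman_norm p (f j) < Bergman_norm q (?T (f j))"
    by metis
  \<comment> \<open>An argument of norm zero is scaled through its image, so no appeal to
    definiteness of the norm is made.\<close>
  define c where "c = (\<lambda>j. if Bergman_norm p (f j) > 0 then 1 / Bergman_norm p (f j)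
      else real j / Bergman_norm q (?T (f j)))"
  have pos: "Bergman_norm q (?T (f j)) > 0" for j
    using f(2)[of j] Bergman_norm_nonneg[of p "f j"] by (meson le_less_trans mult_nonneg_nonneg of_nat_0_le_iff)
  have c0: "c j \<ge> 0" for j using pos[of j] by (auto simp: c_def)
  have c1: "c j * Bergman_norm p (f j) \<le> 1" for j
    using Bergman_norm_nonneg[of p "f j"] by (auto simp: c_def)
  have c2: "real j \<le> c j * Bergman_norm q (?T (f j))" for j
  proof (cases "Bergman_norm p (f j) > 0")
    case True
    then show ?thesis using f(2)[of j] by (simp add: c_def field_simps)
  next
    case False
    then show ?thesis using pos[of j] by (simp add: c_def)
  qed
  define F where "F = (\<lambda>j z. of_real (c j) * f j z)"
  have F: "F j \<in> Bergman p" "Bergman_norm p (F j) \<le> 1" for j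
    unfolding F_def using Bergman_scale[OF f(1) p] c0 c1 by auto
  have TF: "real j \<le> Bergman_norm q (?T (F j))" for j
  proof -
    have hol: "f j holomorphic_on unit_disc" using f by (simp add: Bergman_def)
    have eqF: "?T (F j) z = of_real (c j) * ?T (f j) z" if "cmod z < 1" for z
      using Ig_linear[OF hol hol g that, of "of_real (c j)" 0] by (simp add: F_def)
    have "Bergman_norm q (?T (F j)) = Bergman_norm q (\<lambda>z. of_real (c j) * ?T (f j) z)"
      by (rule Bergman_norm_cong) (simp add: eqF)
    also have "\<dots> = c j * Bergman_norm q (?T (f j))"
      using Bergman_scale(2)[OF T[OF f(1)] q] c0 by simp
    finally show ?thesis using c2 by simp
  qed
  have "\<exists>r h. strict_mono r \<and> h \<in> Bergman q \<and> (\<lambda>j. Bergman_norm q (\<lambda>z. ?T (F (r j)) z - h z)) \<longlonglongrightarrow> 0"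
    using comp F unfolding compact_op_def by blast
  then obtain r :: "nat \<Rightarrow> nat" and h where r: "strict_mono r" and h: "h \<in> Bergman q"
    and lim: "(\<lambda>j. Bergman_norm q (\<lambda>z. ?T (F (r j)) z - h z)) \<longlonglongrightarrow> 0"
    by blast
  \<comment> \<open>Bounds the q-th powers of the image norms as soon as the images are within
    distance 1 of \<open>h\<close>.\<close>
  define R where "R = 2 powr q * (1 + Bergman_norm q h powr q)"
  have "\<forall>\<^sub>F j in sequentially. Bergman_norm q (\<lambda>z. ?T (F (r j)) z - h z) < 1"
    using order_tendstoD(2)[OF lim, of 1] by simp
  moreover have "\<forall>\<^sub>F j in sequentially. R powr (1 / q) < real j"
  proof -
    obtain k :: nat where "R powr (1 / q) < real k" using reals_Archimedean2 by blast
    then show ?thesis unfolding eventually_sequentially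
      by (intro exI[of _ k]) (auto intro: less_le_trans)
  qed
  ultimately have "\<forall>\<^sub>F j in sequentially. False"
  proof eventually_elim
    case (elim j)
    let ?d = "\<lambda>z. ?T (F (r j)) z - h z"
    have Tr: "?T (F (r j)) \<in> Bergman q" by (intro T F)
    have d: "?d \<in> Bergman q"
    proof -
      have hol: "?T (F (r j)) holomorphic_on unit_disc" "h holomorphic_on unit_disc"
        using Tr h by (auto simp: Bergman_def)
      have "dint (\<lambda>z. cmod (?d z) powr q)
        \<le> ennreal (2 powr q) * (dint (\<lambda>z. cmod (?T (F (r j)) z) powr q)
        + dint (\<lambda>z. cmod (h z) powr q))"
        using hol q by (intro nn_integral_powr_combination_le norm_triangle_ineq4)
      also have "\<dots> < \<infinity>" using Tr h by (simp add: Bergman_iff ennreal_mult_less_top)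
      finally show ?thesis unfolding Bergman_iff using hol by (auto intro: holomorphic_intros)
    qed
    have "Bergman_norm q (?T (F (r j))) powr q \<le> 2 powr q * (Bergman_norm q ?d powr q + Bergman_norm q h powr q)"
    proof (rule Bergman_norm_triangle[OF d h Tr q])
      show "cmod (?T (F (r j)) z) \<le> cmod (?d z) + cmod (h z)" for z
        using norm_triangle_ineq[of "?d z" "h z"] by simp
    qed
    also have "\<dots> \<le> R"
    proof -
      have "Bergman_norm q ?d powr q \<le> 1 powr q"
        using elim q Bergman_norm_nonneg by (intro powr_mono2) auto
      then show ?thesis unfolding R_def by (intro mult_left_mono) auto
    qed
    finally have le: "Bergman_norm q (?T (F (r j))) powr q \<le> R" .
    have "real j \<le> real (r j)" using seq_suble[OF r] by simp
    also have "\<dots> \<le> Bergman_norm q (?T (F (r j)))" by (rule TF)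
    finally have "real j powr q \<le> R" using q le by (meson powr_mono2 of_nat_0_le_iff less_imp_le order.trans)
    then have "(real j powr q) powr (1 / q) \<le> R powr (1 / q)" using q by (intro powr_mono2) auto
    then have "real j \<le> R powr (1 / q)" using q by (simp add: powr_powr)
    then show False using elim by simp
  qed
  then show False by simp
qed

section \<open>Sufficiency of the integrability condition\<close>

context
  fixes n :: nat and g :: "nat \<Rightarrow> complex \<Rightarrow> complex" and p q s :: real
  assumes g: "\<forall>k<n. g k holomorphic_on unit_disc" and pq: "0 < q" "q < p" and s_def: "s = p * q / (p - q)"
    and fin: "\<forall>k<n. dint (\<lambda>z. (cmod (g k z) * bd z ^ (n - k)) powr s) < \<infinity>"
begin

text \<open>The weight \<open>bd z ^ n\<close> left by n integrations is shared: n - k powers go to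
  the coefficient \<open>g k\<close>, and k to the k-th derivative, where
  \<open>weighted_deriv_le\<close> needs them.\<close>

private definition "y k z = cmod (g k z) * bd z ^ (n - k)"
private definition "x f k z = cmod ((deriv ^^ k) f z) * bd z ^ k"
text \<open>The remainder in \<open>young_min\<close>; its majorant \<open>K * y k z powr s\<close>
  is integrable by assumption and does not involve \<open>f\<close>.\<close>

private definition "m K f k z = ennreal (min (x f k z powr q * y k z powr q) (K * y k z powr s))"

private lemma p: "p > 0" and s: "s > 0"
  using pq by (auto simp: s_def)

private lemma cont_y: "k < n \<Longrightarrow> e > 0 \<Longrightarrow> continuous_on unit_disc (\<lambda>z. y k z powr e)"
  unfolding y_def using g by (intro continuous_on_weighted_powr) auto

private lemma cont_x: "f holomorphic_on unit_disc \<Longrightarrow> e > 0 \<Longrightarrow> continuous_on unit_disc (\<lambda>z. x f k z powr e)"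
  unfolding x_def by (intro continuous_on_weighted_powr holomorphic_higher_deriv) auto

private lemma meas_m:
  assumes "f holomorphic_on unit_disc" "k < n"
  shows "(\<lambda>z. m K f k z * indicator unit_disc z) \<in> borel_measurable lborel"
proof -
  have "continuous_on unit_disc (\<lambda>z. min (x f k z powr q * y k z powr q) (K * y k z powr s))"
    using assms pq s by (intro continuous_intros cont_x cont_y) auto
  from measurable_ennreal_indicator_continuous[OF this borel_unit_disc] show ?thesis by (simp add: m_def)
qed

private lemma meas_y: "k < n \<Longrightarrow> (\<lambda>z. ennreal (y k z powr s) * indicator unit_disc z) \<in> borel_measurable lborel"
  using measurable_ennreal_indicator_continuous[OF cont_y[OF _ s] borel_unit_disc] by simp

private lemma meas_x: "f holomorphic_on unit_disc \<Longrightarrow>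
    (\<lambda>z. ennreal (x f k z powr p) * indicator unit_disc z) \<in> borel_measurable lborel"
  using measurable_ennreal_indicator_continuous[OF cont_x[OF _ p] borel_unit_disc] by simp

private definition "H K f = (\<integral>\<^sup>+z. (\<Sum>k<n. m K f k z * indicator unit_disc z) \<partial>lborel)"

text \<open>The order of the quantifiers is essential: \<open>A\<close> is fixed before \<eta>, so
  the first term can be made small uniformly on bounded sets of \<open>f\<close>, and only
  \<open>K\<close> in the second term reacts to \<eta>.\<close>

lemma Ig_integral_split:
  "\<exists>A>0. \<forall>\<eta>>0. \<exists>K>0. \<forall>f. f holomorphic_on unit_disc \<longrightarrow>
    dint (\<lambda>z. cmod (Ig n g f z) powr q)
      \<le> ennreal A * (ennreal \<eta> * dint (\<lambda>z. cmod (f z) powr p) + H K f)"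
proof -
  obtain C0 where C0: "C0 > 0" and lp: "\<And>h. h holomorphic_on unit_disc \<Longrightarrow>
    dint (\<lambda>z. cmod ((Iop ^^ n) h z) powr q * bd z powr 0)
      \<le> ennreal C0 * dint (\<lambda>z. cmod (h z) powr q * bd z powr (0 + real n * q))"
    using funpow_Iop_integral_le[OF pq(1), of 0 n] by auto
  define P where "P = (\<lambda>k C. C > 0 \<and> (\<forall>f. f holomorphic_on unit_disc \<longrightarrow>
    dint (\<lambda>z. x f k z powr p)
      \<le> ennreal C * dint (\<lambda>z. cmod (f z) powr p)))"
  have "\<forall>k. \<exists>C. P k C" unfolding P_def x_def using weighted_deriv_le[OF p] by simp
  from choice[OF this] obtain c where "\<forall>k. P k (c k)" by (elim exE)
  then have c: "c k > 0" "f holomorphic_on unit_disc \<Longrightarrow>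
    dint (\<lambda>z. x f k z powr p)
      \<le> ennreal (c k) * dint (\<lambda>z. cmod (f z) powr p)" for k f
    unfolding P_def by simp_all
  define S where "S = (\<Sum>k<n. c k)"
  have S: "S \<ge> 0" unfolding S_def by (intro sum_nonneg less_imp_le c)
  \<comment> \<open>The added ones keep \<open>A\<close> positive even for empty sums.\<close>
  define A where "A = C0 * (real n powr q + 1) * (1 + S)"
  have A: "A > 0" using C0 S by (auto simp: A_def add_nonneg_pos add_pos_nonneg)
  have "\<exists>K>0. \<forall>f. f holomorphic_on unit_disc \<longrightarrow>
    dint (\<lambda>z. cmod (Ig n g f z) powr q)
      \<le> ennreal A * (ennreal \<eta> * dint (\<lambda>z. cmod (f z) powr p) + H K f)"
    if \<eta>: "\<eta> > 0" for \<eta>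
  proof -
    obtain K where K: "K > 0" and young: "\<And>x y. x \<ge> 0 \<Longrightarrow> y \<ge> 0 \<Longrightarrow> x powr q * y powr q
      \<le> \<eta> * x powr p + min (x powr q * y powr q) (K * y powr s)"
      using young_min[OF pq \<eta>] unfolding s_def by blast
    have "dint (\<lambda>z. cmod (Ig n g f z) powr q)
      \<le> ennreal A * (ennreal \<eta> * dint (\<lambda>z. cmod (f z) powr p) + H K f)"
      if f: "f holomorphic_on unit_disc" for f
    proof -
      define h where "h = (\<lambda>z. \<Sum>k<n. (deriv ^^ k) f z * g k z)"
      define L where "L = real n powr q"
      define N where "N = dint (\<lambda>z. cmod (f z) powr p)"
      have pt: "ennreal (cmod (h z) powr q * bd z powr (0 + real n * q)) * indicator unit_disc z
          \<le> ennreal L * (ennreal \<eta> * (\<Sum>k<n. ennreal (x f k z powr p) * indicator unit_disc z)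
              + (\<Sum>k<n. m K f k z * indicator unit_disc z))" for z
      proof (cases "cmod z < 1")
        case True
        have xy: "x f k z \<ge> 0" "y k z \<ge> 0" for k using True by (auto simp: x_def y_def)
        have "cmod (h z) * bd z ^ n \<le> (\<Sum>k<n. cmod ((deriv ^^ k) f z * g k z)) * bd z ^ n"
          unfolding h_def using True by (intro mult_right_mono norm_sum) auto
        also have "\<dots> = (\<Sum>k<n. x f k z * y k z)"
          unfolding sum_distrib_right
        proof (intro sum.cong refl)
          fix k assume "k \<in> {..<n}"
          then have "bd z ^ n = bd z ^ k * bd z ^ (n - k)" by (simp add: power_add[symmetric])
          then show "cmod ((deriv ^^ k) f z * g k z) * bd z ^ n = x f k z * y k z"
            by (simp add: x_def y_def norm_mult)
        qed
        finally have "(cmod (h z) * bd z ^ n) powr q \<le> (\<Sum>k<n. x f k z * y k z) powr q"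
          using True pq by (intro powr_mono2) auto
        also have "\<dots> \<le> real (card {..<n}) powr q * (\<Sum>k<n. (x f k z * y k z) powr q)"
          using xy pq by (intro powr_sum_le) auto
        also have "\<dots> = L * (\<Sum>k<n. x f k z powr q * y k z powr q)" by (simp add: L_def powr_mult)
        also have "\<dots> \<le> L * (\<Sum>k<n. \<eta> * x f k z powr p + min (x f k z powr q * y k z powr q) (K * y k z powr s))"
          using xy by (intro mult_left_mono sum_mono young) (auto simp: L_def)
        also have "\<dots> = L * (\<eta> * (\<Sum>k<n. x f k z powr p) + (\<Sum>k<n. min (x f k z powr q * y k z powr q) (K * y k z powr s)))"
          by (simp add: sum.distrib sum_distrib_left)
        also have "(cmod (h z) * bd z ^ n) powr q = cmod (h z) powr q * bd z powr (0 + real n * q)"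
          using True by (simp add: powr_mult powr_realpow[symmetric] powr_powr)
        finally have "ennreal (cmod (h z) powr q * bd z powr (0 + real n * q))
            \<le> ennreal (L * (\<eta> * (\<Sum>k<n. x f k z powr p) + (\<Sum>k<n. min (x f k z powr q * y k z powr q) (K * y k z powr s))))"
          by (rule ennreal_leI)
        also have "\<dots> = ennreal L * (ennreal \<eta> * ennreal (\<Sum>k<n. x f k z powr p) + ennreal (\<Sum>k<n. min (x f k z powr q * y k z powr q) (K * y k z powr s)))"
          using \<eta> K by (simp add: ennreal_mult L_def sum_nonneg)
        also have "ennreal (\<Sum>k<n. x f k z powr p) = (\<Sum>k<n. ennreal (x f k z powr p) * indicator unit_disc z)"
          using True by (subst sum_ennreal[symmetric]) (auto simp del: sum_ennreal)
        also have "ennreal (\<Sum>k<n. min (x f k z powr q * y k z powr q) (K * y k z powr s)) = (\<Sum>k<n. m K f k z * indicator unit_disc z)"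
          unfolding m_def using True K by (subst sum_ennreal[symmetric]) (auto simp del: sum_ennreal)
        finally show ?thesis using True by simp
      qed simp
      have "dint (\<lambda>z. cmod (Ig n g f z) powr q)
          = dint (\<lambda>z. cmod ((Iop ^^ n) h z) powr q * bd z powr 0)"
        by (intro nn_integral_cong) (auto simp: Ig_def h_def split: split_indicator)
      also have "\<dots> \<le> ennreal C0 * dint (\<lambda>z. cmod (h z) powr q * bd z powr (0 + real n * q))"
        unfolding h_def by (rule lp[OF holomorphic_Ig_integrand[OF f g]])
      also have "\<dots> \<le> ennreal C0 * (\<integral>\<^sup>+z. ennreal L * (ennreal \<eta> * (\<Sum>k<n. ennreal (x f k z powr p) * indicator unit_disc z)
              + (\<Sum>k<n. m K f k z * indicator unit_disc z)) \<partial>lborel)"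
        by (intro mult_left_mono nn_integral_mono pt) auto
      also have "(\<integral>\<^sup>+z. ennreal L * (ennreal \<eta> * (\<Sum>k<n. ennreal (x f k z powr p) * indicator unit_disc z)
              + (\<Sum>k<n. m K f k z * indicator unit_disc z)) \<partial>lborel)
          = ennreal L * (\<integral>\<^sup>+z. ennreal \<eta> * (\<Sum>k<n. ennreal (x f k z powr p) * indicator unit_disc z)
              + (\<Sum>k<n. m K f k z * indicator unit_disc z) \<partial>lborel)"
        by (intro nn_integral_cmult borel_measurable_add borel_measurable_times_ennreal borel_measurable_const
              borel_measurable_sum meas_x meas_m f) auto
      also have "(\<integral>\<^sup>+z. ennreal \<eta> * (\<Sum>k<n. ennreal (x f k z powr p) * indicator unit_disc z)
              + (\<Sum>k<n. m K f k z * indicator unit_disc z) \<partial>lborel)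
          = (\<integral>\<^sup>+z. ennreal \<eta> * (\<Sum>k<n. ennreal (x f k z powr p) * indicator unit_disc z) \<partial>lborel) + H K f"
        unfolding H_def
        by (intro nn_integral_add borel_measurable_times_ennreal borel_measurable_const
              borel_measurable_sum meas_x meas_m f) auto
      also have "(\<integral>\<^sup>+z. ennreal \<eta> * (\<Sum>k<n. ennreal (x f k z powr p) * indicator unit_disc z) \<partial>lborel)
          = ennreal \<eta> * (\<Sum>k<n. \<integral>\<^sup>+z\<in>unit_disc. ennreal (x f k z powr p) \<partial>lborel)"
        by (subst nn_integral_cmult, intro borel_measurable_sum meas_x f)
           (subst nn_integral_sum[OF meas_x[OF f]], rule refl)
      also have "(\<Sum>k<n. \<integral>\<^sup>+z\<in>unit_disc. ennreal (x f k z powr p) \<partial>lborel) \<le> (\<Sum>k<n. ennreal (c k) * N)"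
        unfolding N_def by (intro sum_mono c f)
      also have "\<dots> = ennreal S * N"
        unfolding S_def using c(1) by (subst sum_ennreal[symmetric]) (auto simp: sum_distrib_right less_imp_le simp del: sum_ennreal)
      also have "ennreal C0 * (ennreal L * (ennreal \<eta> * (ennreal S * N) + H K f))
          \<le> ennreal C0 * (ennreal (L + 1) * (ennreal (1 + S) * (ennreal \<eta> * N + H K f)))"
      proof (intro mult_left_mono mult_mono)
        have "ennreal \<eta> * (ennreal S * N) = ennreal S * (ennreal \<eta> * N)" by (simp only: mult_ac)
        also have "\<dots> \<le> ennreal (1 + S) * (ennreal \<eta> * N)" by (intro mult_right_mono ennreal_leI) auto
        finally have 1: "ennreal \<eta> * (ennreal S * N) \<le> ennreal (1 + S) * (ennreal \<eta> * N)" .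
        have "ennreal 1 * H K f \<le> ennreal (1 + S) * H K f" using S by (intro mult_right_mono ennreal_leI) auto
        then have "H K f \<le> ennreal (1 + S) * H K f" by simp
        then show "ennreal \<eta> * (ennreal S * N) + H K f \<le> ennreal (1 + S) * (ennreal \<eta> * N + H K f)"
          using 1 by (simp add: distrib_left add_mono)
      qed (auto intro: ennreal_leI)
      also have "\<dots> = ennreal A * (ennreal \<eta> * N + H K f)"
        using C0 S by (simp add: A_def L_def ennreal_mult mult.assoc del: ennreal_plus)
      finally show ?thesis by (simp add: N_def add_left_mono add_right_mono mult_left_mono)
    qed
    then show ?thesis using K by blast
  qed
  then show ?thesis using A by blast
qed

private lemma dominating_finite:
  "(\<integral>\<^sup>+z. (\<Sum>k<n. ennreal K * (ennreal (y k z powr s) * indicator unit_disc z)) \<partial>lborel) < \<infinity>"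
proof -
  have "(\<integral>\<^sup>+z. (\<Sum>k<n. ennreal K * (ennreal (y k z powr s) * indicator unit_disc z)) \<partial>lborel)
      = (\<Sum>k<n. ennreal K * dint (\<lambda>z. y k z powr s))"
    using meas_y by (subst nn_integral_sum) (auto intro!: sum.cong nn_integral_cmult)
  also have "\<dots> < \<infinity>" using fin by (auto simp: y_def ennreal_mult_less_top)
  finally show ?thesis .
qed

private lemma m_le: "m K f k z * indicator unit_disc z \<le> ennreal K * (ennreal (y k z powr s) * indicator unit_disc z)"
  if "K \<ge> 0"
  using that by (auto simp: m_def ennreal_mult[symmetric] split: split_indicator intro!: ennreal_leI)

private lemma H_finite:
  assumes "K \<ge> 0" shows "H K f < \<infinity>"
proof -
  have "H K f \<le> (\<integral>\<^sup>+z. (\<Sum>k<n. ennreal K * (ennreal (y k z powr s) * indicator unit_disc z)) \<partial>lborel)"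
    unfolding H_def using assms by (intro nn_integral_mono sum_mono m_le)
  also have "\<dots> < \<infinity>" by (rule dominating_finite)
  finally show ?thesis .
qed

lemma Ig_maps_Bergman:
  assumes "f \<in> Bergman p" shows "Ig n g f \<in> Bergman q"
proof -
  have f: "f holomorphic_on unit_disc" using assms by (simp add: Bergman_def)
  obtain A K where "K > 0" and le: "dint (\<lambda>z. cmod (Ig n g f z) powr q)
      \<le> ennreal A * (ennreal 1 * dint (\<lambda>z. cmod (f z) powr p) + H K f)"
    using Ig_integral_split f zero_less_one by blast
  have "ennreal A * (ennreal 1 * dint (\<lambda>z. cmod (f z) powr p) + H K f) < \<infinity>"
    using assms H_finite[of K f] \<open>K > 0\<close> by (auto simp: Bergman_iff ennreal_mult_less_top)
  then show ?thesis using le Ig_properties(1)[OF f g] unfolding Bergman_iff by (auto intro: le_less_trans)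
qed

text \<open>Pointwise convergence of all derivatives suffices: \<open>H K\<close> tends to 0 by
  dominated convergence for each fixed \<open>K\<close>, and the other term is small because the
  p-integrals are bounded.\<close>

lemma Ig_integral_tendsto_0:
  assumes hol: "\<And>j. G j holomorphic_on unit_disc"
    and bound: "\<And>j. dint (\<lambda>z. cmod (G j z) powr p) \<le> ennreal B" and B: "B > 0"
    and lim: "\<And>k z. cmod z < 1 \<Longrightarrow> (\<lambda>j. (deriv ^^ k) (G j) z) \<longlonglongrightarrow> 0"
  shows "(\<lambda>j. \<integral>\<^sup>+z\<in>unit_disc. ennreal (cmod (Ig n g (G j) z) powr q) \<partial>lborel) \<longlonglongrightarrow> 0"
proof -
  obtain A where A: "A > 0" and split: "\<And>\<eta>. \<eta> > 0 \<Longrightarrow> \<exists>K>0. \<forall>f. f holomorphic_on unit_disc \<longrightarrow>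
    dint (\<lambda>z. cmod (Ig n g f z) powr q)
      \<le> ennreal A * (ennreal \<eta> * dint (\<lambda>z. cmod (f z) powr p) + H K f)"
    using Ig_integral_split by blast
  have H0: "(\<lambda>j. H K (G j)) \<longlonglongrightarrow> 0" if K: "K > 0" for K
  proof -
    have "(\<lambda>j. \<integral>\<^sup>+z. (\<Sum>k<n. m K (G j) k z * indicator unit_disc z) \<partial>lborel) \<longlonglongrightarrow> (\<integral>\<^sup>+(z::complex). 0 \<partial>lborel)"
    proof (rule nn_integral_dominated_convergence[OF _ _ _ _ dominating_finite[of K]])
      show "(\<lambda>z. \<Sum>k<n. ennreal K * (ennreal (y k z powr s) * indicator unit_disc z)) \<in> borel_measurable lborel"
        by (intro borel_measurable_sum borel_measurable_times_ennreal borel_measurable_const meas_y) auto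
      show "(\<lambda>z. \<Sum>k<n. m K (G j) k z * indicator unit_disc z) \<in> borel_measurable lborel" for j
        by (intro borel_measurable_sum meas_m hol) auto
      show "AE z in lborel. (\<Sum>k<n. m K (G j) k z * indicator unit_disc z)
          \<le> (\<Sum>k<n. ennreal K * (ennreal (y k z powr s) * indicator unit_disc z))" for j
        using K by (intro AE_I2 sum_mono m_le) auto
      have "(\<lambda>j. \<Sum>k<n. m K (G j) k z * indicator unit_disc z) \<longlonglongrightarrow> 0" for z
      proof (cases "cmod z < 1")
        case True
        have "(\<lambda>j. m K (G j) k z) \<longlonglongrightarrow> 0" for k
        proof -
          have "(\<lambda>j. x (G j) k z) \<longlonglongrightarrow> 0"
            unfolding x_def using tendsto_mult_left_zero[OF tendsto_norm_zero[OF lim[OF True]]] by simp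
          then have "(\<lambda>j. x (G j) k z powr q) \<longlonglongrightarrow> 0"
            using pq True by (intro tendsto_zero_powrI[OF _ tendsto_const]) (auto simp: x_def)
          then have "(\<lambda>j. x (G j) k z powr q * y k z powr q) \<longlonglongrightarrow> 0" by (rule tendsto_mult_left_zero)
          then have "(\<lambda>j. min (x (G j) k z powr q * y k z powr q) (K * y k z powr s)) \<longlonglongrightarrow> min 0 (K * y k z powr s)"
            by (intro tendsto_min tendsto_const)
          then have "(\<lambda>j. ennreal (min (x (G j) k z powr q * y k z powr q) (K * y k z powr s))) \<longlonglongrightarrow> ennreal 0"
            using K by (intro tendsto_ennrealI) simp
          then show ?thesis by (simp add: m_def)
        qed
        then have "(\<lambda>j. \<Sum>k<n. m K (G j) k z) \<longlonglongrightarrow> (\<Sum>k<n. 0)" by (intro tendsto_sum)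
        then show ?thesis using True by simp
      qed simp
      then show "AE z in lborel. (\<lambda>j. \<Sum>k<n. m K (G j) k z * indicator unit_disc z) \<longlonglongrightarrow> 0" by simp
    qed auto
    then show ?thesis by (simp add: H_def)
  qed
  show ?thesis
  proof (rule order_tendstoI)
    fix a :: ennreal assume a: "0 < a"
    obtain e where e: "e > 0" "ennreal e < a"
    proof (cases a)
      case (real r)
      then have "r / 2 > 0" "ennreal (r / 2) < a" using a by (auto simp: ennreal_lessI)
      then show ?thesis using that by blast
    next
      case top
      then show ?thesis using that[of 1] by simp
    qed
    \<comment> \<open>Chosen so that A \<eta> B is e / 2; the remainder \<open>H K\<close> takes the
      other half.\<close>
    define \<eta> where "\<eta> = e / (2 * A * B)"
    have \<eta>: "\<eta> > 0" using e A B by (simp add: \<eta>_def)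
    obtain K where K: "K > 0" and le: "\<And>f. f holomorphic_on unit_disc \<Longrightarrow>
      dint (\<lambda>z. cmod (Ig n g f z) powr q)
      \<le> ennreal A * (ennreal \<eta> * dint (\<lambda>z. cmod (f z) powr p) + H K f)"
      using split[OF \<eta>] by blast
    have "\<forall>\<^sub>F j in sequentially. H K (G j) < ennreal (e / (2 * A))"
      using order_tendstoD(2)[OF H0[OF K]] e A by simp
    then show "\<forall>\<^sub>F j in sequentially. dint (\<lambda>z. cmod (Ig n g (G j) z) powr q) < a"
    proof eventually_elim
      case (elim j)
      have "dint (\<lambda>z. cmod (Ig n g (G j) z) powr q)
          \<le> ennreal A * (ennreal \<eta> * dint (\<lambda>z. cmod (G j z) powr p) + H K (G j))"
        by (rule le[OF hol])
      also have "\<dots> \<le> ennreal A * (ennreal \<eta> * ennreal B + ennreal (e / (2 * A)))"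
        using elim by (intro mult_left_mono add_mono bound) auto
      also have "\<dots> = ennreal (A * (\<eta> * B + e / (2 * A)))"
        using A B \<eta> e by (simp add: ennreal_mult[symmetric] ennreal_plus[symmetric] del: ennreal_plus)
      also have "A * (\<eta> * B + e / (2 * A)) = e" using A B by (simp add: \<eta>_def field_simps)
      finally show ?case using e(2) by (rule le_less_trans)
    qed
  qed simp
qed

text \<open>A norm-bounded sequence is locally bounded by the local estimate, so Montel's theorem
  extracts a locally uniform limit \<open>h\<close>. The differences are bounded in
  \<open>Bergman p\<close>, and their derivatives tend to 0, so the images converge to
  \<open>Ig n g h\<close>.\<close>

theorem coefficient_integrable_imp_compact: "compact_op p q (Ig n g)"
  unfolding compact_op_def
proof (intro conjI ballI allI impI)
  show "Ig n g f \<in> Bergman q" if "f \<in> Bergman p" for f using that by (rule Ig_maps_Bergman)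
next
  fix F :: "nat \<Rightarrow> complex \<Rightarrow> complex"
  assume F: "\<forall>j. F j \<in> Bergman p" and "\<exists>M. \<forall>j. Bergman_norm p (F j) \<le> M"
  then obtain M where M: "\<And>j. Bergman_norm p (F j) \<le> M" by blast
  \<comment> \<open>The added 1 makes \<open>B\<close> positive even when \<open>M\<close> is
    0.\<close>
  define B where "B = pi * M powr p + 1"
  have B: "B > 0" by (simp add: B_def add_nonneg_pos)
  have holF: "F j holomorphic_on unit_disc" for j using F by (simp add: Bergman_def)
  have intF: "dint (\<lambda>z. cmod (F j z) powr p) \<le> ennreal B" for j
  proof -
    have "Bergman_norm p (F j) powr p \<le> M powr p"
      using M p Bergman_norm_nonneg by (intro powr_mono2) auto
    then have "pi * Bergman_norm p (F j) powr p \<le> pi * M powr p" by (intro mult_left_mono) auto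
    also have "\<dots> \<le> B" by (simp add: B_def)
    finally show ?thesis unfolding nn_integral_Bergman_norm[OF F[rule_format] p] by (rule ennreal_leI)
  qed
  obtain C where C: "C > 0" and sub: "\<And>f (a::complex) r. r > 0 \<Longrightarrow> f holomorphic_on ball a r \<Longrightarrow>
           ennreal (cmod (f a) powr p * r\<^sup>2)
             \<le> ennreal C * (\<integral>\<^sup>+z\<in>ball a r. ennreal (cmod (f z) powr p) \<partial>lborel)"
    using holomorphic_powr_local_bound[OF p] by blast
  have local_bd: "cmod (F j z) \<le> (C * B / (bd z)\<^sup>2) powr (1 / p)" if z: "cmod z < 1" for j z
  proof -
    have ball: "ball z (bd z) \<subseteq> unit_disc"
    proof
      fix w assume "w \<in> ball z (bd z)"
      then show "w \<in> unit_disc" using norm_triangle_ineq2[of w z] by (simp add: dist_norm norm_minus_commute)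
    qed
    have "ennreal (cmod (F j z) powr p * (bd z)\<^sup>2)
        \<le> ennreal C * (\<integral>\<^sup>+w\<in>ball z (bd z). ennreal (cmod (F j w) powr p) \<partial>lborel)"
      using z ball holF by (intro sub) (auto intro: holomorphic_on_subset)
    also have "\<dots> \<le> ennreal C * dint (\<lambda>w. cmod (F j w) powr p)"
      using ball by (intro mult_left_mono nn_integral_mono) (auto split: split_indicator)
    also have "\<dots> \<le> ennreal C * ennreal B" by (intro mult_left_mono intF) auto
    also have "\<dots> = ennreal (C * B)" using B C by (simp add: ennreal_mult)
    finally have "cmod (F j z) powr p * (bd z)\<^sup>2 \<le> C * B" using B C by (subst (asm) ennreal_le_iff) auto
    then have "cmod (F j z) powr p \<le> C * B / (bd z)\<^sup>2" using z by (simp add: field_simps)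
    then have "(cmod (F j z) powr p) powr (1 / p) \<le> (C * B / (bd z)\<^sup>2) powr (1 / p)"
      using p by (intro powr_mono2) auto
    then show ?thesis using p by (simp add: powr_powr)
  qed
  obtain h r where h: "h holomorphic_on unit_disc" and r: "strict_mono (r :: nat \<Rightarrow> nat)"
    and pw: "\<And>z. z \<in> unit_disc \<Longrightarrow> (\<lambda>j. F (r j) z) \<longlonglongrightarrow> h z"
    and uni: "\<And>K. compact K \<Longrightarrow> K \<subseteq> unit_disc \<Longrightarrow> uniform_limit K (F \<circ> r) h sequentially"
  proof (rule Montel[of unit_disc "range F" F])
    show "\<exists>B. \<forall>f\<in>range F. \<forall>z\<in>K. cmod (f z) \<le> B" if K: "compact K" "K \<subseteq> unit_disc" for K
    proof (cases "K = {}")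
      case False
      have "continuous_on K (\<lambda>z. (C * B / (bd z)\<^sup>2) powr (1 / p))"
        using K C B by (intro continuous_intros) auto
      then have "\<exists>w\<in>K. \<forall>z\<in>K. (C * B / (bd z)\<^sup>2) powr (1 / p) \<le> (C * B / (bd w)\<^sup>2) powr (1 / p)"
        by (rule continuous_attains_sup[OF K(1) False])
      then obtain w where "\<forall>z\<in>K. (C * B / (bd z)\<^sup>2) powr (1 / p) \<le> (C * B / (bd w)\<^sup>2) powr (1 / p)" by blast
      moreover have "cmod (F j z) \<le> (C * B / (bd z)\<^sup>2) powr (1 / p)" if "z \<in> K" for j z
        using that K(2) by (intro local_bd) auto
      ultimately have "\<forall>f\<in>range F. \<forall>z\<in>K. cmod (f z) \<le> (C * B / (bd w)\<^sup>2) powr (1 / p)"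
        by (fastforce intro: order.trans)
      then show ?thesis by blast
    qed simp
  qed (use holF in auto)
  \<comment> \<open>Fatou's lemma: the limit belongs to \<open>Bergman p\<close> with the same
    bound.\<close>
  have inth: "dint (\<lambda>z. cmod (h z) powr p) \<le> ennreal B"
  proof -
    have lim: "(\<lambda>j. ennreal (cmod (F (r j) z) powr p) * indicator unit_disc z) \<longlonglongrightarrow> ennreal (cmod (h z) powr p) * indicator unit_disc z" for z
    proof (cases "cmod z < 1")
      case True
      then have "(\<lambda>j. cmod (F (r j) z)) \<longlonglongrightarrow> cmod (h z)" using pw by (intro tendsto_norm) auto
      then have "(\<lambda>j. cmod (F (r j) z) powr p) \<longlonglongrightarrow> cmod (h z) powr p"
        using p by (intro tendsto_powr2 tendsto_const) auto
      then show ?thesis using True by (simp add: tendsto_ennrealI)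
    qed simp
    have "dint (\<lambda>z. cmod (h z) powr p)
        = (\<integral>\<^sup>+z. liminf (\<lambda>j. ennreal (cmod (F (r j) z) powr p) * indicator unit_disc z) \<partial>lborel)"
      using lim_imp_Liminf[OF _ lim] by (intro nn_integral_cong) simp
    also have "\<dots> \<le> liminf (\<lambda>j. \<integral>\<^sup>+z\<in>unit_disc. ennreal (cmod (F (r j) z) powr p) \<partial>lborel)"
      using measurable_holomorphic_powr[OF holF p] by (intro nn_integral_liminf) simp
    also have "\<dots> \<le> ennreal B"
      using intF by (intro Liminf_le) auto
    finally show ?thesis .
  qed
  have hB: "h \<in> Bergman p" using h inth by (auto simp: Bergman_iff intro: le_less_trans)
  \<comment> \<open>Written as a linear combination to match the form of
    \<open>Ig_linear\<close>.\<close>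
  define G where "G = (\<lambda>j z. 1 * F (r j) z + (- 1) * h z)"
  have holG: "G j holomorphic_on unit_disc" for j unfolding G_def by (intro holomorphic_intros holF h)
  \<comment> \<open>Uniform convergence on a disc about \<open>z\<close> carries over to all
    derivatives at \<open>z\<close>.\<close>
  have limG: "(\<lambda>j. (deriv ^^ k) (G j) z) \<longlonglongrightarrow> 0" if z: "cmod z < 1" for k z
  proof -
    define U where "U = ball z (bd z / 2)"
    have cb: "cball z (bd z / 2) \<subseteq> unit_disc"
    proof
      fix w assume "w \<in> cball z (bd z / 2)"
      then have "cmod (w - z) \<le> bd z / 2" by (simp add: dist_norm norm_minus_commute)
      then show "w \<in> unit_disc" using norm_triangle_ineq2[of w z] z by (simp add: field_simps)
    qed
    then have UD: "U \<subseteq> unit_disc" unfolding U_def using ball_subset_cball by blast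
    have "uniform_limit U (\<lambda>j. F (r j)) h sequentially"
      using uni[OF compact_cball cb] unfolding U_def comp_def by (rule uniform_limit_on_subset) auto
    then have "(\<lambda>j. (deriv ^^ k) (F (r j)) z) \<longlonglongrightarrow> (deriv ^^ k) h z"
    proof (rule higher_deriv_complex_uniform_limit)
      show "\<forall>\<^sub>F j in sequentially. F (r j) holomorphic_on U"
        using holomorphic_on_subset[OF holF UD] by (intro always_eventually allI)
    qed (use z in \<open>auto simp: U_def\<close>)
    then have "(\<lambda>j. (deriv ^^ k) (F (r j)) z - (deriv ^^ k) h z) \<longlonglongrightarrow> 0"
      by (simp add: LIM_zero)
    moreover have "(deriv ^^ k) (G j) z = (deriv ^^ k) (F (r j)) z - (deriv ^^ k) h z" for j
      unfolding G_def using higher_deriv_diff[OF holF h open_unit_disc, of z k] z by simp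
    ultimately show ?thesis by simp
  qed
  define B' where "B' = 2 powr p * (B + B)"
  have intG: "dint (\<lambda>z. cmod (G j z) powr p) \<le> ennreal B'" for j
  proof -
    have "dint (\<lambda>z. cmod (G j z) powr p)
      \<le> ennreal (2 powr p) * (dint (\<lambda>z. cmod (F (r j) z) powr p)
        + dint (\<lambda>z. cmod (h z) powr p))"
      using norm_triangle_ineq4 by (intro nn_integral_powr_combination_le holF h p) (auto simp: G_def)
    also have "\<dots> \<le> ennreal (2 powr p) * (ennreal B + ennreal B)"
      by (intro mult_left_mono add_mono intF inth) auto
    also have "\<dots> = ennreal B'"
    proof -
      have "ennreal (B + B) = ennreal B + ennreal B" using B by (intro ennreal_plus) auto
      then show ?thesis by (simp only: B'_def ennreal_mult'[OF powr_ge_zero])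
    qed
    finally show ?thesis .
  qed
  have X0: "(\<lambda>j. \<integral>\<^sup>+z\<in>unit_disc. ennreal (cmod (Ig n g (G j) z) powr q) \<partial>lborel) \<longlonglongrightarrow> 0"
    using B by (intro Ig_integral_tendsto_0[OF holG intG _ limG]) (auto simp: B'_def)
  have GB: "G j \<in> Bergman p" for j using holG intG[of j] by (auto simp: Bergman_iff intro: le_less_trans)
  have norm_eq: "Bergman_norm q (\<lambda>z. Ig n g (F (r j)) z - Ig n g h z) = Bergman_norm q (Ig n g (G j))" for j
    unfolding G_def using Ig_linear[OF holF h g, where c=1 and d="- 1"] by (intro Bergman_norm_cong) simp
  have "(\<lambda>j. enn2real (dint (\<lambda>z. cmod (Ig n g (G j) z) powr q))) \<longlonglongrightarrow> 0"
    using X0 by (intro tendsto_enn2real) simp_all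
  then have "(\<lambda>j. pi * Bergman_norm q (Ig n g (G j)) powr q) \<longlonglongrightarrow> 0"
    unfolding nn_integral_Bergman_norm[OF Ig_maps_Bergman[OF GB] pq(1)] by simp
  then have "(\<lambda>j. (1 / pi) * (pi * Bergman_norm q (Ig n g (G j)) powr q)) \<longlonglongrightarrow> 0"
    by (rule tendsto_mult_right_zero)
  then have "(\<lambda>j. Bergman_norm q (Ig n g (G j)) powr q) \<longlonglongrightarrow> 0" by simp
  then have "(\<lambda>j. (Bergman_norm q (Ig n g (G j)) powr q) powr (1 / q)) \<longlonglongrightarrow> 0"
    by (rule tendsto_zero_powrI[OF _ tendsto_const]) (use pq in auto)
  then have "(\<lambda>j. Bergman_norm q (Ig n g (G j))) \<longlonglongrightarrow> 0"
    using pq by (simp add: powr_powr Bergman_norm_nonneg)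
  then have "(\<lambda>j. Bergman_norm q (\<lambda>z. Ig n g (F (r j)) z - Ig n g h z)) \<longlonglongrightarrow> 0" by (simp add: norm_eq)
  then show "\<exists>r h. strict_mono r \<and> h \<in> Bergman q \<and>
      (\<lambda>j. Bergman_norm q (\<lambda>z. Ig n g (F (r j)) z - h z)) \<longlonglongrightarrow> 0"
    using r Ig_maps_Bergman[OF hB] by blast
qed

end

text \<open>1 - |z|^2 equals \<open>bd z * (1 + cmod z)\<close> and so lies between
  \<open>bd z\<close> and \<open>2 * bd z\<close>; the normalisation of the measure does not affect
  finiteness.\<close>

lemma disc_int_coefficient_iff:
  fixes s :: real
  assumes "s > 0" "f holomorphic_on unit_disc"
  shows "disc_int (\<lambda>z. cmod (f z * (1 - (cmod z)\<^sup>2) ^ N) powr s) < \<infinity> \<longleftrightarrow>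
    dint (\<lambda>z. (cmod (f z) * bd z ^ N) powr s) < \<infinity>"
proof -
  let ?u = "\<lambda>z. cmod (f z * (1 - (cmod z)\<^sup>2) ^ N) powr s"
  let ?v = "\<lambda>z. (cmod (f z) * bd z ^ N) powr s"
  have u: "?u z = (cmod (f z) * (1 - (cmod z)\<^sup>2) ^ N) powr s" if "cmod z < 1" for z
  proof -
    have "(1 - (complex_of_real (cmod z))\<^sup>2) = complex_of_real (1 - (cmod z)\<^sup>2)" by simp
    then have "cmod (1 - (complex_of_real (cmod z))\<^sup>2) = \<bar>1 - (cmod z)\<^sup>2\<bar>" by (simp only: norm_of_real)
    also have "\<dots> = 1 - (cmod z)\<^sup>2" using that by (simp add: power_le_one)
    finally show ?thesis by (simp add: norm_mult norm_power)
  qed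
  have fac: "1 - (cmod z)\<^sup>2 = bd z * (1 + cmod z)" for z by (simp add: power2_eq_square algebra_simps)
  have vu: "?v z \<le> ?u z" if z: "cmod z < 1" for z
    unfolding u[OF z] unfolding fac using z assms
    by (intro powr_mono2 mult_left_mono power_mono) (auto simp: mult_le_cancel_left1)
  have uv: "?u z \<le> (2 ^ N) powr s * ?v z" if z: "cmod z < 1" for z
  proof -
    have "?u z \<le> (cmod (f z) * (bd z * 2) ^ N) powr s"
      unfolding u[OF z] unfolding fac using z assms
      by (intro powr_mono2 mult_left_mono power_mono) (auto simp: zero_le_mult_iff)
    also have "\<dots> = (2 ^ N) powr s * ?v z" by (simp only: power_mult_distrib powr_mult mult_ac)
    finally show ?thesis .
  qed
  show ?thesis
    unfolding disc_int_finite_iff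
  proof
    assume "dint (\<lambda>z. ?u z) < \<infinity>"
    moreover have "dint (\<lambda>z. ?v z) \<le> dint (\<lambda>z. ?u z)"
      using vu by (intro nn_integral_mono) (auto split: split_indicator intro!: ennreal_leI)
    ultimately show "dint (\<lambda>z. ?v z) < \<infinity>" by (rule le_less_trans[rotated])
  next
    assume fin: "dint (\<lambda>z. ?v z) < \<infinity>"
    have meas: "(\<lambda>z. ennreal (?v z) * indicator unit_disc z) \<in> borel_measurable lborel"
      using measurable_ennreal_indicator_continuous[OF continuous_on_weighted_powr[OF assms(2,1)] borel_unit_disc]
      by simp
    have "dint (\<lambda>z. ?u z)
        \<le> (\<integral>\<^sup>+z. ennreal ((2 ^ N) powr s) * (ennreal (?v z) * indicator unit_disc z) \<partial>lborel)"
    proof (intro nn_integral_mono)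
      fix z
      show "ennreal (?u z) * indicator unit_disc z
          \<le> ennreal ((2 ^ N) powr s) * (ennreal (?v z) * indicator unit_disc z)"
      proof (cases "cmod z < 1")
        case True
        from ennreal_leI[OF uv[OF this]] show ?thesis using True by (simp add: ennreal_mult)
      qed simp
    qed
    also have "\<dots> = ennreal ((2 ^ N) powr s) * dint (\<lambda>z. ?v z)"
      by (rule nn_integral_cmult[OF meas])
    also have "\<dots> < \<infinity>" using fin by (simp add: ennreal_mult_less_top)
    finally show "dint (\<lambda>z. ?u z) < \<infinity>" .
  qed
qed

theorem theorem1p4:
  fixes n :: nat and g :: "nat \<Rightarrow> complex \<Rightarrow> complex" and p q :: real
  assumes "n > 0"
    and "\<forall>k<n. g k holomorphic_on unit_disc"
    and "0 < q" and "q < p"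
  shows "(bounded_op p q (Ig n g) \<longleftrightarrow> compact_op p q (Ig n g)) \<and>
         (compact_op p q (Ig n g) \<longleftrightarrow>
            (\<forall>k<n. disc_int (\<lambda>z. cmod (g k z * (1 - (cmod z)\<^sup>2) ^ (n - k)) powr (p * q / (p - q))) < \<infinity>))"
proof -
  define c where "c \<longleftrightarrow> (\<forall>k<n. disc_int (\<lambda>z. cmod (g k z * (1 - (cmod z)\<^sup>2) ^ (n - k)) powr (p * q / (p - q))) < \<infinity>)"
  have s: "p * q / (p - q) > 0" and p: "p > 0" using assms by auto
  have c: "c \<longleftrightarrow> (\<forall>k<n. dint (\<lambda>z. (cmod (g k z) * bd z ^ (n - k)) powr (p * q / (p - q))) < \<infinity>)"
    unfolding c_def using disc_int_coefficient_iff[OF s] assms(2) by blast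
  have "compact_op p q (Ig n g) \<Longrightarrow> bounded_op p q (Ig n g)"
    by (rule compact_imp_bounded_op[OF _ assms(2) p assms(3)])
  moreover have "bounded_op p q (Ig n g) \<Longrightarrow> c"
    unfolding c using bounded_imp_coefficient_integrable[OF _ assms(2-4)] by blast
  moreover have "c \<Longrightarrow> compact_op p q (Ig n g)"
    unfolding c by (rule coefficient_integrable_imp_compact[OF assms(2-4) refl])
  ultimately show ?thesis unfolding c_def by blast
qed

end
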